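(* Let $P$ be an ideal Coxeter polytope with $n$ facets in hyperbolic $3$-space $\mathbb{H}^3$, let $(\Gamma,S)$ be the Coxeter system associated to $P$, and let $\tau$ be the growth rate of $P$, i.e. of $(\Gamma,S)$. Then $$n-3\le \tau\le n-1.$$
   Context: A polytope in hyperbolic $3$-space $\mathbb{H}^3$ is a closed domain $P\subset\mathbb{H}^3$ (with nonempty interior) of finite volume that can be written as the intersection $P=\bigcap H_B$ of finitely many closed half-spaces $H_B$ bounded by hyperplanes $B$ (totally geodesic planes), where for each such $B$ the set $F_B=P\cap B$ is a hyperbolic polygon in $B$. The sets $F_B$ are the facets of $P$. When two facets intersect in a geodesic (segment), this intersection is called an edge of $P$; the dihedral angle at an edge is the angle, measured inside $P$, between the two hyperplanes containing the two facets. A point of the boundary at infinity $\partial\mathbb{H}^3$ at which facets of $P$ meet is an ideal vertex of $P$. The polytope $P$ is ideal if all of its vertices are ideal, i.e. $P$ is the hyperbolic convex hull of finitely many points of $\partial\mathbb{H}^3$. It is a Coxeter polytope if the dihedral angle at each edge is of the form $\pi/k$ with $k\ge 2$ an integer. For a Coxeter polytope $P$, let $S$ be the set of reflections in the hyperplanes supporting its facets (one for each facet) and let $\Gamma$ be the discrete group of isometries of $\mathbb{H}^3$ generated by $S$; $(\Gamma,S)$ is the Coxeter system associated to $P$. The word length $\ell_S(x)$ of $x\in\Gamma$ is the smallest integer $k\ge 0$ such that $x=s_1s_2\cdots s_k$ for some $s_1,\dots,s_k\in S$. Let $a_k$ be the number of $x\in\Gamma$ with $\ell_S(x)=k$. The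 growth rate of $(\Gamma,S)$, also called the growth rate of $P$, is $\tau=\limsup_{k\to\infty}\sqrt[k]{a_k}$. *)

theory Defs
  imports "HOL-Analysis.Analysis" "HOL-Algebra.Bij" "HOL-Algebra.Generated_Groups"
begin

section \<open>The hyperboloid model\<close>

text \<open>
  Hyperbolic space of dimension \<open>DIM('a)\<close> is the upper sheet of the hyperboloid in Minkowski
  space \<open>real \<times> 'a\<close>; the first coordinate is the time coordinate.  We use \<open>'a = real ^ 3\<close>
  for the ambient space and \<open>'a = real ^ 2\<close> for the polygons that occur as facets.
\<close>

definition lorentz :: "real \<times> 'a::euclidean_space \<Rightarrow> real \<times> 'a \<Rightarrow> real" where
  "lorentz x y = snd x \<bullet> snd y - fst x * fst y"

definition hyp_space :: "(real \<times> 'a::euclidean_space) set" where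
  "hyp_space = {x. lorentz x x = -1 \<and> fst x > 0}"

definition hyp_dist :: "real \<times> 'a::euclidean_space \<Rightarrow> real \<times> 'a \<Rightarrow> real" where
  "hyp_dist x y = arcosh (- lorentz x y)"

text \<open>
  The hyperboloid is the graph of \<open>t = sqrt (1 + (norm u)\<^sup>2)\<close>, and in the coordinates \<open>u\<close> the
  Riemannian volume form is \<open>du / sqrt (1 + (norm u)\<^sup>2)\<close>.
\<close>

definition hyp_volume :: "(real \<times> 'a::euclidean_space) set \<Rightarrow> ennreal" where
  "hyp_volume A = (\<integral>\<^sup>+ u \<in> snd ` A. ennreal (1 / sqrt (1 + (norm u)\<^sup>2)) \<partial>lborel)"

text \<open>
  Unit spacelike vectors correspond bijectively to closed half-spaces: \<open>e\<close> is the unit normal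
  of the bounding hyperplane that points out of the half-space.
\<close>

definition unit_normals :: "(real \<times> 'a::euclidean_space) set" where
  "unit_normals = {e. lorentz e e = 1}"

definition hyp_plane :: "real \<times> 'a::euclidean_space \<Rightarrow> (real \<times> 'a) set" where
  "hyp_plane e = {x \<in> hyp_space. lorentz x e = 0}"

definition hyp_halfspace :: "real \<times> 'a::euclidean_space \<Rightarrow> (real \<times> 'a) set" where
  "hyp_halfspace e = {x \<in> hyp_space. lorentz x e \<le> 0}"

definition hyp_reflection :: "real \<times> 'a::euclidean_space \<Rightarrow> real \<times> 'a \<Rightarrow> real \<times> 'a" where
  "hyp_reflection e = (\<lambda>x\<in>hyp_space. x - (2 * lorentz x e) *\<^sub>R e)"


section \<open>Polytopes\<close>

text \<open>
  Connectedness is not required separately: it is automatic for intersections of half-spaces,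
  the only sets to which this predicate is applied.
\<close>

definition finite_volume_domain :: "(real \<times> 'a::euclidean_space) set \<Rightarrow> bool" where
  "finite_volume_domain P \<longleftrightarrow>
     P \<subseteq> hyp_space \<and> closedin (top_of_set hyp_space) P \<and>
     (top_of_set hyp_space) interior_of P \<noteq> {} \<and> hyp_volume P < \<infinity>"

definition halfspace_family ::
  "(real \<times> 'a::euclidean_space) set \<Rightarrow> (real \<times> 'a) set \<Rightarrow> bool" where
  "halfspace_family P E \<longleftrightarrow>
     finite E \<and> E \<subseteq> unit_normals \<and> P = hyp_space \<inter> (\<Inter>e\<in>E. hyp_halfspace e)"

text \<open>
  For polygons no condition on the sides is imposed: redundant half-planes can be dropped
  without changing the underlying set.
\<close>

definition hyp_polygon :: "(real \<times> (real ^ 2)) set \<Rightarrow> bool" where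
  "hyp_polygon Q \<longleftrightarrow> finite_volume_domain Q \<and> (\<exists>E. halfspace_family Q E)"

definition hyp_polygon_in :: "(real \<times> (real ^ 3)) set \<Rightarrow> (real \<times> (real ^ 3)) set \<Rightarrow> bool" where
  "hyp_polygon_in B F \<longleftrightarrow>
     (\<exists>\<phi> Q. bij_betw \<phi> hyp_space B \<and>
            (\<forall>x\<in>hyp_space. \<forall>y\<in>hyp_space. hyp_dist (\<phi> x) (\<phi> y) = hyp_dist x y) \<and>
            hyp_polygon Q \<and> F = \<phi> ` Q)"

text \<open>
  A polytope comes with the family \<open>E\<close> of outward unit normals of its bounding half-spaces.
  Since every \<open>P \<inter> hyp_plane e\<close> has to be a polygon, no half-space of the family is redundant.
\<close>

definition hyp_polytope :: "(real \<times> (real ^ 3)) set \<Rightarrow> (real \<times> (real ^ 3)) set \<Rightarrow> bool" where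
  "hyp_polytope P E \<longleftrightarrow>
     finite_volume_domain P \<and> halfspace_family P E \<and>
     (\<forall>e\<in>E. hyp_polygon_in (hyp_plane e) (P \<inter> hyp_plane e))"

definition facets :: "(real \<times> (real ^ 3)) set \<Rightarrow> (real \<times> (real ^ 3)) set \<Rightarrow> (real \<times> (real ^ 3)) set set" where
  "facets P E = (\<lambda>e. P \<inter> hyp_plane e) ` E"

text \<open>
  The intersection of two distinct facets is a convex subset of a geodesic line, so it is a
  (possibly unbounded) geodesic segment exactly when it contains two different points.
\<close>

definition meet_in_edge ::
  "(real \<times> (real ^ 3)) set \<Rightarrow> real \<times> (real ^ 3) \<Rightarrow> real \<times> (real ^ 3) \<Rightarrow> bool" where
  "meet_in_edge P e f \<longleftrightarrow>
     hyp_plane e \<noteq> hyp_plane f \<and>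
     (\<exists>x y. x \<noteq> y \<and> {x, y} \<subseteq> (P \<inter> hyp_plane e) \<inter> (P \<inter> hyp_plane f))"

text \<open>
  At a common point \<open>x\<close> of the two hyperplanes, \<open>e\<close> and \<open>f\<close> lie in the tangent space
  \<open>{v. lorentz x v = 0}\<close>, on which \<open>lorentz\<close> is the Riemannian metric.  The angle inside the
  polytope is supplementary to the angle between the outward normals.
\<close>

definition dihedral_angle :: "real \<times> (real ^ 3) \<Rightarrow> real \<times> (real ^ 3) \<Rightarrow> real" where
  "dihedral_angle e f = pi - arccos (lorentz e f)"

definition coxeter_polytope :: "(real \<times> (real ^ 3)) set \<Rightarrow> (real \<times> (real ^ 3)) set \<Rightarrow> bool" where
  "coxeter_polytope P E \<longleftrightarrow>
     hyp_polytope P E \<and>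
     (\<forall>e\<in>E. \<forall>f\<in>E. meet_in_edge P e f \<longrightarrow>
        (\<exists>k::nat. k \<ge> 2 \<and> dihedral_angle e f = pi / real k))"

text \<open>
  The boundary at infinity is identified with the unit sphere, \<open>u\<close> standing for the light ray
  through \<open>(1, u)\<close>.  Under the projection \<open>x \<mapsto> snd x / fst x\<close> to the Klein model, geodesics
  become straight chords of the unit ball, so hyperbolic convex hulls become Euclidean ones.
\<close>

definition ideal_hull :: "(real ^ 3) set \<Rightarrow> (real \<times> (real ^ 3)) set" where
  "ideal_hull V = {x \<in> hyp_space. snd x /\<^sub>R fst x \<in> convex hull V}"

definition ideal_polytope :: "(real \<times> (real ^ 3)) set \<Rightarrow> bool" where
  "ideal_polytope P \<longleftrightarrow> (\<exists>V. finite V \<and> V \<subseteq> sphere 0 1 \<and> P = ideal_hull V)"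


section \<open>Growth rates\<close>

definition word_length :: "('g, 'b) monoid_scheme \<Rightarrow> 'g set \<Rightarrow> 'g \<Rightarrow> nat" where
  "word_length G S x =
     (LEAST k. \<exists>w. length w = k \<and> set w \<subseteq> S \<and> x = foldr (mult G) w (one G))"

definition growth_coeff :: "('g, 'b) monoid_scheme \<Rightarrow> 'g set \<Rightarrow> nat \<Rightarrow> nat" where
  "growth_coeff G S k = card {x \<in> generate G S. word_length G S x = k}"

definition growth_rate :: "('g, 'b) monoid_scheme \<Rightarrow> 'g set \<Rightarrow> ereal" where
  "growth_rate G S = limsup (\<lambda>k. ereal (root k (real (growth_coeff G S k))))"

text \<open>
  The ambient group \<open>BijGroup hyp_space\<close> consists of the bijections of hyperbolic space onto
  itself; only its operations enter into the subgroup generated by the reflections.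
\<close>

definition polytope_growth_rate :: "(real \<times> (real ^ 3)) set \<Rightarrow> ereal" where
  "polytope_growth_rate E = growth_rate (BijGroup hyp_space) (hyp_reflection ` E)"

end

theory Submission
  imports Defs
begin

text \<open>
  Let \<open>f(x)\<close> be the growth series and write \<open>x = 1/t\<close>. Grouping the elements of \<open>\<Gamma>\<close> by their
  descent sets, and using the dihedral cosets of the pairs of facets that share an edge, one obtains a
  one-sided version of Steinberg's formula,
  \<open>1 \<le> f(x) (1 - n / (1 + t) + \<Sum> 1 / ((1 + t) (1 + t + \<dots> + t^(m - 1))))\<close>,
  where the sum runs over the edges and \<open>\<pi>/m\<close> is the dihedral angle. The elementary bound
  \<open>1 + t + \<dots> + t^(m - 1) \<ge> m (1 + t) / 2\<close> reduces the lower estimate to \<open>\<Sum> 1/m \<le> n - 2\<close>: the bracket is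
  then nonpositive at \<open>t = n - 3\<close>, so \<open>f\<close> diverges there. The links of the ideal vertices are Euclidean
  triangles and rectangles, so that a vertex on \<open>q\<close> facets contributes \<open>(q - 2)/2\<close> to \<open>\<Sum> 1/m\<close>, and one
  half of Euler's formula, proved by sweeping the polytope with a generic linear functional, bounds
  the sum of these contributions by \<open>n - 2\<close>. The descent sets are controlled by the positivity of
  roots, for which Andreev's theorem supplies \<open>lorentz e f \<le> -1\<close> whenever the facets \<open>e\<close> and \<open>f\<close> share
  no edge.
\<close>

section \<open>Groups generated by reflections\<close>

text \<open>More than four normals are linearly dependent in Minkowski space, so the sign of a root
  cannot be read off from coefficients. It is measured against the cone over the polytope instead
  (\<open>pos\<close>), which suffices to run the usual induction on length for the reflections
  themselves. The inequality in place of Steinberg's formula is a truncated inclusion-exclusion: an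
  element with \<open>d\<close> descents is counted \<open>1 - d + d * (d - 1) / 2\<close> times,
  which equals \<open>(d - 1) * (d - 2) / 2\<close>, hence is nonnegative, and is \<open>1\<close>
  at the identity. The whole count therefore rests on pairs of facets. After the bounds on edges and
  exponents the bracket is at most \<open>1 - n / s + 2 * (n - 2) / s^2\<close> with
  \<open>s = 1 + t\<close>. Its numerator is \<open>(s - 2) * (s - (n - 2))\<close>, and the root
  \<open>s = n - 2\<close> is the origin of \<open>n - 3\<close>. The upper estimate comes from the
  fact that every element other than the identity has a descent, so that a reduced word extends in
  at most \<open>n - 1\<close> ways.\<close>

fun alternating :: "'a \<Rightarrow> 'a \<Rightarrow> nat \<Rightarrow> 'a list" where
  "alternating a b 0 = []"
| "alternating a b (Suc j) = a # alternating b a j"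

text \<open>Descents concern the right end of a word, while the recursion builds it from the left.
  This is the letter that would be appended next, hence the last letter of
  \<open>alternating a b (Suc j)\<close>.\<close>

definition alternating_next :: "'a \<Rightarrow> 'a \<Rightarrow> nat \<Rightarrow> 'a" where
  "alternating_next a b j = (if even j then a else b)"

lemma alternating_next_0 [simp]: "alternating_next a b 0 = a"
  by (simp add: alternating_next_def)

lemma alternating_next_Suc [simp]: "alternating_next a b (Suc j) = alternating_next b a j"
  by (simp add: alternating_next_def)

lemma length_alternating [simp]: "length (alternating a b j) = j"
  by (induction j arbitrary: a b) auto

lemma set_alternating: "set (alternating a b j) \<subseteq> {a, b}"
  by (induction j arbitrary: a b) fastforce+

lemma alternating_snoc: "alternating a b (Suc j) = alternating a b j @ [alternating_next a b j]"
  by (induction j arbitrary: a b) auto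

lemma alternating_add:
  "alternating a b (i + j) =
     alternating a b i @ alternating (alternating_next a b i) (alternating_next b a i) j"
  by (induction i arbitrary: a b) auto

lemma alternating_next_add:
  "alternating_next (alternating_next a b i) (alternating_next b a i) j = alternating_next a b (i + j)"
  by (auto simp: alternating_next_def)

text \<open>Chebyshev polynomials of the second kind, with the index shifted by one. The recursion,
  unlike the quotient of sines, also covers arguments \<open>c \<ge> 1\<close>, which belong to
  pairs of facets without a common edge.\<close>

fun chebyshev_U :: "real \<Rightarrow> nat \<Rightarrow> real" where
  "chebyshev_U c 0 = 0"
| "chebyshev_U c (Suc 0) = 1"
| "chebyshev_U c (Suc (Suc k)) = 2 * c * chebyshev_U c (Suc k) - chebyshev_U c k"

lemma chebyshev_U_cos: "chebyshev_U (cos \<theta>) k * sin \<theta> = sin (real k * \<theta>)"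
proof (induction "cos \<theta>" k rule: chebyshev_U.induct)
  case (3 k)
  have "sin (real (Suc (Suc k)) * \<theta>) + sin (real k * \<theta>) = 2 * cos \<theta> * sin (real (Suc k) * \<theta>)"
  proof -
    have "real (Suc (Suc k)) * \<theta> = real (Suc k) * \<theta> + \<theta>" "real k * \<theta> = real (Suc k) * \<theta> - \<theta>"
      by (auto simp: algebra_simps)
    then show ?thesis
      by (simp add: sin_add sin_diff del: of_nat_Suc)
  qed
  with 3 show ?case
    by (simp add: algebra_simps)
qed auto

text \<open>Since \<open>2 * c \<ge> 2\<close>, the sequence is nondecreasing, so an infinite
  dihedral group never produces a negative coefficient.\<close>

lemma chebyshev_U_ge_1: "1 \<le> c \<Longrightarrow> 0 \<le> chebyshev_U c k \<and> chebyshev_U c k \<le> chebyshev_U c (Suc k)"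
proof (induction k)
  case (Suc k)
  then have "chebyshev_U c (Suc k) * 1 \<le> chebyshev_U c (Suc k) * c"
    by (intro mult_left_mono) auto
  with Suc show ?case
    by (simp add: mult.commute mult.left_commute)
qed auto

lemma sin_pi_div_pos: "2 \<le> m \<Longrightarrow> 0 < sin (pi / real m)"
  by (intro sin_gt_zero) (auto simp: field_simps)

lemma chebyshev_U_nonneg:
  assumes "2 \<le> m" "k \<le> m"
  shows "0 \<le> chebyshev_U (cos (pi / real m)) k"
proof -
  have "0 \<le> sin (real k * (pi / real m))"
    using assms by (intro sin_ge_zero) (auto simp: field_simps)
  with chebyshev_U_cos[of "pi / real m" k] sin_pi_div_pos[OF assms(1)] show ?thesis
    by (metis zero_le_mult_iff not_le less_eq_real_def)
qed

text \<open>These are the sines of \<open>pi\<close>, \<open>pi + pi / m\<close> and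
  \<open>pi - pi / m\<close>; the return to zero and the values next to it are what makes the two
  alternating words of length \<open>m\<close> agree.\<close>

lemma chebyshev_U_at:
  assumes "2 \<le> m"
  shows "chebyshev_U (cos (pi / real m)) m = 0"
    and "chebyshev_U (cos (pi / real m)) (Suc m) = -1"
    and "chebyshev_U (cos (pi / real m)) (m - 1) = 1"
proof -
  let ?\<theta> = "pi / real m"
  have s: "sin ?\<theta> \<noteq> 0"
    using sin_pi_div_pos[OF assms] by simp
  have "real m * ?\<theta> = pi" "real (Suc m) * ?\<theta> = pi + ?\<theta>" "real (m - 1) * ?\<theta> = pi - ?\<theta>"
    using assms by (auto simp: field_simps of_nat_diff)
  then have "chebyshev_U (cos ?\<theta>) m * sin ?\<theta> = 0 * sin ?\<theta>"
    "chebyshev_U (cos ?\<theta>) (Suc m) * sin ?\<theta> = (-1) * sin ?\<theta>"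
    "chebyshev_U (cos ?\<theta>) (m - 1) * sin ?\<theta> = 1 * sin ?\<theta>"
    unfolding chebyshev_U_cos by (simp_all add: sin_add sin_diff)
  with s show "chebyshev_U (cos ?\<theta>) m = 0" "chebyshev_U (cos ?\<theta>) (Suc m) = -1"
    "chebyshev_U (cos ?\<theta>) (m - 1) = 1"
    unfolding mult_cancel_right by simp_all
qed

text \<open>\<open>E\<close> holds the simple roots, possibly linearly dependent, and
  \<open>C\<close> consists of vectors on the nonpositive side of all of them. The exponent
  \<open>0\<close> stands for infinity, so that \<open>1 / real (m a b)\<close> is then
  \<open>0\<close>. \<open>form_separates\<close> takes the place of linear independence: it
  prevents a nonzero vector from being both positive and negative.\<close>

locale reflection_system =
  fixes B :: "'v::real_vector \<Rightarrow> 'v \<Rightarrow> real" and E C :: "'v set" and m :: "'v \<Rightarrow> 'v \<Rightarrow> nat"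
  assumes form_add: "B (x + y) z = B x z + B y z"
    and form_scaleR: "B (c *\<^sub>R x) z = c * B x z"
    and form_commute: "B x y = B y x"
    and finite_E: "finite E"
    and form_unit: "e \<in> E \<Longrightarrow> B e e = 1"
    and form_coxeter: "\<lbrakk>e \<in> E; f \<in> E; e \<noteq> f\<rbrakk> \<Longrightarrow>
           2 \<le> m e f \<and> B e f = - cos (pi / real (m e f)) \<or> m e f = 0 \<and> B e f \<le> -1"
    and exponent_commute: "m e f = m f e"
    and form_cone: "\<lbrakk>p \<in> C; e \<in> E\<rbrakk> \<Longrightarrow> B p e \<le> 0"
    and form_separates: "x \<noteq> 0 \<Longrightarrow> \<exists>p\<in>C. B p x \<noteq> 0"
begin

lemma form_add_right: "B x (y + z) = B x y + B x z"
  using form_add form_commute by metis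

lemma form_scaleR_right: "B x (c *\<^sub>R y) = c * B x y"
  using form_scaleR form_commute by metis

lemma form_minus: "B (- x) z = - B x z"
  using form_scaleR[of "-1" x z] by simp

lemma form_minus_right: "B x (- z) = - B x z"
  using form_minus form_commute by metis

lemma form_diff: "B (x - y) z = B x z - B y z"
  using form_add[of x "- y" z] by (simp add: form_minus)

definition refl :: "'v \<Rightarrow> 'v \<Rightarrow> 'v" where
  "refl e x = x - (2 * B x e) *\<^sub>R e"

lemma linear_refl: "linear (refl e)"
  by (rule linearI) (auto simp: refl_def form_add form_scaleR algebra_simps)

lemma refl_refl: "e \<in> E \<Longrightarrow> refl e (refl e x) = x"
  by (simp add: refl_def form_diff form_scaleR form_unit algebra_simps)

lemma refl_comp_refl: "e \<in> E \<Longrightarrow> refl e \<circ> refl e = id"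
  by (auto simp: refl_refl)

lemma refl_self: "e \<in> E \<Longrightarrow> refl e e = - e"
  by (simp add: refl_def form_unit scaleR_2)

section \<open>Words, the group they form, and the length function\<close>

primrec word_map :: "'v list \<Rightarrow> 'v \<Rightarrow> 'v" where
  "word_map [] = id"
| "word_map (e # w) = refl e \<circ> word_map w"

lemma word_map_append: "word_map (u @ w) = word_map u \<circ> word_map w"
  by (induction u) (auto simp: o_assoc)

lemma word_map_snoc: "word_map (u @ [s]) = word_map u \<circ> refl s"
  by (simp add: word_map_append)

lemma linear_word_map: "linear (word_map w)"
proof (induction w)
  case Nil
  then show ?case by (simp add: module_hom_ident id_def linear_iff)
next
  case (Cons e w)
  then show ?case
    using linear_compose[OF _ linear_refl] by (simp add: o_def)
qed

definition W :: "('v \<Rightarrow> 'v) set" where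
  "W = word_map ` lists E"

definition len :: "('v \<Rightarrow> 'v) \<Rightarrow> nat" where
  "len T = (LEAST k. \<exists>w. length w = k \<and> set w \<subseteq> E \<and> T = word_map w)"

lemma W_linear: "T \<in> W \<Longrightarrow> linear T"
  by (auto simp: W_def linear_word_map)

lemma word_map_in_W: "set w \<subseteq> E \<Longrightarrow> word_map w \<in> W"
  by (auto simp: W_def lists_eq_set)

lemma id_in_W: "id \<in> W"
  using word_map_in_W[of "[]"] by simp

lemma W_comp_word: "\<lbrakk>T \<in> W; set w \<subseteq> E\<rbrakk> \<Longrightarrow> T \<circ> word_map w \<in> W"
  by (auto simp: W_def lists_eq_set simp flip: word_map_append)

lemma W_comp_refl: "\<lbrakk>T \<in> W; s \<in> E\<rbrakk> \<Longrightarrow> T \<circ> refl s \<in> W"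
  using W_comp_word[of T "[s]"] by simp

lemma comp_refl_refl: "s \<in> E \<Longrightarrow> T \<circ> refl s \<circ> refl s = T"
  by (auto simp: refl_refl)

lemma len_le: "set w \<subseteq> E \<Longrightarrow> len (word_map w) \<le> length w"
  unfolding len_def by (rule Least_le) auto

lemma reduced_word: "T \<in> W \<Longrightarrow> \<exists>w. length w = len T \<and> set w \<subseteq> E \<and> T = word_map w"
proof -
  assume "T \<in> W"
  then have "\<exists>k w. length w = k \<and> set w \<subseteq> E \<and> T = word_map w"
    by (auto simp: W_def)
  from LeastI_ex[OF this] show ?thesis
    unfolding len_def .
qed

lemma len_comp_word: "\<lbrakk>T \<in> W; set w \<subseteq> E\<rbrakk> \<Longrightarrow> len (T \<circ> word_map w) \<le> len T + length w"
  using reduced_word[of T] len_le by (metis le_sup_iff length_append set_append word_map_append)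

lemma len_comp_refl: "\<lbrakk>T \<in> W; s \<in> E\<rbrakk> \<Longrightarrow> len (T \<circ> refl s) \<le> len T + 1"
  using len_comp_word[of T "[s]"] by simp

lemma len_le_comp_refl: "\<lbrakk>T \<in> W; s \<in> E\<rbrakk> \<Longrightarrow> len T \<le> len (T \<circ> refl s) + 1"
  using len_comp_refl[OF W_comp_refl] comp_refl_refl by metis

lemma len_id: "len id = 0"
  using len_le[of "[]"] by simp

lemma len_eq_0: "T \<in> W \<Longrightarrow> len T = 0 \<longleftrightarrow> T = id"
  using reduced_word[of T] by (auto simp: len_id)

lemma word_map_bij: "set w \<subseteq> E \<Longrightarrow> bij (word_map w)"
proof (induction w)
  case (Cons e w)
  have "bij (refl e)"
    using Cons by (intro o_bij[of "refl e"]) (auto simp: refl_comp_refl)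
  moreover have "bij (word_map w)"
    using Cons by simp
  ultimately show ?case
    unfolding word_map.simps by (rule bij_comp[rotated])
qed auto

lemma W_bij: "T \<in> W \<Longrightarrow> bij T"
  using word_map_bij by (auto simp: W_def lists_eq_set)

lemma W_nonzero: "\<lbrakk>T \<in> W; s \<in> E\<rbrakk> \<Longrightarrow> T s \<noteq> 0"
proof
  assume a: "T \<in> W" "s \<in> E" "T s = 0"
  then have "T 0 = 0" using W_linear linear_0 by blast
  with a have "s = 0" using W_bij by (metis bij_is_inj injD)
  with form_unit[OF \<open>s \<in> E\<close>] form_scaleR[of 0 0 0] show False by simp
qed

definition pos :: "'v \<Rightarrow> bool" where
  "pos y \<longleftrightarrow> (\<forall>p\<in>C. B p y \<le> 0)"

lemma pos_combination: "\<lbrakk>pos x; pos y; 0 \<le> a; 0 \<le> b\<rbrakk> \<Longrightarrow> pos (a *\<^sub>R x + b *\<^sub>R y)"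
  by (auto simp: pos_def form_add_right form_scaleR_right
      intro!: add_nonpos_nonpos mult_nonneg_nonpos)

lemma not_pos_both: "\<lbrakk>x \<noteq> 0; pos x\<rbrakk> \<Longrightarrow> \<not> pos (- x)"
  using form_separates[of x] by (force simp: pos_def form_minus_right)

lemma pos_E: "e \<in> E \<Longrightarrow> pos e"
  by (simp add: pos_def form_cone)

text \<open>One reflection acts on the coefficients exactly as one step of the Chebyshev recursion,
  so the signs of roots in the plane of \<open>a\<close> and \<open>b\<close> become signs of
  Chebyshev values.\<close>

lemma alternating_root:
  assumes "a \<in> E" "b \<in> E" "B a b = - c"
  shows "word_map (alternating a b j) (alternating_next a b j)
         = chebyshev_U c (Suc j) *\<^sub>R a + chebyshev_U c j *\<^sub>R b"
  using assms
proof (induction j arbitrary: a b)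
  case (Suc j)
  then have "B b a = - c" by (simp add: form_commute)
  with Suc have "word_map (alternating b a j) (alternating_next b a j)
         = chebyshev_U c (Suc j) *\<^sub>R b + chebyshev_U c j *\<^sub>R a"
    by blast
  moreover have "refl a (chebyshev_U c (Suc j) *\<^sub>R b + chebyshev_U c j *\<^sub>R a)
     = chebyshev_U c (Suc (Suc j)) *\<^sub>R a + chebyshev_U c (Suc j) *\<^sub>R b"
    using \<open>B b a = - c\<close> form_unit[OF \<open>a \<in> E\<close>]
    by (simp add: refl_def form_add form_scaleR algebra_simps flip: scaleR_2)
  ultimately show ?case by simp
qed simp

lemma word_map_fixes:
  "\<lbrakk>\<forall>e\<in>set w. B y e = 0\<rbrakk> \<Longrightarrow> word_map w y = y"
  by (induction w) (auto simp: refl_def)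

text \<open>For the first word the coefficients at \<open>k\<close> are \<open>-1\<close> and
  \<open>0\<close>. The second word ends in the very letter it is applied to, which flips the root,
  and the other \<open>k - 1\<close> letters send the unflipped root to \<open>a\<close>.\<close>

lemma braid_aux:
  assumes ab: "a \<in> E" "b \<in> E" and m: "2 \<le> k" "B a b = - cos (pi / real k)"
  shows "word_map (alternating a b k) (alternating_next a b k) = - a"
    and "word_map (alternating b a k) (alternating_next a b k) = - a"
proof -
  show "word_map (alternating a b k) (alternating_next a b k) = - a"
    using alternating_root[OF ab m(2)] chebyshev_U_at[OF m(1)] by simp
  obtain j where j: "k = Suc j" using m by (cases k) auto
  have n: "alternating_next b a j = alternating_next a b k" by (simp add: j)
  have nE: "alternating_next b a j \<in> E" using ab by (simp add: alternating_next_def)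
  have "B b a = - cos (pi / real k)" using m form_commute by simp
  from alternating_root[OF ab(2,1) this, of j] 
  have "word_map (alternating b a j) (alternating_next b a j) = a"
    using chebyshev_U_at[OF m(1)] by (simp add: j)
  then show "word_map (alternating b a k) (alternating_next a b k) = - a"
    unfolding n[symmetric] j alternating_snoc word_map_snoc
    using refl_self[OF nE] linear_neg[OF linear_word_map] by simp
qed

text \<open>Both maps agree on \<open>a\<close> and \<open>b\<close> and fix everything orthogonal
  to the two. This determines them, because the form is nondegenerate on the plane of
  \<open>a\<close> and \<open>b\<close>: its Gram determinant is the square of
  \<open>sin (pi / k)\<close>.\<close>

lemma braid_relation:
  assumes ab: "a \<in> E" "b \<in> E" and m: "2 \<le> k" "B a b = - cos (pi / real k)"
  shows "word_map (alternating a b k) = word_map (alternating b a k)"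
proof
  fix x
  let ?S = "word_map (alternating a b k)" and ?T = "word_map (alternating b a k)"
  let ?c = "B a b"
  have m': "B b a = - cos (pi / real k)" using m form_commute by simp
  have eq: "?S a = ?T a \<and> ?S b = ?T b"
    using braid_aux[OF ab m] braid_aux[OF ab(2,1) m(1) m']
    by (cases "even k") (auto simp: alternating_next_def)
  have c: "1 - ?c\<^sup>2 \<noteq> 0"
    using sin_pi_div_pos[OF m(1)] sin_squared_eq[of "pi / real k"] m(2) by fastforce
  \<comment> \<open>The solution of the Gram system, that is, the coefficients of the orthogonal
    projection of \<open>x\<close> to the plane of \<open>a\<close> and \<open>b\<close>.\<close>
  define \<alpha> \<beta> where "\<alpha> = (B x a - ?c * B x b) / (1 - ?c\<^sup>2)" and "\<beta> = (B x b - ?c * B x a) / (1 - ?c\<^sup>2)"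
  define y where "y = x - (\<alpha> *\<^sub>R a + \<beta> *\<^sub>R b)"
  have ya: "\<alpha> + \<beta> * ?c = B x a" and yb: "\<alpha> * ?c + \<beta> = B x b"
    using c unfolding \<alpha>_def \<beta>_def 
    by (simp_all add: divide_simps) (simp_all add: algebra_simps power2_eq_square)
  have "B y a = 0" "B y b = 0"
    using ya yb form_unit[OF ab(1)] form_unit[OF ab(2)] form_commute[of b a]
    by (simp_all add: y_def form_diff form_add form_scaleR)
  then have y: "?S y = y" "?T y = y"
    using set_alternating[of a b k] set_alternating[of b a k] by (auto intro!: word_map_fixes)
  have x: "x = y + (\<alpha> *\<^sub>R a + \<beta> *\<^sub>R b)" by (simp add: y_def)
  show "?S x = ?T x"
    unfolding x
    using y eq by (simp add: linear_add[OF linear_word_map] linear_scale[OF linear_word_map])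
qed

text \<open>By the braid relation the last \<open>k\<close> letters can be rewritten to end in the
  appended letter; the two cancel and \<open>j - 1\<close> letters remain.\<close>

lemma len_alternating_less:
  assumes T: "T \<in> W" and ab: "a \<in> E" "b \<in> E" and k: "2 \<le> k" "B a b = - cos (pi / real k)" "k \<le> j"
  shows "len (T \<circ> word_map (alternating a b j) \<circ> refl (alternating_next a b j)) < len T + j"
proof -
  obtain i where i: "j = i + k" using k(3) by (metis add.commute le_Suc_ex)
  define a' b' where "a' = alternating_next a b i" and "b' = alternating_next b a i"
  have ab': "a' \<in> E" "b' \<in> E" "B a' b' = - cos (pi / real k)"
    using ab k form_commute[of a b] by (auto simp: a'_def b'_def alternating_next_def)
  obtain l where l: "k = Suc l" using k by (cases k) auto
  have s: "alternating_next a b j = alternating_next b' a' l"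
    using alternating_next_add[of a b i k] by (simp add: i a'_def b'_def l)
  have sE: "alternating_next b' a' l \<in> E"
    using ab' by (simp add: alternating_next_def)
  have w: "word_map (alternating a b j) = word_map (alternating a b i) \<circ> word_map (alternating b' a' k)"
    using braid_relation[OF ab'(1,2) k(1) ab'(3)]
    by (simp add: i alternating_add word_map_append a'_def b'_def)
  have "word_map (alternating a b j) \<circ> refl (alternating_next a b j)
      = word_map (alternating a b i @ alternating b' a' l)"
    unfolding w s by (simp only: l alternating_snoc word_map_append word_map.simps comp_id comp_assoc
        refl_comp_refl[OF sE])
  then have eq: "T \<circ> word_map (alternating a b j) \<circ> refl (alternating_next a b j)
      = T \<circ> word_map (alternating a b i @ alternating b' a' l)"
    by (simp only: comp_assoc)
  have "set (alternating a b i @ alternating b' a' l) \<subseteq> E"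
    using set_alternating[of a b i] set_alternating[of b' a' l] ab ab' by auto
  from len_comp_word[OF T this] show ?thesis
    unfolding eq by (simp add: i l)
qed

lemma chebyshev_nonneg_upto:
  assumes "a \<in> E" "b \<in> E" "a \<noteq> b" "m a b = 0 \<or> j \<le> m a b"
  shows "0 \<le> chebyshev_U (- B a b) j"
  using form_coxeter[OF assms(1-3)] assms(4) chebyshev_U_nonneg chebyshev_U_ge_1
  by auto

text \<open>Induction on length. The last letter \<open>t\<close> of a reduced word is a descent
  while \<open>s\<close> is not, and \<open>T\<close> is split into \<open>v\<close> and an
  alternating word in \<open>s\<close> and \<open>t\<close> that is as long as possible. Then
  \<open>v\<close> is shorter and has neither letter as a descent, so both its images are positive,
  and \<open>T s\<close> combines them with Chebyshev coefficients.\<close>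

theorem ascent_pos:
  assumes "T \<in> W" "s \<in> E" "len T \<le> len (T \<circ> refl s)"
  shows "pos (T s)"
  using assms
proof (induction "len T" arbitrary: T s rule: less_induct)
  case less
  show ?case
  proof (cases "len T = 0")
    case True
    then show ?thesis using less len_eq_0 pos_E by simp
  next
    case False
    obtain w where w: "length w = len T" "set w \<subseteq> E" "T = word_map w"
      using reduced_word[OF less(2)] by blast
    with False have "w \<noteq> []" by auto
    then obtain u t where ut: "w = u @ [t]" by (meson rev_exhaust)
    \<comment> \<open>The alternating suffix has to be one that \<open>s\<close> would continue; the
      largest such \<open>j\<close> makes \<open>v\<close> shortest.\<close>
    define Q where "Q j \<longleftrightarrow> (\<exists>v a b. v \<in> W \<and> {a, b} = {s, t} \<and> alternating_next a b j = s \<and>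
        T = v \<circ> word_map (alternating a b j) \<and> len T = len v + j)" for j
    have tE: "t \<in> E" and uE: "set u \<subseteq> E" using w ut by auto
    have "len (word_map u) \<le> length u" using len_le uE by blast
    moreover have "len T \<le> len (word_map u) + 1"
      using w ut len_comp_refl[OF word_map_in_W[OF uE] tE] by (simp add: word_map_snoc)
    ultimately have "len T = len (word_map u) + 1" using w ut by simp
    then have "Q 1"
      unfolding Q_def using w ut uE word_map_in_W
      by (intro exI[of _ "word_map u"] exI[of _ t] exI[of _ s]) (auto simp: word_map_snoc)
    have bound: "\<forall>j. Q j \<longrightarrow> j \<le> len T" by (auto simp: Q_def)
    define j where "j = (GREATEST j. Q j)"
    have "Q j" unfolding j_def using \<open>Q 1\<close> bound by (blast intro: GreatestI_nat)
    have jmax: "j' \<le> j" if "Q j'" for j'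
      unfolding j_def using that bound by (blast intro: Greatest_le_nat)
    have "1 \<le> j" using jmax \<open>Q 1\<close> .
    obtain v a b where v: "v \<in> W" "{a, b} = {s, t}" "alternating_next a b j = s"
      "T = v \<circ> word_map (alternating a b j)" "len T = len v + j"
      using \<open>Q j\<close> by (auto simp: Q_def)
    have ab: "a \<in> E" "b \<in> E" using v(2) tE less(3) by auto
    have "s \<noteq> t"
    proof
      assume "s = t"
      then have "T \<circ> refl s = word_map u"
        using w ut tE by (auto simp: word_map_snoc refl_refl)
      then show False
        using less(4) \<open>len T = len (word_map u) + 1\<close> by simp
    qed
    then have "a \<noteq> b" using v(2) by fastforce
    \<comment> \<open>A descent \<open>b\<close> of \<open>v\<close> would extend the alternating
      word to the left, against maximality; a descent \<open>a\<close> would make \<open>T\<close>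
      shorter than its own length.\<close>
    have "len v \<le> len (v \<circ> refl b)"
    proof (rule ccontr)
      assume *: "\<not> len v \<le> len (v \<circ> refl b)"
      have eq: "T = v \<circ> refl b \<circ> word_map (alternating b a (Suc j))"
        using v(4) ab refl_refl by auto
      have "len T \<le> len (v \<circ> refl b) + Suc j"
        using len_comp_word[OF W_comp_refl[OF v(1) ab(2)], of "alternating b a (Suc j)"]
          set_alternating[of b a "Suc j"] ab unfolding eq by (metis empty_subsetI insert_subset length_alternating order_trans)
      with * v(5) have "len T = len (v \<circ> refl b) + Suc j" by simp
      then have "Q (Suc j)" 
        unfolding Q_def using eq v W_comp_refl[OF v(1) ab(2)]
        by (intro exI[of _ "v \<circ> refl b"] exI[of _ b] exI[of _ a]) auto
      then show False using jmax by fastforce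
    qed
    moreover have "len v \<le> len (v \<circ> refl a)"
    proof (rule ccontr)
      assume *: "\<not> len v \<le> len (v \<circ> refl a)"
      obtain i where i: "j = Suc i" using \<open>1 \<le> j\<close> by (cases j) auto
      have eq: "T = v \<circ> refl a \<circ> word_map (alternating b a i)"
        using v(4) i by auto
      have "len T \<le> len (v \<circ> refl a) + i"
        using len_comp_word[OF W_comp_refl[OF v(1) ab(1)], of "alternating b a i"]
          set_alternating[of b a i] ab unfolding eq by (metis empty_subsetI insert_subset length_alternating order_trans)
      with * v(5) i show False by simp
    qed
    moreover have "len v < len T" using v(5) \<open>1 \<le> j\<close> by simp
    ultimately have posab: "pos (v a)" "pos (v b)"
      using less(1) v(1) ab by blast+
    \<comment> \<open>With \<open>m a b\<close> or more letters, appending \<open>s\<close> would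
      shorten \<open>T\<close>. So the indices stay where the Chebyshev values are
      nonnegative.\<close>
    have "m a b = 0 \<or> Suc j \<le> m a b"
    proof (rule ccontr)
      assume "\<not> ?thesis"
      then have "2 \<le> m a b" "B a b = - cos (pi / real (m a b))" "m a b \<le> j"
        using form_coxeter[OF ab \<open>a \<noteq> b\<close>] by auto
      from len_alternating_less[OF v(1) ab this] show False
        using v(3,4,5) less(4) by simp
    qed
    then have "0 \<le> chebyshev_U (- B a b) (Suc j)" "0 \<le> chebyshev_U (- B a b) j"
      using chebyshev_nonneg_upto[OF ab \<open>a \<noteq> b\<close>] by auto
    moreover have "T s = chebyshev_U (- B a b) (Suc j) *\<^sub>R v a + chebyshev_U (- B a b) j *\<^sub>R v b"
      using alternating_root[OF ab, of "- B a b" j] v(3,4) W_linear[OF v(1)]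
      by (simp add: linear_add linear_scale)
    ultimately show ?thesis using pos_combination posab by simp
  qed
qed

section \<open>Descent sets\<close>

definition descents :: "('v \<Rightarrow> 'v) \<Rightarrow> 'v set" where
  "descents T = {s \<in> E. len (T \<circ> refl s) < len T}"

lemma descent_neg:
  assumes "T \<in> W" "s \<in> E" "len (T \<circ> refl s) \<le> len T"
  shows "pos (- T s)"
proof -
  have "pos ((T \<circ> refl s) s)"
    using ascent_pos[OF W_comp_refl[OF assms(1,2)] assms(2)] assms(3) comp_refl_refl[OF assms(2), of T]
    by simp
  then show ?thesis
    using refl_self[OF assms(2)] linear_neg[OF W_linear[OF assms(1)]] by simp
qed

text \<open>With equal lengths \<open>s\<close> would be treated both as an ascent and as a descent,
  and \<open>T s\<close> and \<open>- T s\<close> would both be positive. Positivity thus plays the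
  part of the usual parity argument.\<close>

lemma len_comp_refl_ne: "\<lbrakk>T \<in> W; s \<in> E\<rbrakk> \<Longrightarrow> len (T \<circ> refl s) \<noteq> len T"
  using ascent_pos descent_neg not_pos_both W_nonzero by (metis order_refl)

lemma len_descent: "\<lbrakk>T \<in> W; s \<in> descents T\<rbrakk> \<Longrightarrow> len T = len (T \<circ> refl s) + 1"
  using len_le_comp_refl[of T s] by (auto simp: descents_def)

lemma len_ascent: "\<lbrakk>T \<in> W; s \<in> E; s \<notin> descents T\<rbrakk> \<Longrightarrow> len (T \<circ> refl s) = len T + 1"
  using len_comp_refl[of T s] len_comp_refl_ne[of T s] by (force simp: descents_def)

lemma neg_descent: "\<lbrakk>T \<in> W; s \<in> E; pos (- T s)\<rbrakk> \<Longrightarrow> s \<in> descents T"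
  using ascent_pos[of T s] not_pos_both[of "T s"] W_nonzero[of T s] by (force simp: descents_def)

lemma refl_not_descent: "\<lbrakk>T \<in> W; s \<in> descents T\<rbrakk> \<Longrightarrow> s \<notin> descents (T \<circ> refl s)"
  using comp_refl_refl[of s T] by (auto simp: descents_def)

lemma refl_descent: "\<lbrakk>T \<in> W; s \<in> E; s \<notin> descents T\<rbrakk> \<Longrightarrow> s \<in> descents (T \<circ> refl s)"
  using comp_refl_refl[of s T] len_ascent[of T s] by (auto simp: descents_def)

end

text \<open>In each pair \<open>t ^ i\<close>, \<open>t ^ (k - 1 - i)\<close> one exponent is
  nonzero, so the pair sums to at least \<open>1 + t\<close>. For \<open>k = 2\<close> there is
  equality, so right angles lose nothing.\<close>

lemma geometric_sum_ge:
  assumes "1 \<le> (t::real)" "2 \<le> k"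
  shows "real k * (1 + t) \<le> 2 * (\<Sum>i<k. t ^ i)"
proof -
  have "(\<Sum>i<k. t ^ i) = (\<Sum>i<k. t ^ (k - 1 - i))"
    by (subst sum.nat_diff_reindex[symmetric]) (simp add: diff_diff_eq add.commute)
  then have "2 * (\<Sum>i<k. t ^ i) = (\<Sum>i<k. t ^ i + t ^ (k - 1 - i))"
    by (simp add: sum.distrib)
  also have "\<dots> \<ge> (\<Sum>i<k. 1 + t)"
  proof (intro sum_mono)
    fix i assume "i \<in> {..<k}"
    then have "i \<noteq> 0 \<or> k - 1 - i \<noteq> 0" using assms by auto
    moreover have "1 \<le> t ^ j \<and> (j \<noteq> 0 \<longrightarrow> t \<le> t ^ j)" for j
      using assms power_increasing[of 1 j t] by auto
    ultimately show "1 + t \<le> t ^ i + t ^ (k - 1 - i)"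
      by (metis add_mono add.commute)
  qed
  finally show ?thesis by simp
qed

lemma has_sum_finite_sum:
  fixes f :: "'a \<Rightarrow> 'b \<Rightarrow> 'c::{topological_ab_group_add, t2_space}"
  assumes "finite I" "\<And>i. i \<in> I \<Longrightarrow> (f i has_sum s i) A"
  shows "((\<lambda>x. \<Sum>i\<in>I. f i x) has_sum (\<Sum>i\<in>I. s i)) A"
  using assms by (induction I) (auto intro: has_sum_add)

section \<open>Dihedral cosets and the one-sided Steinberg formula\<close>

context reflection_system
begin

text \<open>Here \<open>- T a\<close> and \<open>- T b\<close> are positive, and so is minus the
  image of every next letter while the Chebyshev coefficients are nonnegative. Thus \<open>T\<close>
  is the top of its coset by the group of \<open>a\<close> and \<open>b\<close>, and alternating
  words descend from it step by step.\<close>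

lemma descent_chain:
  assumes T: "T \<in> W" "a \<in> descents T" "b \<in> descents T" and "a \<noteq> b"
    and "m a b = 0 \<or> j \<le> m a b"
  shows "len (T \<circ> word_map (alternating a b j)) + j = len T"
    and "m a b = 0 \<or> j < m a b \<Longrightarrow> alternating_next a b j \<in> descents (T \<circ> word_map (alternating a b j))"
proof -
  have ab: "a \<in> E" "b \<in> E" using T by (auto simp: descents_def)
  have neg: "pos (- T a)" "pos (- T b)"
    using T ab by (simp_all add: descent_neg descents_def)
  have in_W: "T \<circ> word_map (alternating a b j) \<in> W" for j
    using set_alternating[of a b j] ab by (intro W_comp_word T) auto
  show desc: "alternating_next a b j \<in> descents (T \<circ> word_map (alternating a b j))"
    if "m a b = 0 \<or> j < m a b" for j
  proof -
    have "0 \<le> chebyshev_U (- B a b) (Suc j)" "0 \<le> chebyshev_U (- B a b) j"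
      using that by (auto intro!: chebyshev_nonneg_upto ab \<open>a \<noteq> b\<close>)
    then have "pos (chebyshev_U (- B a b) (Suc j) *\<^sub>R - T a + chebyshev_U (- B a b) j *\<^sub>R - T b)"
      by (intro pos_combination neg)
    also have "chebyshev_U (- B a b) (Suc j) *\<^sub>R - T a + chebyshev_U (- B a b) j *\<^sub>R - T b
      = - (T \<circ> word_map (alternating a b j)) (alternating_next a b j)"
      using alternating_root[OF ab, of "- B a b" j] W_linear[OF T(1)]
      by (simp add: linear_add linear_scale)
    finally show ?thesis
      using ab by (intro neg_descent in_W) (auto simp: alternating_next_def)
  qed
  show "len (T \<circ> word_map (alternating a b j)) + j = len T"
    using assms(5)
  proof (induction j)
    case (Suc j)
    then have 1: "len (T \<circ> word_map (alternating a b j)) = len (T \<circ> word_map (alternating a b j) \<circ> refl (alternating_next a b j)) + 1"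
      by (intro len_descent in_W desc) auto
    have 2: "T \<circ> word_map (alternating a b j) \<circ> refl (alternating_next a b j)
        = T \<circ> word_map (alternating a b (Suc j))"
      by (simp only: alternating_snoc word_map_snoc comp_assoc)
    have "len (T \<circ> word_map (alternating a b j)) + j = len T"
      using Suc by linarith
    with 1[unfolded 2] show ?case
      by linarith
  qed simp
qed

definition descents_both :: "'v \<Rightarrow> 'v \<Rightarrow> ('v \<Rightarrow> 'v) set" where
  "descents_both a b = {T \<in> W. a \<in> descents T \<and> b \<in> descents T}"

lemma descents_both_commute: "descents_both a b = descents_both b a"
  by (auto simp: descents_both_def)

text \<open>With exponent \<open>0\<close> the descent from \<open>T\<close> would never stop, but
  it cannot take more than \<open>len T\<close> steps.\<close>

lemma descents_both_empty:
  assumes "a \<noteq> b" "m a b = 0"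
  shows "descents_both a b = {}"
proof -
  have "T \<notin> descents_both a b" for T
    using descent_chain(1)[of T a b "Suc (len T)"] assms by (auto simp: descents_both_def)
  then show ?thesis by blast
qed

lemma last_letter_ascent:
  assumes "T \<in> descents_both a b" "a \<noteq> b" "m a b = 0 \<or> Suc j \<le> m a b"
  shows "alternating_next a b j \<notin> descents (T \<circ> word_map (alternating a b (Suc j)))"
proof -
  have T: "T \<in> W" "a \<in> descents T" "b \<in> descents T" "a \<in> E" "b \<in> E"
    using assms by (auto simp: descents_both_def descents_def)
  have "T \<circ> word_map (alternating a b j) \<in> W"
    using set_alternating[of a b j] T by (intro W_comp_word T) auto
  moreover have "alternating_next a b j \<in> descents (T \<circ> word_map (alternating a b j))"
    using assms T by (intro descent_chain) auto
  ultimately have "alternating_next a b j \<notin>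
      descents (T \<circ> word_map (alternating a b j) \<circ> refl (alternating_next a b j))"
    by (rule refl_not_descent)
  then show ?thesis
    by (simp add: alternating_snoc word_map_snoc comp_assoc del: alternating.simps)
qed

text \<open>Strictly between the ends of its coset an element has exactly one of \<open>a\<close>
  and \<open>b\<close> as a descent, so the last letter can be read off and stripped. Neither word
  runs out before the other, since \<open>T\<close> and \<open>T'\<close> have both
  descents.\<close>

lemma alternating_unique:
  assumes "T \<in> descents_both a b" "T' \<in> descents_both a b" "a \<noteq> b"
    and "{x, y} = {a, b}" "{x', y'} = {a, b}"
    and "T \<circ> word_map (alternating x y (Suc j)) = T' \<circ> word_map (alternating x' y' (Suc j'))"
    and "Suc j < m a b" "Suc j' < m a b"
  shows "T = T' \<and> j = j' \<and> x = x'"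
  using assms(6-8)
proof (induction j arbitrary: j')
  have D: "T \<in> descents_both x y" "T' \<in> descents_both x' y'" "x \<noteq> y" "x' \<noteq> y'"
    and m: "m x y = m a b" "m x' y' = m a b" 
    using assms(1-5) descents_both_commute exponent_commute by (auto simp: doubleton_eq_iff)
  have E: "x \<in> E" "y \<in> E" "x' \<in> E" "y' \<in> E"
    using D by (auto simp: descents_both_def descents_def)
  have step: "alternating_next x y j = alternating_next x' y' j' \<and>
      T \<circ> word_map (alternating x y j) = T' \<circ> word_map (alternating x' y' j')"
    if eq: "T \<circ> word_map (alternating x y (Suc j)) = T' \<circ> word_map (alternating x' y' (Suc j'))"
      and less: "Suc j < m a b" "Suc j' < m a b" for j j'
  proof -
    let ?Y = "T \<circ> word_map (alternating x y (Suc j))"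
    have "alternating_next x y j \<notin> descents ?Y"
      using D m less by (intro last_letter_ascent) auto
    moreover have "alternating_next x' y' (Suc j') \<in> descents ?Y"
      unfolding eq using D m less by (intro descent_chain) (auto simp: descents_both_def)
    ultimately have *: "alternating_next x y j = alternating_next x' y' j'"
      using assms(4,5) by (auto simp: alternating_next_def doubleton_eq_iff split: if_splits)
    have "alternating_next x y j \<in> E" using E by (simp add: alternating_next_def)
    then have "T \<circ> word_map (alternating x y j) = ?Y \<circ> refl (alternating_next x y j)"
      "T' \<circ> word_map (alternating x' y' j') =
        T' \<circ> word_map (alternating x' y' (Suc j')) \<circ> refl (alternating_next x' y' j')"
      unfolding alternating_snoc word_map_snoc using *
      by (simp_all add: comp_assoc refl_comp_refl)
    with eq * show ?thesis by simp
  qed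
  have no0: False if "T = T' \<circ> word_map (alternating x' y' (Suc i))" "Suc i < m a b" for i
  proof -
    have "alternating_next x' y' i \<notin> descents T"
      unfolding that using D m that by (intro last_letter_ascent) auto
    then show False using assms(1,5) 
      by (auto simp: descents_both_def alternating_next_def doubleton_eq_iff split: if_splits)
  qed
  have no0': False if "T' = T \<circ> word_map (alternating x y (Suc i))" "Suc i < m a b" for i
  proof -
    have "alternating_next x y i \<notin> descents T'"
      unfolding that using D m that by (intro last_letter_ascent) auto
    then show False using assms(2,4) 
      by (auto simp: descents_both_def alternating_next_def doubleton_eq_iff split: if_splits)
  qed
  {
    case 0
    show ?case
    proof (cases j')
      case 0
      with step[OF "0.prems"] show ?thesis by simp
    next
      case (Suc i)
      with step[OF "0.prems"] no0[of i] "0.prems" show ?thesis by simp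
    qed
  next
    case (Suc j)
    show ?case
    proof (cases j')
      case 0
      with step[OF "Suc.prems"] no0'[of j] "Suc.prems" show ?thesis by simp
    next
      case j': (Suc i)
      have "T \<circ> word_map (alternating x y (Suc j)) = T' \<circ> word_map (alternating x' y' (Suc i))"
        using step[OF "Suc.prems"] unfolding j' by blast
      from Suc.IH[OF this] have "T = T' \<and> j = i \<and> x = x'"
        using Suc.prems(2,3) j' by linarith
      then show ?thesis by (simp add: j')
    qed
  }
qed

text \<open>One word for each element of a finite dihedral group: the identity and the longest
  element, which both starting letters would produce, are listed only among the words starting from
  \<open>a\<close>.\<close>

definition dihedral_words :: "'v \<Rightarrow> 'v \<Rightarrow> 'v list set" where
  "dihedral_words a b = alternating a b ` {..m a b} \<union> alternating b a ` {1..<m a b}"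

lemma dihedral_words_cases:
  assumes "w \<in> dihedral_words a b"
  obtains "w = []" | "w = alternating a b (m a b)" "0 < m a b"
    | x y j where "{x, y} = {a, b}" "w = alternating x y (Suc j)" "Suc j < m a b"
proof -
  consider j where "w = alternating a b j" "j \<le> m a b" | j where "w = alternating b a j" "1 \<le> j" "j < m a b"
    using assms by (auto simp: dihedral_words_def)
  then show ?thesis
  proof cases
    case 1
    then show ?thesis
      using that(1,2) that(3)[of a b "j - 1"] by (cases "j = 0"; cases "j = m a b") auto
  next
    case 2
    then show ?thesis
      using that(3)[of b a "j - 1"] by (cases j) auto
  qed
qed

text \<open>The descents among \<open>a\<close> and \<open>b\<close> show where an element sits in
  its coset: both at the top, none at the bottom, exactly one in between. Within one of these levels
  \<open>T\<close> is recovered by cancellation or by \<open>alternating_unique\<close>.\<close>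

lemma dihedral_words_inj:
  assumes "a \<noteq> b" "0 < m a b"
  shows "inj_on (\<lambda>(T, w). T \<circ> word_map w) (descents_both a b \<times> dihedral_words a b)"
proof -
  let ?k = "m a b"
  have mid: "\<exists>s\<in>{a, b}. s \<in> descents (T \<circ> word_map (alternating x y (Suc j)))"
    "\<exists>s\<in>{a, b}. s \<notin> descents (T \<circ> word_map (alternating x y (Suc j)))"
    if "T \<in> descents_both a b" "{x, y} = {a, b}" "Suc j < ?k" for T x y j
  proof -
    have *: "T \<in> descents_both x y" "x \<noteq> y" "m x y = ?k"
      using that assms descents_both_commute exponent_commute by (auto simp: doubleton_eq_iff)
    then have "alternating_next x y (Suc j) \<in> descents (T \<circ> word_map (alternating x y (Suc j)))"
      using that by (intro descent_chain) (auto simp: descents_both_def)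
    moreover have "alternating_next x y j \<notin> descents (T \<circ> word_map (alternating x y (Suc j)))"
      using that * by (intro last_letter_ascent) auto
    moreover have "alternating_next x y (Suc j) \<in> {a, b}" "alternating_next x y j \<in> {a, b}"
      unfolding that(2)[symmetric] by (auto simp: alternating_next_def)
    ultimately show "\<exists>s\<in>{a, b}. s \<in> descents (T \<circ> word_map (alternating x y (Suc j)))"
    "\<exists>s\<in>{a, b}. s \<notin> descents (T \<circ> word_map (alternating x y (Suc j)))" by blast+
  qed
  \<comment> \<open>The bottom element has two expressions with different last letters, by the braid
    relation, and neither letter is a descent.\<close>
  have bot: "{a, b} \<inter> descents (T \<circ> word_map (alternating a b ?k)) = {}"
    if T: "T \<in> descents_both a b" for T
  proof -
    obtain i where i: "?k = Suc i" using assms by (cases ?k) auto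
    have ab: "a \<in> E" "b \<in> E" using T by (auto simp: descents_both_def descents_def)
    then have "2 \<le> ?k" "B a b = - cos (pi / real ?k)" using form_coxeter[OF ab] assms by auto
    note braid = braid_relation[OF ab this]
    have "alternating_next a b i \<notin> descents (T \<circ> word_map (alternating a b ?k))"
      unfolding i using T assms i by (intro last_letter_ascent) auto
    moreover have "alternating_next b a i \<notin> descents (T \<circ> word_map (alternating b a ?k))"
      unfolding i using T assms i exponent_commute[of a b] descents_both_commute[of a b]
      by (intro last_letter_ascent) auto
    ultimately show ?thesis
      unfolding braid by (auto simp: alternating_next_def split: if_splits)
  qed
  have top: "{a, b} \<subseteq> descents T" if "T \<in> descents_both a b" for T
    using that by (auto simp: descents_both_def)
  have "T = T' \<and> w = w'"
    if D: "T \<in> descents_both a b" "T' \<in> descents_both a b"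
      and w: "w \<in> dihedral_words a b" "w' \<in> dihedral_words a b"
      and eq: "T \<circ> word_map w = T' \<circ> word_map w'" for T T' w w'
    using w(1)
  proof (cases rule: dihedral_words_cases)
    case 1
    with eq have eq: "T = T' \<circ> word_map w'" by simp
    from w(2) show ?thesis
    proof (cases rule: dihedral_words_cases)
      case 2
      with bot[OF D(2)] top[OF D(1)] eq show ?thesis by auto
    next
      case (3 x y j)
      with mid(2)[OF D(2) 3(1,3)] top[OF D(1)] eq show ?thesis by auto
    qed (use 1 eq in auto)
  next
    case 2
    note w1 = this
    from w(2) show ?thesis
    proof (cases rule: dihedral_words_cases)
      case 1
      with bot[OF D(1)] top[OF D(2)] eq w1 show ?thesis by auto
    next
      case 2
      have "a \<in> E" "b \<in> E" using D by (auto simp: descents_both_def descents_def)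
      then have "bij (word_map w)"
        using w1 set_alternating[of a b ?k] by (intro word_map_bij) auto
      with eq 2 w1 have "T = T'" by (metis bij_is_surj surj_fun_eq fun.inj_map_strong comp_apply surjD ext)
      with 2 w1 show ?thesis by simp
    next
      case (3 x y j)
      with mid(1)[OF D(2) 3(1,3)] bot[OF D(1)] eq w1 show ?thesis by auto
    qed
  next
    case (3 x y j)
    note w1 = this
    from w(2) show ?thesis
    proof (cases rule: dihedral_words_cases)
      case 1
      with mid(2)[OF D(1) w1(1,3)] top[OF D(2)] eq w1 show ?thesis by auto
    next
      case 2
      with mid(1)[OF D(1) w1(1,3)] bot[OF D(2)] eq w1 show ?thesis by auto
    next
      case (3 x' y' j')
      have "T = T' \<and> j = j' \<and> x = x'"
        using alternating_unique[OF D assms(1) w1(1) 3(1)] eq w1 3 by blast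
      moreover from this have "y = y'" using w1(1) 3(1) by (auto simp: doubleton_eq_iff)
      ultimately show ?thesis using w1 3 by simp
    qed
  qed
  then show ?thesis
    by (intro inj_onI) auto
qed

text \<open>The right-hand side is the growth polynomial of the dihedral group of order
  \<open>2 * m a b\<close>.\<close>

lemma sum_dihedral_words:
  fixes t :: real
  assumes "a \<noteq> b" "2 \<le> m a b"
  shows "(\<Sum>w\<in>dihedral_words a b. t ^ length w) = (1 + t) * (\<Sum>i<m a b. t ^ i)"
proof -
  obtain k where k: "m a b = Suc (Suc k)" using assms by (metis add_2_eq_Suc le_Suc_ex)
  have inj: "inj_on (alternating x y) A" for x y :: 'v and A
    by (rule inj_on_inverseI[of _ length]) simp
  have "alternating a b i \<noteq> alternating b a j" if "1 \<le> j" for i j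
  proof
    assume eq: "alternating a b i = alternating b a j"
    from arg_cong[OF this, of length] have "i = j" by simp
    with eq assms(1) that show False by (cases j) auto
  qed
  then have "alternating a b ` {..m a b} \<inter> alternating b a ` {1..<m a b} = {}"
    by force
  then have "(\<Sum>w\<in>dihedral_words a b. t ^ length w) = (\<Sum>i\<le>m a b. t ^ i) + (\<Sum>i\<in>{1..<m a b}. t ^ i)"
    unfolding dihedral_words_def by (simp add: sum.union_disjoint sum.reindex[OF inj] o_def)
  also have "(\<Sum>i\<in>{1..<m a b}. t ^ i) = (\<Sum>i<m a b. t ^ i) - 1"
    using sum.atLeast_Suc_lessThan[of 0 "m a b" "\<lambda>i. t ^ i"] assms by (simp add: atLeast0LessThan)
  also have "(\<Sum>i\<le>m a b. t ^ i) = 1 + t * (\<Sum>i<m a b. t ^ i)"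
    by (simp add: sum.atMost_shift sum_distrib_left)
  finally show ?thesis by (simp add: algebra_simps)
qed


lemma finite_descents: "finite (descents T)"
  using finite_E by (simp add: descents_def)

lemma descents_id: "descents id = {}"
  by (simp add: descents_def len_id)

section \<open>Weights at a point where the growth series converges\<close>

context
  fixes t :: real
  assumes t: "1 \<le> t"
    and summable: "(\<lambda>T. (1 / t) ^ len T) summable_on W"
begin

abbreviation weight :: "('v \<Rightarrow> 'v) \<Rightarrow> real" where
  "weight T \<equiv> (1 / t) ^ len T"

lemma weight_nonneg: "0 \<le> weight T"
  using t by simp

lemma summable_weight_subset: "X \<subseteq> W \<Longrightarrow> weight summable_on X"
  using summable summable_on_subset_banach by blast

lemma sum_weight_le: "\<lbrakk>finite F; F \<subseteq> X; X \<subseteq> W\<rbrakk> \<Longrightarrow> sum weight F \<le> infsum weight X"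
  using weight_nonneg by (intro finite_sum_le_infsum summable_weight_subset) auto

text \<open>Right multiplication by \<open>s\<close> injects the elements without descent
  \<open>s\<close> into those with it and adds one to the length, so the former weigh at most
  \<open>t\<close> times the latter.\<close>

lemma total_weight_le:
  assumes s: "s \<in> E"
  shows "infsum weight W \<le> (1 + t) * infsum weight {T \<in> W. s \<in> descents T}"
proof (rule infsum_le_finite_sums[OF summable])
  fix F assume F: "finite F" "F \<subseteq> W"
  let ?D = "{T \<in> W. s \<in> descents T}"
  have eq: "sum weight (F - ?D) = t * (\<Sum>T\<in>F - ?D. weight (T \<circ> refl s))"
    unfolding sum_distrib_left
  proof (rule sum.cong)
    fix T assume "T \<in> F - ?D"
    then have "len (T \<circ> refl s) = len T + 1" using F s by (intro len_ascent) auto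
    then show "weight T = t * weight (T \<circ> refl s)" using t by (simp only:) simp
  qed simp
  have "(\<Sum>T\<in>F - ?D. weight (T \<circ> refl s)) = sum weight ((\<lambda>T. T \<circ> refl s) ` (F - ?D))"
    by (rule sum.reindex_cong[symmetric, OF _ refl refl])
      (rule inj_on_inverseI[of _ "\<lambda>T. T \<circ> refl s"], rule comp_refl_refl[OF s])
  also have "\<dots> \<le> infsum weight ?D"
    using F s refl_descent W_comp_refl by (intro sum_weight_le) auto
  finally have "sum weight (F - ?D) \<le> t * infsum weight ?D"
    unfolding eq using t by (intro mult_left_mono) auto
  moreover have "sum weight (F \<inter> ?D) \<le> infsum weight ?D"
    using F by (intro sum_weight_le) auto
  moreover have "sum weight F = sum weight (F \<inter> ?D) + sum weight (F - ?D)"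
    by (rule sum.Int_Diff[OF F(1)])
  ultimately show "sum weight F \<le> (1 + t) * infsum weight ?D"
    unfolding distrib_right by linarith
qed

text \<open>Each such \<open>T\<close> is the top of a coset with weights
  \<open>weight T * t ^ length w\<close>. The cosets do not overlap, so the weight of the tops times
  the dihedral growth polynomial is at most the whole series. For exponent \<open>0\<close> both
  sides vanish, because \<open>2 / 0 = 0\<close>.\<close>

lemma weight_descents_both_le:
  assumes ab: "a \<in> E" "b \<in> E" "a \<noteq> b"
  shows "infsum weight (descents_both a b) \<le> 2 / real (m a b) / (1 + t)\<^sup>2 * infsum weight W"
proof (cases "m a b = 0")
  case True
  then show ?thesis using descents_both_empty[OF ab(3)] by simp
next
  case False
  then have k: "2 \<le> m a b" using form_coxeter[OF ab] by auto
  let ?D = "descents_both a b" and ?J = "dihedral_words a b"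
  have DW: "?D \<subseteq> W" by (auto simp: descents_both_def)
  let ?Z = "(1 + t) * (\<Sum>i<m a b. t ^ i)"
  have Z: "?Z \<ge> (1 + t)\<^sup>2 * (real (m a b) / 2)"
    using mult_left_mono[OF geometric_sum_ge[OF t k], of "1 + t"] t
    by (simp add: power2_eq_square algebra_simps)
  moreover have "0 < (1 + t)\<^sup>2 * (real (m a b) / 2)" using t k by simp
  ultimately have Zpos: "0 < ?Z" by linarith
  have "infsum weight ?D \<le> infsum weight W / ?Z"
  proof (rule infsum_le_finite_sums[OF summable_weight_subset[OF DW]])
    fix F assume F: "finite F" "F \<subseteq> ?D"
    have finJ: "finite ?J" by (simp add: dihedral_words_def)
    have JE: "set w \<subseteq> E" if "w \<in> ?J" for w
      using that ab set_alternating by (fastforce simp: dihedral_words_def)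
    have len: "len T = len (T \<circ> word_map w) + length w" if "T \<in> ?D" "w \<in> ?J" for T w
    proof -
      consider j where "w = alternating a b j" "j \<le> m a b" | j where "w = alternating b a j" "j \<le> m a b"
        using \<open>w \<in> ?J\<close> by (auto simp: dihedral_words_def)
      then show ?thesis
        using descent_chain(1)[of T a b] descent_chain(1)[of T b a] \<open>T \<in> ?D\<close> ab exponent_commute[of a b]
        by cases (auto simp: descents_both_def)
    qed
    have w: "weight (T \<circ> word_map w) = weight T * t ^ length w" if "T \<in> ?D" "w \<in> ?J" for T w
      unfolding len[OF that] using t by (simp add: power_add field_simps)
    have "sum weight F * ?Z = (\<Sum>T\<in>F. \<Sum>w\<in>?J. weight T * t ^ length w)"
      by (simp add: sum_dihedral_words[OF ab(3) k, symmetric] sum_product)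
    also have "\<dots> = (\<Sum>(T, w)\<in>F \<times> ?J. weight T * t ^ length w)"
      by (rule sum.cartesian_product)
    also have "\<dots> = (\<Sum>x\<in>F \<times> ?J. weight ((\<lambda>(T, w). T \<circ> word_map w) x))"
      using F w by (intro sum.cong) auto
    also have "\<dots> = sum weight ((\<lambda>(T, w). T \<circ> word_map w) ` (F \<times> ?J))"
      using F k by (intro sum.reindex_cong[symmetric, OF _ refl refl]
          inj_on_subset[OF dihedral_words_inj[OF ab(3)]]) auto
    also have "\<dots> \<le> infsum weight W"
    proof (intro sum_weight_le)
      show "(\<lambda>(T, w). T \<circ> word_map w) ` (F \<times> ?J) \<subseteq> W"
        using W_comp_word JE F DW by auto
    qed (use F finJ in auto)
    finally show "sum weight F \<le> infsum weight W / ?Z"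
      using Zpos by (simp add: pos_le_divide_eq)
  qed
  also have "\<dots> \<le> infsum weight W / ((1 + t)\<^sup>2 * (real (m a b) / 2))"
    by (rule divide_left_mono[OF Z infsum_nonneg mult_pos_pos[OF Zpos \<open>0 < (1 + t)\<^sup>2 * _\<close>]])
      (rule weight_nonneg)
  finally show ?thesis by (simp add: field_simps)
qed

text \<open>The function \<open>h\<close> is nonnegative and equal to \<open>1\<close> at the
  identity, so its sum is at least \<open>1\<close>. Single descents enter the sum with a minus sign
  and pairs with a plus sign, which is why \<open>total_weight_le\<close> bounds the former from
  below and \<open>weight_descents_both_le\<close> the latter from above.\<close>

theorem growth_series_ge:
  "1 \<le> infsum weight W *
     (1 - real (card E) / (1 + t) + (\<Sum>(a, b) | a \<in> E \<and> b \<in> E \<and> a \<noteq> b. 1 / real (m a b)) / (1 + t)\<^sup>2)"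
proof -
  define Q where "Q = {(a, b). a \<in> E \<and> b \<in> E \<and> a \<noteq> b}"
  have finQ: "finite Q"
    using finite_E by (intro finite_subset[of Q "E \<times> E"]) (auto simp: Q_def)
  let ?f = "infsum weight W"
  define D1 where "D1 s = {T \<in> W. s \<in> descents T}" for s
  \<comment> \<open>\<open>Q\<close> consists of ordered pairs, hence the factor
    \<open>1/2\<close>.\<close>
  define h where "h T = weight T - (\<Sum>s\<in>E. if s \<in> descents T then weight T else 0)
     + (\<Sum>x\<in>Q. if T \<in> descents_both (fst x) (snd x) then weight T else 0) * (1/2)" for T
  have ind: "((\<lambda>T. if T \<in> X then weight T else 0) has_sum infsum weight X) W" if "X \<subseteq> W" for X
  proof -
    have "(weight has_sum infsum weight X) X"
      using summable_weight_subset[OF that] by (rule has_sum_infsum)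
    then show ?thesis
      using that by (subst has_sum_cong_neutral[of X W weight]) auto
  qed
  have ind1: "((\<lambda>T. if s \<in> descents T then weight T else 0) has_sum infsum weight (D1 s)) W" for s
    using ind[of "D1 s"] by (rule has_sum_cong[THEN iffD1, rotated]) (auto simp: D1_def)
  have "(h has_sum ?f + - (\<Sum>s\<in>E. infsum weight (D1 s)) +
      (\<Sum>x\<in>Q. infsum weight (descents_both (fst x) (snd x))) * (1/2)) W"
    unfolding h_def diff_conv_add_uminus
    by (intro has_sum_add has_sum_uminusI has_sum_infsum[OF summable] has_sum_cmult_left has_sum_finite_sum
        ind1 ind finite_E finQ) (auto simp: descents_both_def)
  moreover have h_eq: "h T = weight T * (1 - real (card (descents T))
      + real (card (descents T) * (card (descents T) - 1)) / 2)" if "T \<in> W" for T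
  proof -
    have "(\<Sum>s\<in>E. if s \<in> descents T then weight T else 0) = weight T * real (card (descents T))"
      by (subst sum.inter_restrict[symmetric])
        (auto simp: finite_E descents_def Int_absorb1 intro: arg_cong[of _ _ card])
    moreover have "(\<Sum>x\<in>Q. if T \<in> descents_both (fst x) (snd x) then weight T else 0)
        = weight T * real (card {x \<in> Q. T \<in> descents_both (fst x) (snd x)})"
      by (simp add: sum.If_cases finQ Int_def)
    moreover have "{x \<in> Q. T \<in> descents_both (fst x) (snd x)} =
        descents T \<times> descents T - (\<lambda>a. (a, a)) ` descents T"
      using that by (auto simp: Q_def descents_both_def descents_def)
    moreover have "card (descents T \<times> descents T - (\<lambda>a. (a, a)) ` descents T)
        = card (descents T) * (card (descents T) - 1)"
      using finite_descents[of T]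
      by (subst card_Diff_subset)
        (auto simp: card_cartesian_product card_image inj_on_def right_diff_distrib')
    ultimately show ?thesis by (simp add: h_def algebra_simps)
  qed
  moreover have "0 \<le> h T" if "T \<in> W" for T
  proof -
    have "0 \<le> 1 - real d + real (d * (d - 1)) / 2" for d :: nat
    proof (cases "d \<le> 1")
      case True
      then show ?thesis by (cases d) auto
    next
      case False
      then obtain k where "d = Suc (Suc k)" by (metis Suc_le_D not_less_eq_eq One_nat_def)
      then show ?thesis by (simp add: field_simps)
    qed
    then show ?thesis using h_eq[OF that] weight_nonneg by simp
  qed
  moreover have "h id = 1" using h_eq[OF id_in_W] by (simp add: descents_id len_id)
  ultimately have "1 \<le> ?f + - (\<Sum>s\<in>E. infsum weight (D1 s)) +
      (\<Sum>x\<in>Q. infsum weight (descents_both (fst x) (snd x))) * (1/2)" (is "_ \<le> ?R")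
    using has_sum_mono2[of h "{id}" "h id" W ?R] id_in_W has_sum_finite[of "{id}" h] by auto
  also have "\<dots> \<le> ?f + - (\<Sum>s\<in>E. ?f / (1 + t)) + (\<Sum>x\<in>Q. 2 / real (m (fst x) (snd x)) / (1 + t)\<^sup>2 * ?f) * (1/2)"
    using total_weight_le weight_descents_both_le t
    by (intro add_mono le_imp_neg_le order_refl sum_mono mult_right_mono) (auto simp: Q_def D1_def field_simps)
  also have "\<dots> = ?f * (1 - real (card E) / (1 + t) + (\<Sum>x\<in>Q. 1 / real (m (fst x) (snd x))) / (1 + t)\<^sup>2)"
    by (simp add: algebra_simps sum_distrib_left sum_divide_distrib)
  finally show ?thesis by (simp add: Q_def case_prod_beta)
qed

end

end

subsection \<open>Spheres in the Cayley graph\<close>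

context reflection_system
begin

definition sphere_count :: "nat \<Rightarrow> nat" where
  "sphere_count k = card {T \<in> W. len T = k}"

lemma finite_sphere: "finite {T \<in> W. len T = k}"
proof (rule finite_subset)
  show "{T \<in> W. len T = k} \<subseteq> word_map ` {w. set w \<subseteq> E \<and> length w = k}"
    using reduced_word by force
  show "finite (word_map ` {w. set w \<subseteq> E \<and> length w = k})"
    using finite_lists_length_eq[OF finite_E] by simp
qed

lemma sphere_Suc_subset:
  "{T \<in> W. len T = Suc k} \<subseteq> (\<Union>T\<in>{T \<in> W. len T = k}. (\<lambda>s. T \<circ> refl s) ` (E - descents T))"
proof
  fix T assume T: "T \<in> {T \<in> W. len T = Suc k}"
  then obtain w where w: "length w = Suc k" "set w \<subseteq> E" "T = word_map w"
    using reduced_word by force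
  then obtain u s where us: "w = u @ [s]" "length u = k" by (auto simp: length_Suc_conv_rev)
  with w have E: "s \<in> E" "set u \<subseteq> E" by auto
  have Tu: "T = word_map u \<circ> refl s" using w us by (simp only: word_map_snoc)
  have uW: "word_map u \<in> W" using E word_map_in_W by simp
  moreover have "len (word_map u) = k"
    using len_le[OF E(2)] us(2) len_comp_refl[OF uW E(1)] T Tu by auto
  moreover have "s \<notin> descents (word_map u)"
    using T Tu \<open>len (word_map u) = k\<close> by (auto simp: descents_def)
  ultimately show "T \<in> (\<Union>T\<in>{T \<in> W. len T = k}. (\<lambda>s. T \<circ> refl s) ` (E - descents T))"
    using Tu E by blast
qed

lemma descents_nonempty:
  assumes "T \<in> W" "len T \<noteq> 0"
  shows "descents T \<noteq> {}"
proof -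
  have "T \<in> {T \<in> W. len T = Suc (len T - 1)}" using assms by simp
  then obtain T' s where T': "T' \<in> W" "s \<in> E" "s \<notin> descents T'" "T = T' \<circ> refl s"
    using sphere_Suc_subset by blast
  then have "s \<in> descents T" using refl_descent by simp
  then show ?thesis by blast
qed

lemma sphere_count_Suc_le:
  "sphere_count (Suc k) \<le> (\<Sum>T | T \<in> W \<and> len T = k. card (E - descents T))"
proof -
  have "sphere_count (Suc k) \<le>
      card (\<Union>T\<in>{T \<in> W. len T = k}. (\<lambda>s. T \<circ> refl s) ` (E - descents T))"
    unfolding sphere_count_def
    by (intro card_mono sphere_Suc_subset finite_UN_I finite_sphere) (auto simp: finite_E)
  also have "\<dots> \<le> (\<Sum>T | T \<in> W \<and> len T = k. card ((\<lambda>s. T \<circ> refl s) ` (E - descents T)))"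
    by (rule card_UN_le[OF finite_sphere])
  also have "\<dots> \<le> (\<Sum>T | T \<in> W \<and> len T = k. card (E - descents T))"
    by (intro sum_mono card_image_le) (simp add: finite_E)
  finally show ?thesis .
qed

lemma sphere_count_0: "sphere_count 0 = 1"
proof -
  have "{T \<in> W. len T = 0} = {id}" using len_eq_0 id_in_W len_id by auto
  then show ?thesis by (simp add: sphere_count_def)
qed

text \<open>Away from the identity at least one generator is a descent, so at most
  \<open>card E - 1\<close> generators lead further out. The exponent \<open>k\<close> in place of
  \<open>k - 1\<close> covers \<open>k = 0\<close> and does not affect the growth rate.\<close>

lemma sphere_count_le:
  assumes "2 \<le> card E"
  shows "sphere_count k \<le> card E * (card E - 1) ^ k"
proof (induction k)
  case 0
  then show ?case using assms by (simp add: sphere_count_0)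
next
  case (Suc k)
  show ?case
  proof (cases "k = 0")
    case True
    have "sphere_count 1 \<le> (\<Sum>T | T \<in> W \<and> len T = 0. card (E - descents T))"
      using sphere_count_Suc_le[of 0] by simp
    also have "\<dots> \<le> (\<Sum>T | T \<in> W \<and> len T = 0. card E)"
      by (intro sum_mono card_mono finite_E) auto
    also have "\<dots> = card E" using sphere_count_0 by (simp add: sphere_count_def)
    also have "\<dots> \<le> card E * (card E - 1) ^ 1" using assms by simp
    finally show ?thesis using True by simp
  next
    case False
    have "sphere_count (Suc k) \<le> (\<Sum>T | T \<in> W \<and> len T = k. card E - 1)"
    proof (intro order_trans[OF sphere_count_Suc_le] sum_mono)
      fix T assume "T \<in> {T \<in> W. len T = k}"
      then have "descents T \<noteq> {}" using descents_nonempty False by auto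
      then have "E - descents T \<subset> E" by (auto simp: descents_def)
      then show "card (E - descents T) \<le> card E - 1"
        using psubset_card_mono[OF finite_E, of "E - descents T"] by linarith
    qed
    also have "\<dots> = sphere_count k * (card E - 1)" by (simp add: sphere_count_def)
    also have "\<dots> \<le> card E * (card E - 1) ^ k * (card E - 1)"
      using Suc by (intro mult_right_mono) auto
    finally show ?thesis by (simp add: mult_ac)
  qed
qed

theorem growth_le:
  assumes "2 \<le> card E"
  shows "limsup (\<lambda>k. ereal (root k (real (sphere_count k)))) \<le> ereal (real (card E) - 1)"
proof -
  let ?n = "real (card E)"
  have "(\<lambda>k. root k ?n * (?n - 1)) \<longlonglongrightarrow> 1 * (?n - 1)"
    using assms by (intro tendsto_intros LIMSEQ_root_const) auto
  then have "limsup (\<lambda>k. ereal (root k ?n * (?n - 1))) = ereal (?n - 1)"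
    by (intro lim_imp_Limsup) auto
  moreover have "limsup (\<lambda>k. ereal (root k (real (sphere_count k))))
      \<le> limsup (\<lambda>k. ereal (root k ?n * (?n - 1)))"
  proof (rule Limsup_mono, rule eventually_mono[OF eventually_gt_at_top[of 0]])
    fix k :: nat assume k: "0 < k"
    have "real (sphere_count k) \<le> real (card E * (card E - 1) ^ k)"
      using sphere_count_le[OF assms] by (rule of_nat_mono)
    also have "\<dots> = ?n * (?n - 1) ^ k"
      using assms by (simp add: of_nat_diff)
    finally have "root k (real (sphere_count k)) \<le> root k (?n * (?n - 1) ^ k)"
      using k by simp
    also have "\<dots> = root k ?n * (?n - 1)"
      using assms k by (simp add: real_root_mult real_root_power_cancel)
    finally show "ereal (root k (real (sphere_count k))) \<le> ereal (root k ?n * (?n - 1))"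
      by simp
  qed
  ultimately show ?thesis by simp
qed

text \<open>The root test for the series grouped by length, with an \<open>r\<close> strictly
  between the growth rate and \<open>t\<close> as the base of a dominating geometric series.\<close>

lemma summable_weight:
  assumes t: "0 < t" and lim: "limsup (\<lambda>k. ereal (root k (real (sphere_count k)))) < ereal t"
  shows "(\<lambda>T. (1 / t) ^ len T) summable_on W"
proof -
  obtain r where r: "limsup (\<lambda>k. ereal (root k (real (sphere_count k)))) < ereal r" "r < t"
    using ereal_dense2[OF lim] by auto
  have ev: "\<forall>\<^sub>F k in sequentially. 0 < k \<and> root k (real (sphere_count k)) < r"
    using Limsup_lessD[OF r(1)] eventually_gt_at_top[of 0] by eventually_elim auto
  have bound: "\<forall>\<^sub>F k in sequentially. real (sphere_count k) * (1 / t) ^ k \<le> (r / t) ^ k \<and> 0 \<le> r"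
    using ev
  proof eventually_elim
    case (elim k)
    then have "0 \<le> r" using real_root_ge_zero[of "real (sphere_count k)" k] by linarith
    have "real (sphere_count k) = root k (real (sphere_count k)) ^ k"
      using elim by simp
    also have "\<dots> \<le> r ^ k" using elim by (intro power_mono) auto
    finally show ?case using \<open>0 \<le> r\<close> t by (simp add: power_divide divide_right_mono)
  qed
  then have "0 \<le> r" using eventually_happens trivial_limit_sequentially by blast
  then have "summable (\<lambda>k. (r / t) ^ k)" using r t by (intro summable_geometric) auto
  then have sm: "summable (\<lambda>k. real (sphere_count k) * (1 / t) ^ k)"
  proof (rule summable_comparison_test_ev[rotated])
    show "\<forall>\<^sub>F k in sequentially. norm (real (sphere_count k) * (1 / t) ^ k) \<le> (r / t) ^ k"
      using bound by eventually_elim (use t in simp)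
  qed
  show ?thesis
  proof (rule nonneg_bdd_above_summable_on)
    show "bdd_above (sum (\<lambda>T. (1 / t) ^ len T) ` {F. F \<subseteq> W \<and> finite F})"
    proof (rule bdd_aboveI2)
      fix F assume F: "F \<in> {F. F \<subseteq> W \<and> finite F}"
      have "(\<Sum>T\<in>F. (1 / t) ^ len T) = (\<Sum>k\<in>len ` F. \<Sum>T | T \<in> F \<and> len T = k. (1 / t) ^ len T)"
        using F by (intro sum.image_gen) auto
      also have "\<dots> \<le> (\<Sum>k\<in>len ` F. real (sphere_count k) * (1 / t) ^ k)"
      proof (rule sum_mono)
        fix k
        have "card {T \<in> F. len T = k} \<le> sphere_count k"
          unfolding sphere_count_def using F by (intro card_mono finite_sphere) auto
        then show "(\<Sum>T | T \<in> F \<and> len T = k. (1 / t) ^ len T) \<le> real (sphere_count k) * (1 / t) ^ k"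
          using t by (simp add: divide_right_mono power_divide)
      qed
      also have "\<dots> \<le> (\<Sum>k. real (sphere_count k) * (1 / t) ^ k)"
        using F t by (intro sum_le_suminf sm) auto
      finally show "(\<Sum>T\<in>F. (1 / t) ^ len T) \<le> (\<Sum>k. real (sphere_count k) * (1 / t) ^ k)" .
    qed
  qed (use t in simp)
qed

text \<open>A growth rate below \<open>t\<close> would make the series converge at
  \<open>1 / t\<close>. There the second factor in \<open>growth_series_ge\<close> is nonpositive,
  so the product could not reach \<open>1\<close>.\<close>

theorem growth_ge:
  assumes sum: "(\<Sum>(a, b) | a \<in> E \<and> b \<in> E \<and> a \<noteq> b. 1 / real (m a b)) \<le> 2 * (real (card E) - 2)"
  shows "ereal (real (card E) - 3) \<le> limsup (\<lambda>k. ereal (root k (real (sphere_count k))))"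
proof (cases "card E \<le> 3")
  \<comment> \<open>With at most three facets the lower bound is not positive; with more,
    \<open>t\<close> is at least \<open>1\<close>, as \<open>growth_series_ge\<close>
    demands.\<close>
  case True
  have "ereal (real (card E) - 3) \<le> 0" using True by simp
  also have "0 \<le> limsup (\<lambda>k. ereal (root k (real (sphere_count k))))"
    by (intro le_Limsup always_eventually) (auto simp: real_root_ge_zero)
  finally show ?thesis .
next
  case False
  define t where "t = real (card E) - 3"
  have t: "1 \<le> t" using False by (simp add: t_def)
  show ?thesis
  proof (rule ccontr)
    assume "\<not> ?thesis"
    then have *: "limsup (\<lambda>k. ereal (root k (real (sphere_count k)))) < ereal t"
      by (simp add: t_def not_le)
    have sm: "(\<lambda>T. (1 / t) ^ len T) summable_on W"
      using t by (intro summable_weight *) auto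
    let ?S = "\<Sum>(a, b) | a \<in> E \<and> b \<in> E \<and> a \<noteq> b. 1 / real (m a b)"
    have "?S / (1 + t)\<^sup>2 \<le> 2 * (1 + t) / (1 + t)\<^sup>2"
      using sum by (intro divide_right_mono) (auto simp: t_def)
    also have "\<dots> = 2 / (1 + t)" using t by (simp add: power2_eq_square divide_simps)
    finally have "1 - real (card E) / (1 + t) + ?S / (1 + t)\<^sup>2 \<le> 1 - real (card E) / (1 + t) + 2 / (1 + t)"
      by simp
    also have "\<dots> = 0" using t by (simp add: t_def field_simps)
    finally have "(\<Sum>\<^sub>\<infinity>T\<in>W. (1 / t) ^ len T) *
        (1 - real (card E) / (1 + t) + ?S / (1 + t)\<^sup>2) \<le> 0"
      using t by (intro mult_nonneg_nonpos infsum_nonneg) auto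
    with growth_series_ge[OF t sm] show False by simp
  qed
qed

end

section \<open>Lorentz geometry\<close>

lemma lorentz_commute: "lorentz x y = lorentz y x"
  by (simp add: lorentz_def inner_commute mult.commute)

lemma lorentz_add_left: "lorentz (x + y) z = lorentz x z + lorentz y z"
  by (simp add: lorentz_def inner_add_left algebra_simps)

lemma lorentz_add_right: "lorentz x (y + z) = lorentz x y + lorentz x z"
  by (simp add: lorentz_def inner_add_right algebra_simps)

lemma lorentz_scaleR_left: "lorentz (c *\<^sub>R x) z = c * lorentz x z"
  by (simp add: lorentz_def algebra_simps)

lemma lorentz_scaleR_right: "lorentz x (c *\<^sub>R z) = c * lorentz x z"
  by (simp add: lorentz_def algebra_simps)

lemma lorentz_minus_left: "lorentz (- x) z = - lorentz x z"
  by (simp add: lorentz_def)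

lemma lorentz_minus_right: "lorentz x (- z) = - lorentz x z"
  by (simp add: lorentz_def)

lemma lorentz_diff_left: "lorentz (x - y) z = lorentz x z - lorentz y z"
  by (simp add: lorentz_def inner_diff_left algebra_simps)

lemma lorentz_diff_right: "lorentz x (y - z) = lorentz x y - lorentz x z"
  by (simp add: lorentz_def inner_diff_right algebra_simps)

lemma lorentz_zero_left [simp]: "lorentz 0 z = 0"
  by (simp add: lorentz_def)

lemma lorentz_zero_right [simp]: "lorentz z 0 = 0"
  by (simp add: lorentz_def)

lemmas lorentz_simps = lorentz_add_left lorentz_add_right lorentz_scaleR_left lorentz_scaleR_right
  lorentz_minus_left lorentz_minus_right lorentz_diff_left lorentz_diff_right

lemma lorentz_sum_left: "lorentz (sum f A) z = (\<Sum>x\<in>A. lorentz (f x) z)"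
  by (induction A rule: infinite_finite_induct) (auto simp: lorentz_simps)

lemma lorentz_self: "lorentz x x = (norm (snd x))\<^sup>2 - (fst x)\<^sup>2"
  unfolding lorentz_def power2_norm_eq_inner by (simp add: power2_eq_square)

lemma lorentz_eq_inner: "lorentz x y = x \<bullet> (- fst y, snd y)"
  by (simp add: lorentz_def inner_prod_def)

lemma continuous_on_lorentz [continuous_intros]:
  "\<lbrakk>continuous_on S f; continuous_on S g\<rbrakk> \<Longrightarrow> continuous_on S (\<lambda>x. lorentz (f x) (g x))"
  unfolding lorentz_def by (intro continuous_intros)

section \<open>Causal and timelike vectors\<close>

definition causal :: "real \<times> 'a::euclidean_space \<Rightarrow> bool" where
  "causal x \<longleftrightarrow> norm (snd x) \<le> fst x"

definition timelike :: "real \<times> 'a::euclidean_space \<Rightarrow> bool" where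
  "timelike x \<longleftrightarrow> norm (snd x) < fst x"

lemma timelike_causal: "timelike x \<Longrightarrow> causal x"
  by (simp add: timelike_def causal_def)

lemma timelike_fst: "timelike x \<Longrightarrow> 0 < fst x"
  using norm_ge_zero[of "snd x"] by (simp add: timelike_def del: norm_ge_zero)

lemma timelike_nonzero: "timelike x \<Longrightarrow> x \<noteq> 0"
  by (auto simp: timelike_def)

lemma timelike_iff: "timelike x \<longleftrightarrow> lorentz x x < 0 \<and> 0 < fst x"
proof -
  have "0 < fst x \<Longrightarrow> norm (snd x) < fst x \<longleftrightarrow> (norm (snd x))\<^sup>2 < (fst x)\<^sup>2"
    by (metis norm_ge_zero power_mono_iff not_le less_imp_le zero_less_numeral)
  then show ?thesis
    using timelike_fst[of x] by (auto simp: timelike_def lorentz_self)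
qed

lemma hyp_space_timelike: "x \<in> hyp_space \<Longrightarrow> timelike x"
  by (simp add: hyp_space_def timelike_iff)

lemma open_timelike: "open {x. timelike x}"
  unfolding timelike_def by (intro open_Collect_less continuous_intros)

lemma closed_causal: "closed {x. causal x}"
  unfolding causal_def by (intro closed_Collect_le continuous_intros)

lemma causal_add: "\<lbrakk>causal x; causal y\<rbrakk> \<Longrightarrow> causal (x + y)"
  unfolding causal_def using norm_triangle_ineq[of "snd x" "snd y"] by simp

lemma causal_scaleR: "\<lbrakk>causal x; 0 \<le> c\<rbrakk> \<Longrightarrow> causal (c *\<^sub>R x)"
  unfolding causal_def by (simp add: mult_left_mono)

lemma timelike_add_causal: "\<lbrakk>timelike x; causal y\<rbrakk> \<Longrightarrow> timelike (x + y)"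
  unfolding causal_def timelike_def using norm_triangle_ineq[of "snd x" "snd y"] by simp

lemma timelike_scaleR: "\<lbrakk>timelike x; 0 < c\<rbrakk> \<Longrightarrow> timelike (c *\<^sub>R x)"
  unfolding timelike_def by simp

lemma causal_eq_0: "\<lbrakk>causal x; fst x \<le> 0\<rbrakk> \<Longrightarrow> x = 0"
proof -
  assume a: "causal x" "fst x \<le> 0"
  then have "norm (snd x) \<le> 0" "0 \<le> fst x"
    unfolding causal_def using norm_ge_zero[of "snd x"] by linarith+
  with a show ?thesis by (intro prod_eqI) auto
qed

lemma causal_fst_pos: "\<lbrakk>causal x; x \<noteq> 0\<rbrakk> \<Longrightarrow> 0 < fst x"
  using causal_eq_0 not_le by blast

lemma causal_lorentz_le: "\<lbrakk>causal x; causal y\<rbrakk> \<Longrightarrow> lorentz x y \<le> 0"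
  unfolding causal_def lorentz_def
  using norm_cauchy_schwarz[of "snd x" "snd y"] mult_mono[of "norm (snd x)" "fst x" "norm (snd y)" "fst y"]
    norm_ge_zero[of "snd x"]
  by (smt (verit) norm_ge_zero)

lemma timelike_lorentz_less: "\<lbrakk>timelike x; causal y; y \<noteq> 0\<rbrakk> \<Longrightarrow> lorentz x y < 0"
proof -
  assume a: "timelike x" "causal y" "y \<noteq> 0"
  then have "0 < fst y" using causal_fst_pos by blast
  have "snd x \<bullet> snd y \<le> norm (snd x) * norm (snd y)" by (rule norm_cauchy_schwarz)
  also have "\<dots> \<le> norm (snd x) * fst y"
    using a by (intro mult_left_mono) (auto simp: causal_def)
  also have "\<dots> < fst x * fst y"
    using a \<open>0 < fst y\<close> by (intro mult_strict_right_mono) (auto simp: timelike_def)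
  finally show ?thesis by (simp add: lorentz_def)
qed

text \<open>The equality case of the reversed Cauchy-Schwarz inequality: orthogonality makes the
  squared norm of the scaled spatial difference at most zero.\<close>

lemma causal_orthogonal_parallel:
  assumes "causal x" "causal y" "lorentz x y = 0"
  shows "fst y *\<^sub>R x = fst x *\<^sub>R y"
proof -
  have sq: "(norm (snd x))\<^sup>2 \<le> (fst x)\<^sup>2" "(norm (snd y))\<^sup>2 \<le> (fst y)\<^sup>2"
    using assms by (auto simp: causal_def intro: power_mono)
  have "(norm (fst y *\<^sub>R snd x - fst x *\<^sub>R snd y))\<^sup>2 =
      (fst y)\<^sup>2 * (norm (snd x))\<^sup>2 + (fst x)\<^sup>2 * (norm (snd y))\<^sup>2 - 2 * (fst x * fst y) * (snd x \<bullet> snd y)"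
    unfolding power2_norm_eq_inner
    by (simp add: inner_diff_left inner_diff_right inner_commute power2_eq_square algebra_simps)
  also have "snd x \<bullet> snd y = fst x * fst y" using assms(3) by (simp add: lorentz_def)
  also have "(fst y)\<^sup>2 * (norm (snd x))\<^sup>2 + (fst x)\<^sup>2 * (norm (snd y))\<^sup>2 - 2 * (fst x * fst y) * (fst x * fst y)
      \<le> (fst y)\<^sup>2 * (fst x)\<^sup>2 + (fst x)\<^sup>2 * (fst y)\<^sup>2 - 2 * (fst x * fst y) * (fst x * fst y)"
    using sq by (intro diff_right_mono add_mono mult_left_mono) auto
  also have "\<dots> = 0" by (simp add: power2_eq_square algebra_simps)
  finally have "fst y *\<^sub>R snd x - fst x *\<^sub>R snd y = 0" by simp
  then show ?thesis by (intro prod_eqI) auto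
qed

lemma timelike_orthogonal_pos:
  assumes "timelike z" "lorentz z x = 0" "x \<noteq> 0"
  shows "0 < lorentz x x"
proof (rule ccontr)
  assume "\<not> ?thesis"
  then have "(norm (snd x))\<^sup>2 \<le> (fst x)\<^sup>2" by (simp add: lorentz_self)
  then have "norm (snd x) \<le> \<bar>fst x\<bar>" by (metis abs_norm_cancel abs_le_square_iff)
  then have "causal x \<or> causal (- x)" by (auto simp: causal_def)
  then show False
    using timelike_lorentz_less[OF assms(1), of x] timelike_lorentz_less[OF assms(1), of "- x"] assms(2,3)
    by (auto simp: lorentz_simps)
qed

lemma not_spacelike_causal: "lorentz x x \<le> 0 \<Longrightarrow> causal x \<or> causal (- x)"
proof -
  assume "lorentz x x \<le> 0"
  then have "(norm (snd x))\<^sup>2 \<le> (fst x)\<^sup>2" by (simp add: lorentz_self)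
  then have "norm (snd x) \<le> \<bar>fst x\<bar>" by (metis abs_norm_cancel abs_le_square_iff)
  then show "causal x \<or> causal (- x)" by (auto simp: causal_def)
qed

text \<open>The part of \<open>e\<close> orthogonal to \<open>f\<close> is nonzero and orthogonal to
  a timelike vector, hence spacelike, and its square is \<open>1 - (lorentz e f)^2\<close>.\<close>

lemma unit_normals_lorentz_less:
  assumes "timelike z" "lorentz z e = 0" "lorentz z f = 0"
    and "lorentz e e = 1" "lorentz f f = 1" "e \<noteq> f" "e \<noteq> - f"
  shows "\<bar>lorentz e f\<bar> < 1"
proof -
  let ?b = "lorentz e f"
  have "e - ?b *\<^sub>R f \<noteq> 0"
  proof
    assume "e - ?b *\<^sub>R f = 0"
    then have e: "e = ?b *\<^sub>R f" by simp
    then have "lorentz e e = ?b * ?b * lorentz f f"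
      by (metis lorentz_scaleR_left lorentz_scaleR_right mult.assoc)
    then have "?b * ?b = 1" using assms by simp
    then have "?b = 1 \<or> ?b = -1" by (simp add: square_eq_1_iff)
    with e assms(6,7) show False by (metis scaleR_one scaleR_minus1_left)
  qed
  then have "0 < lorentz (e - ?b *\<^sub>R f) (e - ?b *\<^sub>R f)"
    using assms by (intro timelike_orthogonal_pos[OF assms(1)]) (auto simp: lorentz_simps)
  also have "\<dots> = 1 - ?b\<^sup>2"
    using assms by (simp add: lorentz_simps lorentz_commute[of f e] power2_eq_square)
  finally show ?thesis by (simp add: abs_square_less_1)
qed

section \<open>Null vectors representing points at infinity\<close>

definition light :: "'a \<Rightarrow> real \<times> 'a" where
  "light u = (1, u)"

lemma fst_light [simp]: "fst (light u) = 1" and snd_light [simp]: "snd (light u) = u"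
  by (simp_all add: light_def)

lemma light_lorentz: "norm u = 1 \<Longrightarrow> norm u' = 1 \<Longrightarrow> u \<noteq> u' \<Longrightarrow> lorentz (light u) (light u') < 0"
proof -
  assume a: "norm u = 1" "norm u' = 1" "u \<noteq> u'"
  have "0 < (norm (u - u'))\<^sup>2" using a by simp
  also have "\<dots> = 2 - 2 * (u \<bullet> u')"
    using a unfolding power2_norm_eq_inner
    by (simp add: inner_diff_left inner_diff_right inner_commute norm_eq_1)
  finally show ?thesis by (simp add: lorentz_def)
qed

text \<open>On the complement of a null vector the form is semidefinite with that vector as radical.
  This is the Euclidean geometry of a horosphere, and the source of the Euclidean vertex
  links.\<close>

lemma light_orthogonal:
  assumes "norm u = 1" "lorentz (light u) x = 0"
  shows "0 \<le> lorentz x x" and "lorentz x x = 0 \<Longrightarrow> x = fst x *\<^sub>R light u"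
proof -
  have t: "fst x = u \<bullet> snd x" using assms by (simp add: lorentz_def)
  have eq: "lorentz x x = (norm (snd x - fst x *\<^sub>R u))\<^sup>2"
    using assms(1) t unfolding power2_norm_eq_inner lorentz_def
    by (simp add: inner_diff_left inner_diff_right inner_commute norm_eq_1)
  show "0 \<le> lorentz x x" unfolding eq by simp
  show "x = fst x *\<^sub>R light u" if "lorentz x x = 0"
    using that unfolding eq by (intro prod_eqI) auto
qed

lemma sum_nonpos_eq_0:
  fixes f :: "'a \<Rightarrow> real"
  assumes "finite A" "sum f A = 0" "\<And>x. x \<in> A \<Longrightarrow> f x \<le> 0" "a \<in> A"
  shows "f a = 0"
  using sum_nonneg_eq_0_iff[of A "\<lambda>x. - f x"] assms by (simp add: sum_negf)

text \<open>Proper subspaces are negligible, so finitely many of them cannot cover a nonempty open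
  set. This supplies the generic points chosen below.\<close>

lemma open_avoids_subspaces:
  fixes S :: "'i \<Rightarrow> 'a::euclidean_space set"
  assumes "open N" "N \<noteq> {}" "finite I" "\<And>i. i \<in> I \<Longrightarrow> dim (S i) < DIM('a)"
  shows "\<exists>x\<in>N. \<forall>i\<in>I. x \<notin> span (S i)"
proof (rule ccontr)
  assume "\<not> ?thesis"
  then have "N \<subseteq> \<Union> ((\<lambda>i. span (S i)) ` I)" by blast
  moreover have "negligible (\<Union> ((\<lambda>i. span (S i)) ` I))"
    using assms by (intro negligible_Union) (auto intro!: negligible_lowdim)
  ultimately show False
    using open_not_negligible[OF assms(1,2)] negligible_subset by blast
qed

lemma dim_less_of_card_less:
  fixes S :: "'a::euclidean_space set"
  assumes "finite S" "card S < DIM('a)"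
  shows "dim S < DIM('a)"
  using dim_le_card'[OF assms(1)] assms(2) by simp

section \<open>Cones over ideal Coxeter polytopes\<close>

text \<open>The polytope is replaced by the linear cone over it, and an edge by its two ideal
  endpoints. Irredundancy of the half-spaces enters through \<open>facet_point\<close>, ideality
  through \<open>hull\<close>.\<close>

locale ideal_cone =
  fixes E :: "(real \<times> (real ^ 3)) set" and U :: "(real ^ 3) set"
  assumes finite_E: "finite E" and unit: "e \<in> E \<Longrightarrow> lorentz e e = 1"
    and finite_U: "finite U" and norm_U: "u \<in> U \<Longrightarrow> norm u = 1"
    and facet_point: "e \<in> E \<Longrightarrow>
           \<exists>x. timelike x \<and> lorentz x e = 0 \<and> (\<forall>h\<in>E - {e}. lorentz x h < 0)"
    and interior_point: "\<exists>p. timelike p \<and> (\<forall>e\<in>E. lorentz p e < 0)"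
    and vertex: "\<lbrakk>u \<in> U; e \<in> E\<rbrakk> \<Longrightarrow> lorentz (light u) e \<le> 0"
    and hull: "\<lbrakk>timelike x; \<forall>e\<in>E. lorentz x e \<le> 0\<rbrakk> \<Longrightarrow> snd x /\<^sub>R fst x \<in> convex hull U"
    and coxeter: "\<lbrakk>e \<in> E; f \<in> E; e \<noteq> f; u \<in> U; u' \<in> U; u \<noteq> u';
           lorentz (light u) e = 0; lorentz (light u') e = 0; lorentz (light u) f = 0;
           lorentz (light u') f = 0\<rbrakk> \<Longrightarrow> \<exists>k\<ge>2. lorentz e f = - cos (pi / real k)"
begin

definition C :: "(real \<times> (real ^ 3)) set" where
  "C = {x. \<forall>e\<in>E. lorentz x e \<le> 0}"

lemma C_add: "\<lbrakk>x \<in> C; y \<in> C\<rbrakk> \<Longrightarrow> x + y \<in> C"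
  by (auto simp: C_def lorentz_simps intro: add_nonpos_nonpos)

lemma C_scaleR: "\<lbrakk>x \<in> C; 0 \<le> c\<rbrakk> \<Longrightarrow> c *\<^sub>R x \<in> C"
  by (auto simp: C_def lorentz_simps intro: mult_nonneg_nonpos)

text \<open>\<open>hull\<close> speaks of timelike vectors only; a null vector is approached by
  \<open>x + \<epsilon> *\<^sub>R p\<close> with \<open>p\<close> interior, and the convex hull is
  closed.\<close>

lemma causal_in_hull:
  assumes "x \<in> C" "causal x" "x \<noteq> 0"
  shows "snd x /\<^sub>R fst x \<in> convex hull U"
proof -
  obtain p where p: "timelike p" "\<forall>e\<in>E. lorentz p e < 0" using interior_point by blast
  then have "p \<in> C" by (auto simp: C_def intro: less_imp_le)
  have "0 < fst x" using assms causal_fst_pos by blast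
  have "((\<lambda>\<epsilon>. snd (x + \<epsilon> *\<^sub>R p) /\<^sub>R fst (x + \<epsilon> *\<^sub>R p)) \<longlongrightarrow> snd (x + 0 *\<^sub>R p) /\<^sub>R fst (x + 0 *\<^sub>R p)) (at_right 0)"
    using \<open>0 < fst x\<close> by (intro tendsto_intros) auto
  moreover have "\<forall>\<^sub>F \<epsilon> in at_right 0. snd (x + \<epsilon> *\<^sub>R p) /\<^sub>R fst (x + \<epsilon> *\<^sub>R p) \<in> convex hull U"
  proof (rule eventually_mono[OF eventually_at_right_less])
    fix \<epsilon> :: real assume "0 < \<epsilon>"
    then have "timelike (x + \<epsilon> *\<^sub>R p)"
      using timelike_add_causal[OF timelike_scaleR[OF p(1)] assms(2)] by (simp add: add.commute)
    moreover have "x + \<epsilon> *\<^sub>R p \<in> C"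
      using \<open>0 < \<epsilon>\<close> by (intro C_add assms(1) C_scaleR \<open>p \<in> C\<close>) simp
    ultimately show "snd (x + \<epsilon> *\<^sub>R p) /\<^sub>R fst (x + \<epsilon> *\<^sub>R p) \<in> convex hull U"
      using hull unfolding C_def by blast
  qed
  moreover have "closed (convex hull U)"
    using finite_U by (simp add: finite_imp_compact_convex_hull compact_imp_closed)
  ultimately have "snd (x + 0 *\<^sub>R p) /\<^sub>R fst (x + 0 *\<^sub>R p) \<in> convex hull U"
    by (intro Lim_in_closed_set) auto
  then show ?thesis by simp
qed

lemma causal_combination:
  assumes "x \<in> C" "causal x" "x \<noteq> 0"
  shows "\<exists>c. (\<forall>u\<in>U. 0 \<le> c u) \<and> x = (\<Sum>u\<in>U. c u *\<^sub>R light u)"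
proof -
  have "0 < fst x" using assms causal_fst_pos by blast
  obtain a where a: "\<forall>u\<in>U. 0 \<le> a u" "sum a U = 1" "(\<Sum>u\<in>U. a u *\<^sub>R u) = snd x /\<^sub>R fst x"
    using causal_in_hull[OF assms] unfolding convex_hull_finite[OF finite_U] by blast
  have "x = (\<Sum>u\<in>U. (fst x * a u) *\<^sub>R light u)"
  proof (rule prod_eqI)
    show "fst x = fst (\<Sum>u\<in>U. (fst x * a u) *\<^sub>R light u)"
      using a(2) by (simp add: fst_sum sum_distrib_left[symmetric])
    have "snd (\<Sum>u\<in>U. (fst x * a u) *\<^sub>R light u) = fst x *\<^sub>R (\<Sum>u\<in>U. a u *\<^sub>R u)"
      by (simp add: snd_sum scaleR_sum_right)
    also have "\<dots> = snd x"
      using a(3) \<open>0 < fst x\<close> by simp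
    finally show "snd x = snd (\<Sum>u\<in>U. (fst x * a u) *\<^sub>R light u)" ..
  qed
  then show ?thesis
    using a(1) \<open>0 < fst x\<close> by (intro exI[of _ "\<lambda>u. fst x * a u"]) auto
qed

lemma U_nonempty: "U \<noteq> {}"
proof
  assume "U = {}"
  obtain p where "timelike p" "\<forall>e\<in>E. lorentz p e < 0" using interior_point by blast
  then have "snd p /\<^sub>R fst p \<in> convex hull U" by (intro hull) (auto intro: less_imp_le)
  with \<open>U = {}\<close> show False by simp
qed

lemma nonzero_coefficient:
  assumes "x = (\<Sum>u\<in>U. c u *\<^sub>R light u)" "x \<noteq> 0"
  shows "\<exists>u\<in>U. c u \<noteq> 0"
proof (rule ccontr)
  assume "\<not> ?thesis"
  then have "(\<Sum>u\<in>U. c u *\<^sub>R light u) = 0" by (intro sum.neutral) auto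
  with assms show False by metis
qed

text \<open>In a nonnegative combination of vertices all products with \<open>x\<close> are
  nonpositive, and they add up to zero as \<open>x\<close> is null. So every vertex that occurs is
  orthogonal to \<open>x\<close>, hence parallel to it.\<close>

lemma light_vertex:
  assumes "x \<in> C" "causal x" "\<not> timelike x" "x \<noteq> 0"
  shows "\<exists>u\<in>U. x = fst x *\<^sub>R light u"
proof -
  obtain c where c: "\<forall>u\<in>U. 0 \<le> c u" "x = (\<Sum>u\<in>U. c u *\<^sub>R light u)"
    using causal_combination assms by blast
  have cz: "causal (light u)" if "u \<in> U" for u using norm_U[OF that] by (simp add: causal_def)
  obtain u where u: "u \<in> U" "c u \<noteq> 0"
    using nonzero_coefficient[OF c(2) assms(4)] by blast
  have "lorentz x x = 0"
    using assms(2,3) causal_lorentz_le[of x x] unfolding causal_def timelike_def lorentz_self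
    by (metis diff_self leD le_less order_antisym_conv)
  then have "0 = (\<Sum>u\<in>U. c u * lorentz (light u) x)"
    using arg_cong[OF c(2), of "\<lambda>y. lorentz y x"] by (simp add: lorentz_sum_left lorentz_scaleR_left)
  moreover have "c u * lorentz (light u) x \<le> 0" if "u \<in> U" for u
    using c(1) that causal_lorentz_le[OF cz[OF that] assms(2)] by (simp add: mult_nonneg_nonpos)
  ultimately have "c u * lorentz (light u) x = 0"
    using sum_nonpos_eq_0[OF finite_U, of "\<lambda>u. c u * lorentz (light u) x" u] u by simp
  then have "lorentz (light u) x = 0" using u by simp
  from causal_orthogonal_parallel[OF cz[OF u(1)] assms(2) this] have "x = fst x *\<^sub>R light u"
    by simp
  with u(1) show ?thesis by blast
qed

text \<open>A ray in \<open>C\<close> that starts in the interior and leaves the light cone crosses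
  its boundary at a null vector, a multiple of a vertex. Starting off the finitely many planes
  spanned by \<open>x\<close> and a vertex makes this impossible.\<close>

lemma C_causal:
  assumes "x \<in> C"
  shows "causal x"
proof (rule ccontr)
  assume nc: "\<not> causal x"
  let ?N = "{p. timelike p} \<inter> (\<Inter>e\<in>E. {p. lorentz p e < 0})"
  have "open ?N"
    by (intro open_Int open_timelike open_INT finite_E ballI open_Collect_less continuous_intros)
  moreover have "?N \<noteq> {}" using interior_point by auto
  moreover have "dim {x, light u} < DIM(real \<times> (real ^ 3))" for u
    by (rule dim_less_of_card_less) (auto simp: card_insert_if)
  ultimately obtain p where p: "p \<in> ?N" "\<forall>u\<in>U. p \<notin> span {x, light u}"
    using open_avoids_subspaces[of ?N U "\<lambda>u. {x, light u}"] finite_U by blast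
  then have pC: "p \<in> C" "timelike p" by (auto simp: C_def intro: less_imp_le)
  have "\<exists>u. u \<in> U" using U_nonempty by blast
  \<comment> \<open>Otherwise dividing by \<open>T\<close> and letting it grow would make
    \<open>x\<close> causal as a limit of causal vectors.\<close>
  have "\<exists>T\<ge>0. \<not> causal (p + T *\<^sub>R x)"
  proof (rule ccontr)
    assume "\<not> ?thesis"
    then have *: "causal (p + T *\<^sub>R x)" if "0 \<le> T" for T using that by blast
    have "((\<lambda>\<epsilon>. x + \<epsilon> *\<^sub>R p) \<longlongrightarrow> x + 0 *\<^sub>R p) (at_right 0)"
      by (intro tendsto_intros)
    moreover have "\<forall>\<^sub>F \<epsilon> in at_right 0. x + \<epsilon> *\<^sub>R p \<in> {x. causal x}"
    proof (rule eventually_mono[OF eventually_at_right_less])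
      fix \<epsilon> :: real assume "0 < \<epsilon>"
      with *[of "1 / \<epsilon>"] have "causal (\<epsilon> *\<^sub>R (p + (1 / \<epsilon>) *\<^sub>R x))" by (intro causal_scaleR) auto
      then show "x + \<epsilon> *\<^sub>R p \<in> {x. causal x}" using \<open>0 < \<epsilon>\<close> by (simp add: algebra_simps)
    qed
    ultimately have "x + 0 *\<^sub>R p \<in> {x. causal x}"
      by (intro Lim_in_closed_set closed_causal) auto
    with nc show False by simp
  qed
  then obtain T where T: "0 \<le> T" "\<not> causal (p + T *\<^sub>R x)" by blast
  have "closed_segment p (p + T *\<^sub>R x) \<inter> frontier {x. causal x} \<noteq> {}"
    using T(2) timelike_causal[OF pC(2)] by (intro connected_Int_frontier) auto
  then obtain q where q: "q \<in> closed_segment p (p + T *\<^sub>R x)" "q \<in> frontier {x. causal x}" by blast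
  then obtain r where r: "0 \<le> r" "q = (1 - r) *\<^sub>R p + r *\<^sub>R (p + T *\<^sub>R x)"
    by (auto simp: in_segment)
  then have q_eq: "q = p + (r * T) *\<^sub>R x" by (simp add: algebra_simps)
  then have "q \<in> C" using r T assms pC by (auto intro!: C_add C_scaleR)
  moreover have "causal q" using q(2) closed_causal by (metis frontier_subset_closed mem_Collect_eq subsetD)
  moreover have "{x::real \<times> (real ^ 3). timelike x} \<subseteq> interior {x. causal x}"
    by (intro interior_maximal open_timelike) (auto intro: timelike_causal)
  then have "\<not> timelike q" using q(2) by (auto simp: frontier_def)
  moreover have "q \<noteq> 0"
  proof
    assume "q = 0"
    then have "p = (- (r * T)) *\<^sub>R x" using q_eq by (simp add: eq_neg_iff_add_eq_0)
    then have "p \<in> span {x, light u}" for u by (simp add: span_base span_mul span_neg)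
    with p(2) \<open>\<exists>u. u \<in> U\<close> show False by blast
  qed
  ultimately obtain u where u: "u \<in> U" "q = fst q *\<^sub>R light u" using light_vertex by blast
  have "q \<in> span {x, light u}" by (subst u(2), intro span_mul span_base) simp
  moreover have "p = q - (r * T) *\<^sub>R x" using q_eq by simp
  ultimately have "p \<in> span {x, light u}" by (simp add: span_base span_diff span_mul)
  with p(2) u(1) show False by blast
qed

text \<open>All vertices have products of one sign with \<open>e\<close> and \<open>f\<close>, so
  those that occur in \<open>z\<close> lie on both hyperplanes; a single one would make
  \<open>z\<close> null. The case \<open>e = f\<close> is included and yields two vertices of one
  facet.\<close>

lemma timelike_two_vertices:
  assumes "timelike z" "z \<in> C" "e \<in> E" "f \<in> E" "lorentz z e = 0" "lorentz z f = 0"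
  shows "\<exists>u\<in>U. \<exists>u'\<in>U. u \<noteq> u' \<and> lorentz (light u) e = 0 \<and> lorentz (light u') e = 0 \<and>
           lorentz (light u) f = 0 \<and> lorentz (light u') f = 0"
proof -
  obtain c where c: "\<forall>u\<in>U. 0 \<le> c u" "z = (\<Sum>u\<in>U. c u *\<^sub>R light u)"
    using causal_combination assms timelike_causal timelike_nonzero by blast
  have zero: "lorentz (light u) h = 0" if "h \<in> E" "lorentz z h = 0" "u \<in> U" "c u \<noteq> 0" for h u
  proof -
    have "(\<Sum>u\<in>U. c u * lorentz (light u) h) = 0"
      using that(2) unfolding c(2) by (simp add: lorentz_sum_left lorentz_scaleR_left)
    moreover have "c u * lorentz (light u) h \<le> 0" if "u \<in> U" for u
      using c(1) that vertex[OF that \<open>h \<in> E\<close>] by (simp add: mult_nonneg_nonpos)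
    ultimately have "c u * lorentz (light u) h = 0"
      using sum_nonpos_eq_0[OF finite_U, of "\<lambda>u. c u * lorentz (light u) h" u] that by simp
    then show ?thesis using that by simp
  qed
  obtain u where u: "u \<in> U" "c u \<noteq> 0"
    using nonzero_coefficient[OF c(2) timelike_nonzero[OF assms(1)]] by blast
  have "\<exists>u'\<in>U. u' \<noteq> u \<and> c u' \<noteq> 0"
  proof (rule ccontr)
    assume "\<not> ?thesis"
    then have "z = (\<Sum>u'\<in>{u}. c u' *\<^sub>R light u')"
      unfolding c(2) using u by (intro sum.mono_neutral_right finite_U) auto
    then have "norm (snd z) = fst z" using norm_U[OF u(1)] c(1) u(1) by simp
    with assms(1) show False by (simp add: timelike_def)
  qed
  then show ?thesis using u zero assms by metis
qed

text \<open>An edge of an ideal polytope joins two ideal vertices, so sharing an edge is expressed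
  as sharing two vertices.\<close>

definition adjacent :: "real \<times> (real ^ 3) \<Rightarrow> real \<times> (real ^ 3) \<Rightarrow> bool" where
  "adjacent e f \<longleftrightarrow> e \<noteq> f \<and> (\<exists>u\<in>U. \<exists>u'\<in>U. u \<noteq> u' \<and> lorentz (light u) e = 0 \<and> lorentz (light u') e = 0 \<and>
           lorentz (light u) f = 0 \<and> lorentz (light u') f = 0)"

lemma adjacent_commute: "adjacent e f \<longleftrightarrow> adjacent f e"
  unfolding adjacent_def by blast

lemma adjacent_coxeter:
  assumes "e \<in> E" "f \<in> E" "adjacent e f"
  shows "\<exists>k\<ge>2. lorentz e f = - cos (pi / real k)"
  using assms coxeter unfolding adjacent_def by blast

end

subsection \<open>Andreev's theorem\<close>

context ideal_cone
begin

lemma independent_decomposition: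
  assumes lin: "\<And>a b c d. a *\<^sub>R v1 + b *\<^sub>R v2 + c *\<^sub>R v3 + d *\<^sub>R v4 = 0 \<Longrightarrow>
      a = 0 \<and> b = 0 \<and> c = 0 \<and> d = 0"
  shows "\<exists>a b c d. (x :: real \<times> (real ^ 3)) = a *\<^sub>R v1 + b *\<^sub>R v2 + c *\<^sub>R v3 + d *\<^sub>R v4"
proof -
  define F :: "real \<times> (real ^ 3) \<Rightarrow> real \<times> (real ^ 3)" where
    "F y = fst y *\<^sub>R v1 + (snd y $ 1) *\<^sub>R v2 + (snd y $ 2) *\<^sub>R v3 + (snd y $ 3) *\<^sub>R v4" for y
  have "linear F"
    by (rule linearI) (simp_all add: F_def algebra_simps)
  moreover have "inj F"
  proof (subst linear_injective_0[OF \<open>linear F\<close>], intro allI impI)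
    fix y assume "F y = 0"
    from lin[OF this[unfolded F_def]] show "y = 0"
      by (intro prod_eqI) (auto simp: vec_eq_iff forall_3)
  qed
  ultimately have "surj F" by (rule linear_injective_imp_surjective) (rule refl)
  then obtain y where "x = F y" by blast
  then show ?thesis unfolding F_def by blast
qed

lemma dependent_in_hyperplane:
  assumes "\<gamma> \<noteq> (0 :: real \<times> (real ^ 3))"
    and "\<gamma> \<bullet> v1 = 0" "\<gamma> \<bullet> v2 = 0" "\<gamma> \<bullet> v3 = 0" "\<gamma> \<bullet> v4 = 0"
  obtains a b c d where "a *\<^sub>R v1 + b *\<^sub>R v2 + c *\<^sub>R v3 + d *\<^sub>R v4 = 0"
    "\<not> (a = 0 \<and> b = 0 \<and> c = 0 \<and> d = 0)"
proof (rule ccontr)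
  assume "\<not> thesis"
  have "\<exists>a b c d. \<gamma> = a *\<^sub>R v1 + b *\<^sub>R v2 + c *\<^sub>R v3 + d *\<^sub>R v4"
  proof (rule independent_decomposition)
    fix a b c d assume "a *\<^sub>R v1 + b *\<^sub>R v2 + c *\<^sub>R v3 + d *\<^sub>R v4 = 0"
    with that \<open>\<not> thesis\<close> show "a = 0 \<and> b = 0 \<and> c = 0 \<and> d = 0" by blast
  qed
  then obtain a b c d where "\<gamma> = a *\<^sub>R v1 + b *\<^sub>R v2 + c *\<^sub>R v3 + d *\<^sub>R v4"
    by blast
  from arg_cong[OF this, of "inner \<gamma>"] assms show False
    by (simp add: inner_add_right)
qed

text \<open>Otherwise \<open>f - e\<close> or \<open>e - f\<close> is causal, so one half-space
  contains the other, and the larger one has no facet point.\<close>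

lemma lorentz_less_1:
  assumes "e \<in> E" "f \<in> E" "e \<noteq> f"
  shows "lorentz e f < 1"
proof (rule ccontr)
  assume "\<not> ?thesis"
  then have "lorentz (f - e) (f - e) \<le> 0"
    using unit[OF assms(1)] unit[OF assms(2)] by (simp add: lorentz_simps lorentz_commute[of f e])
  then consider "causal (f - e)" | "causal (e - f)"
    using not_spacelike_causal[of "f - e"] by auto
  then show False
  proof cases
    case 1
    obtain x where x: "timelike x" "lorentz x f = 0" "lorentz x e < 0"
      using facet_point[OF assms(2)] assms by blast
    then show ?thesis
      using causal_lorentz_le[OF timelike_causal[OF x(1)] 1] by (simp add: lorentz_simps)
  next
    case 2
    obtain x where x: "timelike x" "lorentz x e = 0" "lorentz x f < 0"
      using facet_point[OF assms(1)] assms by blast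
    then show ?thesis
      using causal_lorentz_le[OF timelike_causal[OF x(1)] 2] by (simp add: lorentz_simps)
  qed
qed

text \<open>Inside the hyperplane of \<open>e\<close> one walks from a generic interior point of the
  facet in the direction of the projection of \<open>f\<close>; \<open>g\<close> is the first facet
  that is hit. Genericity makes the exit point timelike instead of an ideal vertex, so it lies on an
  edge.\<close>

lemma separating_neighbour:
  assumes ef: "e \<in> E" "f \<in> E" "\<bar>lorentz e f\<bar> < 1"
  shows "\<exists>g\<in>E. adjacent e g \<and> 0 < lorentz (f - lorentz e f *\<^sub>R e) g"
proof -
  define f' where "f' = f - lorentz e f *\<^sub>R e"
  define proj where "proj y = y - lorentz y e *\<^sub>R e" for y
  have proj_e: "lorentz (proj y) e = 0" for y
    using unit[OF ef(1)] by (simp add: proj_def lorentz_simps)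
  have f'_e: "lorentz f' e = 0"
    using unit[OF ef(1)] by (simp add: f'_def lorentz_simps lorentz_commute[of f e])
  \<comment> \<open>The value is \<open>1 - (lorentz e f)^2\<close>; thus the walk approaches the
    hyperplane of \<open>f\<close>, and some facet must stop it.\<close>
  have f'_f: "0 < lorentz f' f"
    using unit[OF ef(2)] ef(3) by (simp add: f'_def lorentz_simps abs_square_less_1 flip: power2_eq_square)
  \<comment> \<open>A facet has empty interior in Minkowski space, so the generic point is chosen
    among the vectors that project into the relative interior of the facet.\<close>
  let ?N = "{y. timelike (proj y)} \<inter> (\<Inter>h\<in>E - {e}. {y. lorentz (proj y) h < 0})"
  have cont: "continuous_on UNIV proj"
    unfolding proj_def by (intro continuous_intros)
  have "open {y. timelike (proj y)}"
    using open_vimage[OF open_timelike cont] by (simp add: vimage_def)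
  then have "open ?N"
    by (intro open_Int open_INT finite_Diff finite_E ballI open_Collect_less continuous_intros cont)
  moreover obtain x where x: "timelike x" "lorentz x e = 0" "\<forall>h\<in>E - {e}. lorentz x h < 0"
    using facet_point[OF ef(1)] by blast
  then have "x \<in> ?N" by (simp add: proj_def)
  then have "?N \<noteq> {}" by blast
  moreover have "dim {f', light u, e} < DIM(real \<times> (real ^ 3))" for u
    by (rule dim_less_of_card_less) (auto simp: card_insert_if)
  ultimately obtain y where y: "y \<in> ?N" "\<forall>u\<in>U. y \<notin> span {f', light u, e}"
    using open_avoids_subspaces[of ?N U "\<lambda>u. {f', light u, e}"] finite_U by blast
  define x0 where "x0 = proj y"
  have x0: "timelike x0" "lorentz x0 e = 0" "\<And>h. h \<in> E - {e} \<Longrightarrow> lorentz x0 h < 0"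
    using y(1) proj_e by (auto simp: x0_def)
  define H where "H = {h \<in> E - {e}. 0 < lorentz f' h}"
  have "finite H" using finite_E by (simp add: H_def)
  moreover have "f \<in> H" using f'_f f'_e ef by (auto simp: H_def)
  ultimately obtain g where g: "g \<in> H" "\<And>h. h \<in> H \<Longrightarrow>
      - lorentz x0 g / lorentz f' g \<le> - lorentz x0 h / lorentz f' h"
    using ex_min_if_finite[of "(\<lambda>h. - lorentz x0 h / lorentz f' h) ` H"] 
    by (metis (no_types, lifting) arg_min_if_finite(1) arg_min_if_finite(2) empty_iff not_le)
  define t where "t = - lorentz x0 g / lorentz f' g"
  have g': "g \<in> E" "g \<noteq> e" "0 < lorentz f' g" using g(1) by (auto simp: H_def)
  have "0 \<le> t" using x0(3)[of g] g' by (simp add: t_def divide_nonpos_pos less_imp_le)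
  define z where "z = x0 + t *\<^sub>R f'"
  have ze: "lorentz z e = 0" using x0 f'_e by (simp add: z_def lorentz_simps)
  have zg: "lorentz z g = 0" using g' by (simp add: z_def t_def lorentz_simps)
  have "lorentz z h \<le> 0" if "h \<in> E" for h
  proof (cases "h = e \<or> lorentz f' h \<le> 0")
    case True
    then show ?thesis
      using ze x0(3)[of h] that \<open>0 \<le> t\<close>
      by (cases "h = e") (auto simp: z_def lorentz_simps intro!: add_nonpos_nonpos mult_nonneg_nonpos)
  next
    case False
    then have "h \<in> H" using that by (auto simp: H_def)
    from g(2)[OF this] have "t \<le> - lorentz x0 h / lorentz f' h"
      by (simp only: t_def)
    then have "t * lorentz f' h \<le> - lorentz x0 h"
      using False pos_le_divide_eq[of "lorentz f' h" t "- lorentz x0 h"] by linarith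
    then show ?thesis by (simp add: z_def lorentz_simps)
  qed
  then have zC: "z \<in> C" by (simp add: C_def)
  have "timelike z"
  proof (rule ccontr)
    assume nt: "\<not> timelike z"
    have "\<exists>u\<in>U. z \<in> span {f', light u, e}"
    proof (cases "z = 0")
      case True
      then show ?thesis using U_nonempty by (auto intro: span_zero)
    next
      case False
      then obtain u where u: "u \<in> U" "z = fst z *\<^sub>R light u"
        using light_vertex[OF zC C_causal[OF zC] nt] by blast
      have "z \<in> span {f', light u, e}" by (subst u(2), intro span_mul span_base) simp
      then show ?thesis using u by blast
    qed
    then obtain u where u: "u \<in> U" "z \<in> span {f', light u, e}" by blast
    have "y = z - t *\<^sub>R f' + lorentz y e *\<^sub>R e" by (simp add: z_def x0_def proj_def)
    moreover have "z - t *\<^sub>R f' + lorentz y e *\<^sub>R e \<in> span {f', light u, e}"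
      using u(2) by (intro span_add span_diff span_mul) (auto intro: span_base)
    ultimately have "y \<in> span {f', light u, e}" by simp
    with y(2) u(1) show False by blast
  qed
  from timelike_two_vertices[OF this zC ef(1) g'(1) ze zg] have "adjacent e g"
    using g' by (auto simp: adjacent_def)
  then show ?thesis using g' unfolding f'_def by blast
qed

lemma adjacent_lorentz:
  assumes "e \<in> E" "g \<in> E" "adjacent e g"
  shows "lorentz e g \<le> 0" and "-1 < lorentz e g"
proof -
  obtain k where k: "2 \<le> k" "lorentz e g = - cos (pi / real k)"
    using adjacent_coxeter[OF assms] by blast
  have "0 \<le> pi / real k" "pi / real k \<le> pi / 2"
    using k by (auto simp: field_simps)
  then have "0 \<le> cos (pi / real k)"
    by (intro cos_ge_zero) linarith+
  then show "lorentz e g \<le> 0" using k by simp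
  have "cos (pi / real k) < cos 0"
    using k by (intro cos_monotone_0_pi) (auto simp: field_simps)
  then show "-1 < lorentz e g" using k by simp
qed

text \<open>The endpoints of the edge and the two normals form a basis: the two planes are
  orthogonal, the null directions are independent because their product is negative, and the normals
  because \<open>c < 1\<close>.\<close>

lemma edge_complement:
  assumes e: "e \<in> E" and g: "g \<in> E" "adjacent e g"
    and u: "u \<in> U" "u' \<in> U" "u \<noteq> u'" "lorentz (light u) e = 0" "lorentz (light u') e = 0"
      "lorentz (light u) g = 0" "lorentz (light u') g = 0"
    and k: "lorentz k e = 0" "lorentz k g = 0"
  shows "\<exists>a b. k = a *\<^sub>R light u + b *\<^sub>R light u'"
proof -
  define c where "c = - lorentz e g"
  have c: "0 \<le> c" "c < 1" using adjacent_lorentz[OF e g] by (auto simp: c_def)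
  then have c2: "0 < 1 - c\<^sup>2" using abs_square_less_1[of c] by simp
  have eg: "lorentz e e = 1" "lorentz g g = 1" "lorentz e g = - c" "lorentz g e = - c"
    using unit e g(1) lorentz_commute[of g e] by (auto simp: c_def)
  have uu: "lorentz (light u) (light u') < 0" "lorentz (light u') (light u) < 0"
    "lorentz (light u) (light u) = 0" "lorentz (light u') (light u') = 0"
    using light_lorentz[of u u'] light_lorentz[of u' u] norm_U u by (auto simp: lorentz_self)
  have perp: "lorentz e (light u) = 0" "lorentz e (light u') = 0"
    "lorentz g (light u) = 0" "lorentz g (light u') = 0"
    using u lorentz_commute by metis+
  have zero: "x = 0 \<and> y = 0" if "x - y * c = 0" "y - x * c = 0" for x y
  proof -
    have "x * (1 - c\<^sup>2) = 0" using that by algebra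
    then show ?thesis using c2 that by simp
  qed
  have "\<exists>a1 a2 a3 a4. k = a1 *\<^sub>R light u + a2 *\<^sub>R light u' + a3 *\<^sub>R e + a4 *\<^sub>R g"
  proof (rule independent_decomposition)
    fix a1 a2 a3 a4 assume *: "a1 *\<^sub>R light u + a2 *\<^sub>R light u' + a3 *\<^sub>R e + a4 *\<^sub>R g = 0"
    have "a2 * lorentz (light u') (light u) = 0" "a1 * lorentz (light u) (light u') = 0"
      "a3 - a4 * c = 0" "a4 - a3 * c = 0"
      using arg_cong[OF *, of "\<lambda>x. lorentz x (light u)"] arg_cong[OF *, of "\<lambda>x. lorentz x (light u')"]
        arg_cong[OF *, of "\<lambda>x. lorentz x e"] arg_cong[OF *, of "\<lambda>x. lorentz x g"]
      by (simp_all add: lorentz_simps uu perp eg u)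
    moreover from this have "a3 = 0 \<and> a4 = 0" using zero by blast
    ultimately show "a1 = 0 \<and> a2 = 0 \<and> a3 = 0 \<and> a4 = 0"
      using uu by auto
  qed
  then obtain a1 a2 a3 a4 where ka: "k = a1 *\<^sub>R light u + a2 *\<^sub>R light u' + a3 *\<^sub>R e + a4 *\<^sub>R g" by blast
  have "a3 - a4 * c = 0" "a4 - a3 * c = 0"
    using k unfolding ka by (simp_all add: lorentz_simps eg u)
  then have "a3 = 0" "a4 = 0" using zero by blast+
  with ka show ?thesis by auto
qed

text \<open>Subtracting multiples of \<open>e\<close> and \<open>g\<close> from \<open>f\<close>
  leaves a vector \<open>k\<close> in the plane of their common edge. Both endpoints lie on the
  inner side of \<open>f\<close>, so \<open>k\<close> is causal, and testing it on a facet point of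
  \<open>f\<close> forces the multiple of \<open>e\<close> to be negative.\<close>

lemma separating_neighbour_neg:
  assumes ef: "e \<in> E" "f \<in> E" "e \<noteq> f" "f \<noteq> g" and g: "g \<in> E" "adjacent e g"
    and pos: "0 < lorentz (f - lorentz e f *\<^sub>R e) g"
  shows "lorentz e f < 0" and "0 < lorentz g f"
proof -
  obtain u u' where u: "u \<in> U" "u' \<in> U" "u \<noteq> u'" "lorentz (light u) e = 0" "lorentz (light u') e = 0"
    "lorentz (light u) g = 0" "lorentz (light u') g = 0" and "e \<noteq> g"
    using g(2) by (auto simp: adjacent_def)
  define b c p where "b = lorentz e f" and "c = - lorentz e g"
    and "p = lorentz (f - lorentz e f *\<^sub>R e) g"
  have c: "0 \<le> c" "c < 1" using adjacent_lorentz[OF ef(1) g] by (auto simp: c_def)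
  then have c2: "0 < 1 - c\<^sup>2" using abs_square_less_1[of c] by simp
  have eg: "lorentz e e = 1" "lorentz g g = 1" "lorentz e g = - c" "lorentz g e = - c"
    "lorentz f e = b" "lorentz e f = b" "lorentz f g = p - b * c" "lorentz g f = p - b * c"
    using unit ef g(1) lorentz_commute[of g e] lorentz_commute[of f e] lorentz_commute[of g f]
    by (auto simp: c_def b_def p_def lorentz_simps)
  \<comment> \<open>\<open>l\<close> and \<open>l * c + b\<close> are the multiples that make
    \<open>k\<close> orthogonal to both \<open>g\<close> and \<open>e\<close>.\<close>
  define l where "l = p / (1 - c\<^sup>2)"
  have l: "0 < l" using pos c2 by (simp add: l_def p_def)
  have "l * (1 - c\<^sup>2) = p" using c2 by (simp add: l_def)
  then have lc: "l - l * c * c = p" by (simp add: algebra_simps power2_eq_square)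
  define k where "k = f - l *\<^sub>R g - (l * c + b) *\<^sub>R e"
  have k: "lorentz k e = 0" "lorentz k g = 0"
    using lc by (simp_all add: k_def lorentz_simps eg algebra_simps)
  obtain a1 a2 where ka: "k = a1 *\<^sub>R light u + a2 *\<^sub>R light u'"
    using edge_complement[OF ef(1) g u k] by blast
  have uu: "lorentz (light u) (light u') < 0" "lorentz (light u') (light u) < 0"
    "lorentz (light u) (light u) = 0" "lorentz (light u') (light u') = 0"
    using light_lorentz[of u u'] light_lorentz[of u' u] norm_U u by (auto simp: lorentz_self)
  have perp: "lorentz e (light u) = 0" "lorentz e (light u') = 0"
    "lorentz g (light u) = 0" "lorentz g (light u') = 0"
    using u lorentz_commute by metis+
  have "lorentz k (light u) \<le> 0" "lorentz k (light u') \<le> 0"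
    using vertex[OF u(1) ef(2)] vertex[OF u(2) ef(2)]
    by (simp_all add: k_def lorentz_simps perp lorentz_commute[of f])
  then have "a2 * lorentz (light u') (light u) \<le> 0" "a1 * lorentz (light u) (light u') \<le> 0"
    unfolding ka by (simp_all add: lorentz_simps uu)
  then have "0 \<le> a1" "0 \<le> a2" using uu by (auto simp: mult_le_0_iff)
  moreover have "causal (light u)" "causal (light u')" using norm_U u by (auto simp: causal_def)
  ultimately have "causal k" unfolding ka by (intro causal_add causal_scaleR)
  obtain x where x: "timelike x" "lorentz x f = 0" "lorentz x e < 0" "lorentz x g < 0"
    using facet_point[OF ef(2)] ef g(1) by blast
  have "lorentz x k \<le> 0" using causal_lorentz_le[OF timelike_causal[OF x(1)] \<open>causal k\<close>] .
  then have "0 \<le> l * lorentz x g + (l * c + b) * lorentz x e"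
    using x(2) by (simp add: k_def lorentz_simps)
  moreover have "l * lorentz x g < 0" using l x(4) by (simp add: mult_pos_neg)
  ultimately have "0 < (l * c + b) * lorentz x e" by linarith
  then have "l * c + b < 0" using x(3) by (simp add: zero_less_mult_iff)
  moreover have "0 \<le> l * c" using l c by simp
  ultimately have "b < 0" by linarith
  then show "lorentz e f < 0" by (simp add: b_def)
  have "b * c \<le> 0" using \<open>b < 0\<close> c by (simp add: mult_nonpos_nonneg)
  moreover have "0 < p" using pos by (simp only: p_def)
  ultimately show "0 < lorentz g f" by (simp add: eg)
qed

text \<open>
  Andreev's theorem: if the hyperplanes of two facets that share no edge met, then the one facet
  would have a neighbour whose hyperplane meets that of the other facet in an obtuse angle, and
  repeating the argument with this neighbour would make the angle acute.
\<close>

theorem nonadjacent_lorentz: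
  assumes "e \<in> E" "f \<in> E" "e \<noteq> f" "\<not> adjacent e f"
  shows "lorentz e f \<le> -1"
proof (rule ccontr)
  assume "\<not> ?thesis"
  then have "\<bar>lorentz e f\<bar> < 1" using lorentz_less_1[OF assms(1-3)] by simp
  then obtain g where g: "g \<in> E" "adjacent e g" "0 < lorentz (f - lorentz e f *\<^sub>R e) g"
    using separating_neighbour[OF assms(1,2)] by blast
  then have "f \<noteq> g" using assms(4) by blast
  then have gf: "0 < lorentz g f"
    using separating_neighbour_neg[OF assms(1-3)] g by blast
  then have "\<not> adjacent g f" using adjacent_lorentz[OF g(1) assms(2)] by auto
  have "\<bar>lorentz g f\<bar> < 1" using lorentz_less_1[OF g(1) assms(2)] gf \<open>f \<noteq> g\<close> by auto
  then obtain h where h: "h \<in> E" "adjacent g h" "0 < lorentz (f - lorentz g f *\<^sub>R g) h"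
    using separating_neighbour[OF g(1) assms(2)] by blast
  then have "f \<noteq> h" using \<open>\<not> adjacent g f\<close> by blast
  then have "lorentz g f < 0"
    using separating_neighbour_neg(1)[OF g(1) assms(2)] h \<open>f \<noteq> g\<close> by blast
  with gf show False by simp
qed

end

subsection \<open>Vertex links\<close>

text \<open>The last hypothesis says that a Gram determinant vanishes. Completing the square
  determines \<open>cos \<gamma> + cos \<alpha> * cos \<beta>\<close> up to sign, and angles of at
  most \<open>pi / 2\<close> settle the sign.\<close>

lemma cos_triple_sum:
  assumes "0 \<le> \<alpha>" "\<alpha> \<le> pi / 2" "0 \<le> \<beta>" "\<beta> \<le> pi / 2" "0 \<le> \<gamma>" "\<gamma> \<le> pi / 2"
    and "1 - 2 * cos \<alpha> * cos \<beta> * cos \<gamma> - (cos \<alpha>)\<^sup>2 - (cos \<beta>)\<^sup>2 - (cos \<gamma>)\<^sup>2 = 0"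
  shows "\<alpha> + \<beta> + \<gamma> = pi"
proof -
  have nonneg: "0 \<le> cos x" "0 \<le> sin x" if "0 \<le> x" "x \<le> pi / 2" for x
    using that by (auto intro!: cos_ge_zero sin_ge_zero)
  have "(cos \<gamma> + cos \<alpha> * cos \<beta>)\<^sup>2 = (1 - (cos \<alpha>)\<^sup>2) * (1 - (cos \<beta>)\<^sup>2)"
    using assms(7) by algebra
  also have "\<dots> = (sin \<alpha> * sin \<beta>)\<^sup>2"
    by (simp add: sin_squared_eq power_mult_distrib)
  finally have "cos \<gamma> + cos \<alpha> * cos \<beta> = sin \<alpha> * sin \<beta>"
    by (rule power2_eq_imp_eq)
      (intro add_nonneg_nonneg mult_nonneg_nonneg nonneg assms)+
  then have "cos \<gamma> = cos (pi - (\<alpha> + \<beta>))"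
    unfolding cos_pi_minus cos_add by linarith
  then have "\<gamma> = pi - (\<alpha> + \<beta>)"
    using assms(1-6) by (intro cos_inj_pi[of \<gamma> "pi - (\<alpha> + \<beta>)"]) linarith+
  then show ?thesis by simp
qed

lemma sum_distinct_3:
  fixes w :: "'a \<Rightarrow> 'a \<Rightarrow> real"
  assumes "\<And>x y. w x y = w y x" "a \<noteq> b" "a \<noteq> c" "b \<noteq> c"
  shows "(\<Sum>x\<in>{a, b, c}. \<Sum>y\<in>{a, b, c}. if x = y then 0 else w x y) = 2 * (w a b + w b c + w a c)"
  using assms(2-4) assms(1)[of b a] assms(1)[of c a] assms(1)[of c b] by auto

text \<open>Each unordered pair lies in two of the four triples, matching its two orders on the
  left. In this grouping every bracket can be evaluated by \<open>vertex_angle_sum\<close>.\<close>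

lemma sum_distinct_4:
  fixes w :: "'a \<Rightarrow> 'a \<Rightarrow> real"
  assumes "\<And>x y. w x y = w y x" "distinct [a, b, c, d]"
  shows "(\<Sum>x\<in>{a, b, c, d}. \<Sum>y\<in>{a, b, c, d}. if x = y then 0 else w x y) =
    (w a b + w b c + w a c) + (w a b + w b d + w a d) + (w a c + w c d + w a d) + (w b c + w c d + w b d)"
  using assms(2) assms(1)[of b a] assms(1)[of c a] assms(1)[of c b] assms(1)[of d a] assms(1)[of d b]
    assms(1)[of d c] by auto

lemma obtain_subset_list:
  assumes "k \<le> card A"
  obtains xs where "distinct xs" "length xs = k" "set xs \<subseteq> A"
proof -
  obtain B where B: "B \<subseteq> A" "card B = k" "finite B"
    using obtain_subset_with_card_n[OF assms] by blast
  then obtain xs where "set xs = B" "distinct xs" using finite_distinct_list by blast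
  with B that show ?thesis using distinct_card by fastforce
qed

context ideal_cone
begin

text \<open>The default \<open>0\<close> turns \<open>cos (pi * (1 / 0))\<close> into
  \<open>1\<close>, the cosine for parallel facets, so that the formulas at a vertex include facets
  with angle zero.\<close>

definition coxeter_exponent :: "real \<times> (real ^ 3) \<Rightarrow> real \<times> (real ^ 3) \<Rightarrow> nat" where
  "coxeter_exponent e f =
     (if adjacent e f then SOME k. 2 \<le> k \<and> lorentz e f = - cos (pi / real k) else 0)"

lemma coxeter_exponent_commute: "coxeter_exponent e f = coxeter_exponent f e"
  by (simp add: coxeter_exponent_def adjacent_commute[of e f] lorentz_commute[of e f])

lemma coxeter_exponent_adjacent:
  assumes "e \<in> E" "f \<in> E" "adjacent e f"
  shows "2 \<le> coxeter_exponent e f \<and> lorentz e f = - cos (pi / real (coxeter_exponent e f))"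
  using someI_ex[OF adjacent_coxeter[OF assms]] assms(3) by (simp add: coxeter_exponent_def)

lemma coxeter_exponent_le: 
  assumes "e \<in> E" "f \<in> E"
  shows "1 / real (coxeter_exponent e f) \<le> 1 / 2"
proof (cases "adjacent e f")
  case True
  then show ?thesis using coxeter_exponent_adjacent[OF assms] by (simp add: field_simps)
qed (simp add: coxeter_exponent_def)

abbreviation facet_vertices :: "real \<times> (real ^ 3) \<Rightarrow> (real ^ 3) set" where
  "facet_vertices e \<equiv> {u \<in> U. lorentz (light u) e = 0}"

abbreviation vertex_facets :: "real ^ 3 \<Rightarrow> (real \<times> (real ^ 3)) set" where
  "vertex_facets u \<equiv> {e \<in> E. lorentz (light u) e = 0}"

text \<open>A third common vertex would be a combination of the first two, but a plane spanned by
  two null directions contains no other null direction.\<close>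

lemma common_vertices_le_2:
  assumes e: "e \<in> E" "h \<in> E" "e \<noteq> h"
    and u: "u \<in> U" "u' \<in> U" "u'' \<in> U" "u \<noteq> u'" "u \<noteq> u''" "u' \<noteq> u''"
    and "u \<in> facet_vertices e" "u' \<in> facet_vertices e" "u'' \<in> facet_vertices e"
    and "u \<in> facet_vertices h" "u' \<in> facet_vertices h" "u'' \<in> facet_vertices h"
  shows False
proof -
  have "adjacent e h" using assms unfolding adjacent_def by blast
  then obtain a b where k: "light u'' = a *\<^sub>R light u + b *\<^sub>R light u'"
    using edge_complement[of e h u u' "light u''"] assms by auto
  have null: "lorentz (light v) (light v) = 0" if "v \<in> U" for v
    using norm_U[OF that] by (simp add: lorentz_self)
  have "lorentz (light u'') (light u'') = 2 * a * b * lorentz (light u) (light u')"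
    unfolding k using null[OF u(1)] null[OF u(2)] lorentz_commute[of "light u'" "light u"]
    by (simp add: lorentz_simps)
  then have "a * b = 0"
    using light_lorentz[of u u'] norm_U u null[OF u(3)] by simp
  moreover have "a + b = 1" using arg_cong[OF k, of fst] by simp
  moreover have "u'' = a *\<^sub>R u + b *\<^sub>R u'" using arg_cong[OF k, of snd] by simp
  ultimately show False using u by (cases "a = 0") auto
qed

lemma facet_vertices_ge_2:
  assumes "e \<in> E"
  shows "2 \<le> card (facet_vertices e)"
proof -
  obtain x where x: "timelike x" "lorentz x e = 0" "\<forall>h\<in>E - {e}. lorentz x h < 0"
    using facet_point[OF assms] by blast
  have "x \<in> C" unfolding C_def using x(2,3) by (force intro: less_imp_le)
  then obtain u u' where "u \<in> facet_vertices e" "u' \<in> facet_vertices e" "u \<noteq> u'"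
    using timelike_two_vertices[OF x(1) _ assms assms x(2,2)] by blast
  then have "card {u, u'} \<le> card (facet_vertices e)"
    using finite_U by (intro card_mono) auto
  with \<open>u \<noteq> u'\<close> show ?thesis by simp
qed

text \<open>With at most two facets at \<open>u\<close>, \<open>light u\<close> can be moved both
  ways along some \<open>w\<close> within the cone. The displaced vectors are causal with null sum,
  hence parallel, although their Euclidean products with \<open>w\<close> have opposite
  signs.\<close>

lemma vertex_facets_ge_3:
  assumes u: "u \<in> U"
  shows "3 \<le> card (vertex_facets u)"
proof (rule ccontr)
  assume less: "\<not> ?thesis"
  \<comment> \<open>\<open>?flip\<close> turns Lorentz orthogonality into Euclidean orthogonality;
    including \<open>light u\<close> itself makes \<open>w\<close> transversal to it, and at most
    three vectors leave room for \<open>w\<close>.\<close>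
  let ?Q = "vertex_facets u" and ?flip = "\<lambda>e::real \<times> (real ^ 3). (- fst e, snd e)"
  let ?S = "insert (light u) (?flip ` ?Q)"
  have "card ?S \<le> Suc (card ?Q)"
    using finite_E card_image_le[of ?Q ?flip] by (intro order_trans[OF card_insert_le_m1]) (auto simp: card_insert_if)
  then have "dim ?S < DIM(real \<times> (real ^ 3))"
    using less finite_E by (intro dim_less_of_card_less) auto
  then obtain w where w: "w \<noteq> 0" "\<And>y. y \<in> span ?S \<Longrightarrow> orthogonal w y"
    using orthogonal_to_subspace_exists by blast
  have wu: "w \<bullet> light u = 0" using w(2)[of "light u"] by (simp add: orthogonal_def span_base)
  have we: "lorentz w e = 0" if "e \<in> ?Q" for e
    using w(2)[of "?flip e"] that unfolding lorentz_eq_inner orthogonal_def by (auto intro: span_base)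
  have "\<forall>\<^sub>F \<epsilon> in at_right 0. \<forall>e\<in>E. lorentz (light u + \<epsilon> *\<^sub>R w) e \<le> 0 \<and> lorentz (light u - \<epsilon> *\<^sub>R w) e \<le> 0"
  proof (rule eventually_ball_finite[OF finite_E], rule ballI)
    fix e assume e: "e \<in> E"
    show "\<forall>\<^sub>F \<epsilon> in at_right 0. lorentz (light u + \<epsilon> *\<^sub>R w) e \<le> 0 \<and> lorentz (light u - \<epsilon> *\<^sub>R w) e \<le> 0"
    proof (cases "e \<in> ?Q")
      case True
      then show ?thesis using we by (simp add: lorentz_simps)
    next
      case False
      then have neg: "lorentz (light u) e < 0" using vertex[OF u e] e by auto
      have lim: "((\<lambda>\<epsilon>. lorentz (light u) e + \<epsilon> * lorentz w e) \<longlongrightarrow> lorentz (light u) e + 0 * lorentz w e) (at_right 0)"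
        "((\<lambda>\<epsilon>. lorentz (light u) e - \<epsilon> * lorentz w e) \<longlongrightarrow> lorentz (light u) e - 0 * lorentz w e) (at_right 0)"
        by (intro tendsto_intros)+
      have "\<forall>\<^sub>F \<epsilon> in at_right 0. lorentz (light u) e + \<epsilon> * lorentz w e < 0"
        using neg by (intro order_tendstoD(2)[OF lim(1)]) simp
      moreover have "\<forall>\<^sub>F \<epsilon> in at_right 0. lorentz (light u) e - \<epsilon> * lorentz w e < 0"
        using neg by (intro order_tendstoD(2)[OF lim(2)]) simp
      ultimately show ?thesis
        by eventually_elim (simp add: lorentz_simps)
    qed
  qed
  then have ev: "\<forall>\<^sub>F \<epsilon> in at_right 0. 0 < \<epsilon> \<and> (\<forall>e\<in>E. lorentz (light u + \<epsilon> *\<^sub>R w) e \<le> 0 \<and> lorentz (light u - \<epsilon> *\<^sub>R w) e \<le> 0)"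
    by (intro eventually_conj eventually_at_right_less)
  then obtain \<epsilon> :: real where \<epsilon>: "0 < \<epsilon>" "\<forall>e\<in>E. lorentz (light u + \<epsilon> *\<^sub>R w) e \<le> 0" "\<forall>e\<in>E. lorentz (light u - \<epsilon> *\<^sub>R w) e \<le> 0"
    using eventually_happens[OF ev] by (auto simp: ball_conj_distrib)
  define a b where "a = light u + \<epsilon> *\<^sub>R w" and "b = light u - \<epsilon> *\<^sub>R w"
  have ab: "causal a" "causal b" using \<epsilon> by (auto intro!: C_causal simp: C_def a_def b_def)
  have "a + b = 2 *\<^sub>R light u" by (simp add: a_def b_def scaleR_2)
  moreover have "lorentz (light u) (light u) = 0" using norm_U[OF u] by (simp add: lorentz_self)
  ultimately have "lorentz (a + b) (a + b) = 0" by (simp add: lorentz_scaleR_left lorentz_scaleR_right)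
  then have "lorentz a a + 2 * lorentz a b + lorentz b b = 0"
    by (simp add: lorentz_simps lorentz_commute[of b a])
  with causal_lorentz_le[OF ab(1,1)] causal_lorentz_le[OF ab] causal_lorentz_le[OF ab(2,2)]
  have "lorentz a b = 0" by linarith
  from causal_orthogonal_parallel[OF ab this]
  have "fst b * (w \<bullet> a) = fst a * (w \<bullet> b)" by (metis inner_scaleR_right)
  then have "fst b * (\<epsilon> * (w \<bullet> w)) = - (fst a * (\<epsilon> * (w \<bullet> w)))"
    using wu by (simp add: a_def b_def inner_add_right inner_diff_right)
  then have "(fst a + fst b) * (\<epsilon> * (w \<bullet> w)) = 0" by (simp add: algebra_simps)
  then have "fst a + fst b = 0" using \<epsilon>(1) w(1) by simp
  then show False by (simp add: a_def b_def)
qed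

text \<open>Facets at \<open>u\<close> without a common edge are parallel: Andreev's theorem gives
  \<open>lorentz e f \<le> -1\<close>, and semidefiniteness on the complement of
  \<open>light u\<close>, applied to \<open>e + f\<close>, gives the opposite inequality.\<close>

lemma vertex_facets_lorentz:
  assumes u: "u \<in> U" and ef: "e \<in> vertex_facets u" "f \<in> vertex_facets u" "e \<noteq> f"
  shows "lorentz e f = - cos (pi * (1 / real (coxeter_exponent e f)))"
proof (cases "adjacent e f")
  case True
  then show ?thesis using coxeter_exponent_adjacent[of e f] ef by simp
next
  case False
  then have "lorentz e f \<le> -1" using nonadjacent_lorentz ef by simp
  moreover have "lorentz (light u) (e + f) = 0" using ef by (simp add: lorentz_simps)
  then have "0 \<le> lorentz (e + f) (e + f)" by (rule light_orthogonal[OF norm_U[OF u]])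
  then have "-1 \<le> lorentz e f"
    using ef unit by (simp add: lorentz_simps lorentz_commute[of f e])
  ultimately show ?thesis using False by (simp add: coxeter_exponent_def)
qed

text \<open>The three normals and \<open>light u\<close> lie in the three-dimensional complement of
  \<open>light u\<close>, so they are dependent and the Gram determinant of the normals vanishes.
  Besides triangles this covers any three sides of a rectangle, two of which are parallel and
  contribute \<open>0\<close>.\<close>

lemma vertex_angle_sum:
  assumes u: "u \<in> U" and efg: "e \<in> vertex_facets u" "f \<in> vertex_facets u" "g \<in> vertex_facets u"
    and ne: "e \<noteq> f" "f \<noteq> g" "e \<noteq> g"
  shows "1 / real (coxeter_exponent e f) + 1 / real (coxeter_exponent f g) + 1 / real (coxeter_exponent e g) = 1"
proof -
  define \<alpha> \<beta> \<gamma> where "\<alpha> = pi * (1 / real (coxeter_exponent e f))"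
    and "\<beta> = pi * (1 / real (coxeter_exponent e g))" and "\<gamma> = pi * (1 / real (coxeter_exponent f g))"
  have l: "lorentz e f = - cos \<alpha>" "lorentz e g = - cos \<beta>" "lorentz f g = - cos \<gamma>"
    "lorentz f e = - cos \<alpha>" "lorentz g e = - cos \<beta>" "lorentz g f = - cos \<gamma>"
    "lorentz e e = 1" "lorentz f f = 1" "lorentz g g = 1"
    using vertex_facets_lorentz[OF u] efg ne lorentz_commute[of f e] lorentz_commute[of g e]
      lorentz_commute[of g f] unit by (auto simp: \<alpha>_def \<beta>_def \<gamma>_def)
  have E: "e \<in> E" "f \<in> E" "g \<in> E" using efg by auto
  have flip: "(-1, u) \<bullet> x = lorentz (light u) x" for x
    by (simp add: lorentz_def inner_prod_def)
  obtain a b c d where dep: "a *\<^sub>R light u + b *\<^sub>R e + c *\<^sub>R f + d *\<^sub>R g = 0"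
    "\<not> (a = 0 \<and> b = 0 \<and> c = 0 \<and> d = 0)"
  proof (rule dependent_in_hyperplane[of "(-1, u)" "light u" e f g])
    show "(-1::real, u) \<noteq> 0" by (simp add: zero_prod_def)
    show "(-1::real, u) \<bullet> light u = 0" using norm_U[OF u] unfolding flip by (simp add: lorentz_self)
  qed (use efg in \<open>auto simp: flip\<close>)
  have perp: "lorentz (light u) e = 0" "lorentz (light u) f = 0" "lorentz (light u) g = 0"
    using efg by auto
  have eqs: "b - c * cos \<alpha> - d * cos \<beta> = 0" "- b * cos \<alpha> + c - d * cos \<gamma> = 0"
    "- b * cos \<beta> - c * cos \<gamma> + d = 0"
    using arg_cong[OF dep(1), of "\<lambda>x. lorentz x e"] arg_cong[OF dep(1), of "\<lambda>x. lorentz x f"]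
      arg_cong[OF dep(1), of "\<lambda>x. lorentz x g"]
    by (simp_all add: lorentz_simps l perp)
  let ?det = "1 - 2 * cos \<alpha> * cos \<beta> * cos \<gamma> - (cos \<alpha>)\<^sup>2 - (cos \<beta>)\<^sup>2 - (cos \<gamma>)\<^sup>2"
  \<comment> \<open>Cramer's rule: eliminating the other two unknowns leaves the Gram
    determinant.\<close>
  have "b * ?det = 0" "c * ?det = 0" "d * ?det = 0" using eqs by algebra+
  moreover have "b \<noteq> 0 \<or> c \<noteq> 0 \<or> d \<noteq> 0"
  proof (rule ccontr)
    assume *: "\<not> ?thesis"
    with dep(1) have "a *\<^sub>R light u = 0" by simp
    from arg_cong[OF this, of fst] have "a = 0" by simp
    with * dep(2) show False by simp
  qed
  ultimately have "?det = 0" by auto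
  moreover have "0 \<le> \<alpha>" "0 \<le> \<beta>" "0 \<le> \<gamma>" by (auto simp: \<alpha>_def \<beta>_def \<gamma>_def)
  moreover have "pi * x \<le> pi / 2" if "x \<le> 1 / 2" for x
    using mult_left_mono[OF that, of pi] by simp
  then have "\<alpha> \<le> pi / 2" "\<beta> \<le> pi / 2" "\<gamma> \<le> pi / 2"
    unfolding \<alpha>_def \<beta>_def \<gamma>_def using coxeter_exponent_le E by blast+
  ultimately have "\<alpha> + \<beta> + \<gamma> = pi" by (intro cos_triple_sum)
  then have "pi * (1 / real (coxeter_exponent e f) + 1 / real (coxeter_exponent e g) + 1 / real (coxeter_exponent f g)) = pi * 1"
    by (simp only: \<alpha>_def \<beta>_def \<gamma>_def distrib_left mult_1_right)
  then show ?thesis by simp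
qed

text \<open>For five facets the ten triple equations force all weights to be \<open>1 / 3\<close>.
  Then the sum of three normals is null and orthogonal to \<open>light u\<close>, hence a multiple
  of it, yet its product with a fourth normal is \<open>- 3 / 2\<close>.\<close>

lemma vertex_facets_le_4:
  assumes u: "u \<in> U"
  shows "card (vertex_facets u) \<le> 4"
proof (rule ccontr)
  assume "\<not> ?thesis"
  then have "5 \<le> card (vertex_facets u)" by simp
  then obtain xs where xs: "distinct xs" "length xs = 5" "set xs \<subseteq> vertex_facets u"
    by (rule obtain_subset_list)
  then obtain a b c d e where "xs = [a, b, c, d, e]"
    by (auto simp: length_Suc_conv numeral_eq_Suc)
  with xs have in_Q: "a \<in> vertex_facets u" "b \<in> vertex_facets u" "c \<in> vertex_facets u"
      "d \<in> vertex_facets u" "e \<in> vertex_facets u"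
    and ne: "a \<noteq> b" "a \<noteq> c" "a \<noteq> d" "a \<noteq> e" "b \<noteq> c" "b \<noteq> d" "b \<noteq> e" "c \<noteq> d" "c \<noteq> e" "d \<noteq> e"
    by auto
  define w where "w x y = 1 / real (coxeter_exponent x y)" for x y
  have S: "w x y + w y z + w x z = 1"
    if "x \<in> vertex_facets u" "y \<in> vertex_facets u" "z \<in> vertex_facets u" "x \<noteq> y" "y \<noteq> z" "x \<noteq> z" for x y z
    unfolding w_def using vertex_angle_sum[OF u] that by blast
  have s: "w a b + w b c + w a c = 1" "w a b + w b d + w a d = 1" "w a b + w b e + w a e = 1"
    "w a c + w c d + w a d = 1" "w a c + w c e + w a e = 1" "w a d + w d e + w a e = 1"
    "w b c + w c d + w b d = 1" "w b c + w c e + w b e = 1" "w b d + w d e + w b e = 1"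
    "w c d + w d e + w c e = 1"
    by (rule S; fact)+
  have "w a b = 1 / 3" "w b c = 1 / 3" "w a c = 1 / 3" "w a d = 1 / 3" "w b d = 1 / 3" "w c d = 1 / 3"
    using s by linarith+
  moreover have "lorentz x y = - (1 / 2)" if "x \<in> vertex_facets u" "y \<in> vertex_facets u" "x \<noteq> y" "w x y = 1 / 3" for x y
    using vertex_facets_lorentz[OF u that(1-3)] that(4) unfolding w_def by (simp add: cos_60)
  ultimately have l: "lorentz a b = - (1 / 2)" "lorentz b c = - (1 / 2)" "lorentz a c = - (1 / 2)"
    "lorentz a d = - (1 / 2)" "lorentz b d = - (1 / 2)" "lorentz c d = - (1 / 2)"
    using in_Q ne by blast+
  define y where "y = a + b + c"
  have "lorentz (light u) y = 0" using in_Q by (simp add: y_def lorentz_simps)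
  moreover have "lorentz y y = 0"
    using l in_Q unit lorentz_commute[of b a] lorentz_commute[of c b] lorentz_commute[of c a]
    by (simp add: y_def lorentz_simps)
  ultimately have "y = fst y *\<^sub>R light u"
    using light_orthogonal(2)[OF norm_U[OF u], folded light_def] by blast
  then have "lorentz y d = fst y * lorentz (light u) d" by (metis lorentz_scaleR_left)
  then have "lorentz y d = 0" using in_Q by simp
  then show False using l by (simp add: y_def lorentz_simps)
qed

definition angle_weight :: "real \<times> (real ^ 3) \<Rightarrow> real \<times> (real ^ 3) \<Rightarrow> real" where
  "angle_weight e f = (if e = f then 0 else 1 / real (coxeter_exponent e f))"

lemma angle_weight_nonneg: "0 \<le> angle_weight e f"
  by (simp add: angle_weight_def)

lemma vertex_weight:
  assumes u: "u \<in> U"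
  shows "(\<Sum>e\<in>vertex_facets u. \<Sum>f\<in>vertex_facets u. angle_weight e f) = 2 * (real (card (vertex_facets u)) - 2)"
proof -
  have comm: "1 / real (coxeter_exponent x y) = 1 / real (coxeter_exponent y x)" for x y
    by (simp add: coxeter_exponent_commute)
  have "card (vertex_facets u) = 3 \<or> card (vertex_facets u) = 4"
    using vertex_facets_ge_3[OF u] vertex_facets_le_4[OF u] by auto
  then show ?thesis
  proof
    assume c: "card (vertex_facets u) = 3"
    then obtain a b c where Q: "vertex_facets u = {a, b, c}" "a \<noteq> b" "a \<noteq> c" "b \<noteq> c"
      unfolding card_3_iff by blast
    have "a \<in> vertex_facets u" "b \<in> vertex_facets u" "c \<in> vertex_facets u" unfolding Q by auto
    with vertex_angle_sum[OF u this] Q(2-4) show ?thesis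
      unfolding angle_weight_def c unfolding Q(1) sum_distinct_3[OF comm Q(2-4)] by simp
  next
    assume c4: "card (vertex_facets u) = 4"
    then have "4 \<le> card (vertex_facets u)" by simp
    then obtain xs where xs: "distinct xs" "length xs = 4" "set xs \<subseteq> vertex_facets u"
      by (rule obtain_subset_list)
    then have "set xs = vertex_facets u"
      using c4 finite_E by (intro card_subset_eq) (auto simp: distinct_card)
    moreover obtain a b c d where "xs = [a, b, c, d]"
      using xs(2) by (auto simp: length_Suc_conv numeral_eq_Suc)
    ultimately have Q: "vertex_facets u = {a, b, c, d}" and dist: "distinct [a, b, c, d]"
      using xs by auto
    then have in_Q: "a \<in> vertex_facets u" "b \<in> vertex_facets u" "c \<in> vertex_facets u" "d \<in> vertex_facets u"
      by blast+
    note sum = vertex_angle_sum[OF u]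
    show ?thesis
      unfolding angle_weight_def c4 unfolding Q sum_distinct_4[OF comm dist]
      using sum[OF in_Q(1,2,3)] sum[OF in_Q(1,2,4)] sum[OF in_Q(1,3,4)] sum[OF in_Q(2,3,4)] dist
      by simp
  qed
qed

text \<open>Each edge is seen from at least two vertices. The resulting factor \<open>2\<close>
  cancels the one in \<open>vertex_weight\<close>, where pairs are ordered.\<close>

lemma total_weight_le_vertices:
  "(\<Sum>e\<in>E. \<Sum>f\<in>E. angle_weight e f) \<le> (\<Sum>u\<in>U. real (card (vertex_facets u)) - 2)"
proof -
  have "2 * angle_weight e f \<le> (\<Sum>u\<in>U. if e \<in> vertex_facets u \<and> f \<in> vertex_facets u then angle_weight e f else 0)"
    if ef: "e \<in> E" "f \<in> E" for e f
  proof (cases "adjacent e f")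
    case True
    then obtain u u' where u: "u \<in> U" "u' \<in> U" "u \<noteq> u'" "e \<in> vertex_facets u" "f \<in> vertex_facets u"
      "e \<in> vertex_facets u'" "f \<in> vertex_facets u'"
      using ef by (auto simp: adjacent_def)
    have "2 * angle_weight e f = (\<Sum>u\<in>{u, u'}. if e \<in> vertex_facets u \<and> f \<in> vertex_facets u then angle_weight e f else 0)"
      using u by simp
    also have "\<dots> \<le> (\<Sum>u\<in>U. if e \<in> vertex_facets u \<and> f \<in> vertex_facets u then angle_weight e f else 0)"
      using u finite_U angle_weight_nonneg by (intro sum_mono2) auto
    finally show ?thesis .
  next
    case False
    then have "angle_weight e f = 0" by (simp add: angle_weight_def coxeter_exponent_def)
    moreover have "0 \<le> (\<Sum>u\<in>U. if e \<in> vertex_facets u \<and> f \<in> vertex_facets u then angle_weight e f else 0)"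
      using angle_weight_nonneg by (intro sum_nonneg) auto
    ultimately show ?thesis by simp
  qed
  then have "(\<Sum>e\<in>E. \<Sum>f\<in>E. 2 * angle_weight e f) \<le>
      (\<Sum>e\<in>E. \<Sum>f\<in>E. \<Sum>u\<in>U. if e \<in> vertex_facets u \<and> f \<in> vertex_facets u then angle_weight e f else 0)"
    by (intro sum_mono)
  also have "\<dots> = (\<Sum>u\<in>U. \<Sum>e\<in>E. \<Sum>f\<in>E. if e \<in> vertex_facets u \<and> f \<in> vertex_facets u then angle_weight e f else 0)"
    by (simp only: sum.swap[of _ U])
  also have "\<dots> = (\<Sum>u\<in>U. \<Sum>e\<in>vertex_facets u. \<Sum>f\<in>vertex_facets u. angle_weight e f)"
  proof (rule sum.cong[OF refl])
    fix u
    have "(\<Sum>e\<in>E. \<Sum>f\<in>E. if e \<in> vertex_facets u \<and> f \<in> vertex_facets u then angle_weight e f else 0)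
      = (\<Sum>e\<in>E. if lorentz (light u) e = 0 then (\<Sum>f\<in>E. if lorentz (light u) f = 0 then angle_weight e f else 0) else 0)"
      by (intro sum.cong refl) (auto intro!: sum.cong)
    also have "\<dots> = (\<Sum>e\<in>vertex_facets u. \<Sum>f\<in>vertex_facets u. angle_weight e f)"
      using finite_E by (simp add: sum.inter_filter)
    finally show "(\<Sum>e\<in>E. \<Sum>f\<in>E. if e \<in> vertex_facets u \<and> f \<in> vertex_facets u then angle_weight e f else 0)
      = (\<Sum>e\<in>vertex_facets u. \<Sum>f\<in>vertex_facets u. angle_weight e f)" .
  qed
  also have "\<dots> = (\<Sum>u\<in>U. 2 * (real (card (vertex_facets u)) - 2))"
    by (intro sum.cong refl vertex_weight)
  finally show ?thesis unfolding sum_distrib_left[symmetric] by linarith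
qed

end

subsection \<open>Euler's inequality\<close>

text \<open>Three numbers cannot have pairwise opposite signs, so three such equations make all of
  them vanish; this is how \<open>between_vertices_le_2\<close> ends.\<close>

lemma opposite_signs:
  fixes a b x y :: real
  assumes "a * x + b * y = 0" "x < 0" "y < 0"
  shows "(a = 0 \<longleftrightarrow> b = 0) \<and> (0 < a \<longleftrightarrow> b < 0) \<and> (a < 0 \<longleftrightarrow> 0 < b)"
proof -
  have "a = - b * (y / x)" using assms by (simp add: field_simps)
  moreover have "0 < y / x" using assms by (simp add: divide_neg_neg)
  ultimately obtain r where "a = - b * r" "0 < r" by blast
  then show ?thesis
    by (auto simp: zero_less_mult_iff mult_less_0_iff)
qed

lemma obtain_min_max:
  fixes f :: "'a \<Rightarrow> real"
  assumes "finite A" "A \<noteq> {}"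
  obtains p q where "p \<in> A" "\<And>v. v \<in> A \<Longrightarrow> f p \<le> f v" "q \<in> A" "\<And>v. v \<in> A \<Longrightarrow> f v \<le> f q"
proof -
  have "Min (f ` A) \<in> f ` A" "Max (f ` A) \<in> f ` A" using assms by auto
  then obtain p q where pq: "p \<in> A" "Min (f ` A) = f p" "q \<in> A" "Max (f ` A) = f q" by blast
  have "Min (f ` A) \<le> f v" "f v \<le> Max (f ` A)" if "v \<in> A" for v using assms that by auto
  then show thesis using that[of p q] pq by simp
qed

lemma injective_functional:
  fixes U :: "'a::euclidean_space set"
  assumes "finite U"
  shows "\<exists>a. inj_on (\<lambda>u. u \<bullet> a) U"
proof -
  let ?I = "{p \<in> U \<times> U. fst p \<noteq> snd p}"
  have "dim {x. (fst p - snd p) \<bullet> x = 0} < DIM('a)" if "p \<in> ?I" for p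
    using that by (simp add: dim_hyperplane DIM_positive)
  then obtain a where a: "\<forall>p\<in>?I. a \<notin> span {x. (fst p - snd p) \<bullet> x = 0}"
    using open_avoids_subspaces[of UNIV ?I "\<lambda>p. {x. (fst p - snd p) \<bullet> x = 0}"] assms by auto
  have "inj_on (\<lambda>u. u \<bullet> a) U"
  proof (rule inj_onI, rule ccontr)
    fix u u' assume *: "u \<in> U" "u' \<in> U" "u \<bullet> a = u' \<bullet> a" "u \<noteq> u'"
    then have "a \<in> {x. (fst (u, u') - snd (u, u')) \<bullet> x = 0}" by (simp add: inner_diff_left)
    then have "a \<in> span {x. (fst (u, u') - snd (u, u')) \<bullet> x = 0}" by (rule span_base)
    with a * show False by auto
  qed
  then show ?thesis by blast
qed

context ideal_cone
begin

text \<open>The horizontal plane through \<open>u\<close>, for the height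
  \<open>u \<bullet> a\<close>, cuts such a facet in a segment issuing from \<open>u\<close> instead
  of in \<open>u\<close> alone.\<close>

definition between_vertices :: "real ^ 3 \<Rightarrow> real \<times> (real ^ 3) \<Rightarrow> real ^ 3 \<Rightarrow> bool" where
  "between_vertices a e u \<longleftrightarrow> u \<in> facet_vertices e \<and>
     (\<exists>v\<in>facet_vertices e. v \<bullet> a < u \<bullet> a) \<and> (\<exists>v\<in>facet_vertices e. u \<bullet> a < v \<bullet> a)"

lemma between_vertices_ge:
  assumes e: "e \<in> E" and inj: "inj_on (\<lambda>u. u \<bullet> a) U"
  shows "card (facet_vertices e) \<le> card {u. between_vertices a e u} + 2"
proof -
  let ?V = "facet_vertices e"
  have fin: "finite ?V" using finite_U by simp
  have "?V \<noteq> {}"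
  proof
    assume V: "?V = {}"
    show False using facet_vertices_ge_2[OF e] unfolding V by simp
  qed
  then obtain p q where p: "p \<in> ?V" "\<And>v. v \<in> ?V \<Longrightarrow> p \<bullet> a \<le> v \<bullet> a"
    and q: "q \<in> ?V" "\<And>v. v \<in> ?V \<Longrightarrow> v \<bullet> a \<le> q \<bullet> a"
    by (rule obtain_min_max[OF fin, of "\<lambda>v. v \<bullet> a"]) blast
  have "?V - {p, q} \<subseteq> {u. between_vertices a e u}"
  proof
    fix u assume u: "u \<in> ?V - {p, q}"
    then have "p \<bullet> a \<noteq> u \<bullet> a" "u \<bullet> a \<noteq> q \<bullet> a"
      using inj p(1) q(1) by (auto dest: inj_onD)
    then have "p \<bullet> a < u \<bullet> a" "u \<bullet> a < q \<bullet> a" using p(2)[of u] q(2)[of u] u by auto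
    with p(1) q(1) u show "u \<in> {u. between_vertices a e u}"
      unfolding between_vertices_def by blast
  qed
  moreover have "finite {u. between_vertices a e u}"
    by (rule finite_subset[OF _ fin]) (auto simp: between_vertices_def)
  ultimately have "card (?V - {p, q}) \<le> card {u. between_vertices a e u}" by (rule card_mono[rotated])
  moreover have "card ?V \<le> card (?V - {p, q}) + card {p, q}"
    using diff_card_le_card_Diff[of "{p, q}" ?V] by simp
  moreover have "card {p, q} \<le> 2" by (simp add: card_insert_if)
  ultimately show ?thesis by linarith
qed

text \<open>The witness lies over the point at the height of \<open>u\<close> on the chord from a
  lower to a higher vertex of the facet; its first equation expresses that height. No other facet at
  \<open>u\<close> contains the whole chord, since two facets share at most two vertices, so the
  point is strictly inside it.\<close>

lemma between_vertices_vector: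
  assumes e: "e \<in> E" and b: "between_vertices a e u"
  shows "\<exists>w. (- (u \<bullet> a), a) \<bullet> w = 0 \<and> lorentz w e = 0 \<and>
    (\<forall>h\<in>E. h \<noteq> e \<and> u \<in> facet_vertices h \<longrightarrow> lorentz w h < 0)"
proof -
  obtain v v' where v: "u \<in> facet_vertices e" "v \<in> facet_vertices e" "v' \<in> facet_vertices e"
    "v \<bullet> a < u \<bullet> a" "u \<bullet> a < v' \<bullet> a"
    using b unfolding between_vertices_def by blast
  define w where "w = (v' \<bullet> a - u \<bullet> a) *\<^sub>R light v + (u \<bullet> a - v \<bullet> a) *\<^sub>R light v'"
  show ?thesis
  proof (intro exI[of _ w] conjI ballI impI; (elim conjE)?)
    show "(- (u \<bullet> a), a) \<bullet> w = 0"
      by (simp add: w_def inner_prod_def inner_add_right inner_commute algebra_simps)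
    show "lorentz w e = 0" using v by (simp add: w_def lorentz_simps)
    fix h assume h: "h \<in> E" "h \<noteq> e" "u \<in> facet_vertices h"
    have "lorentz (light v) h \<le> 0" "lorentz (light v') h \<le> 0" using vertex v h by auto
    moreover have "lorentz (light v) h \<noteq> 0 \<or> lorentz (light v') h \<noteq> 0"
    proof (rule ccontr)
      assume "\<not> ?thesis"
      then have "v \<in> facet_vertices h" "v' \<in> facet_vertices h" using v by auto
      moreover have "u \<noteq> v" "u \<noteq> v'" "v \<noteq> v'" using v by auto
      ultimately show False using common_vertices_le_2[OF e h(1), of u v v'] v h by auto
    qed
    ultimately have "(v' \<bullet> a - u \<bullet> a) * lorentz (light v) h + (u \<bullet> a - v \<bullet> a) * lorentz (light v') h < 0"
      using v(4,5) by (smt (verit) mult_nonneg_nonpos mult_pos_neg)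
    then show "lorentz w h < 0" by (simp add: w_def lorentz_simps)
  qed
qed

text \<open>
  The plane through the vertex \<open>u\<close> on which the functional is constant meets the vertex figure
  in a planar convex set, whose boundary crosses at most two of the facets at \<open>u\<close>.
\<close>

lemma between_vertices_le_2:
  "card {e \<in> E. between_vertices a e u} \<le> 2"
proof (rule ccontr)
  assume "\<not> ?thesis"
  then have "3 \<le> card {e \<in> E. between_vertices a e u}" by simp
  then obtain xs where xs: "distinct xs" "length xs = 3" "set xs \<subseteq> {e \<in> E. between_vertices a e u}"
    by (rule obtain_subset_list)
  then obtain e1 e2 e3 where "xs = [e1, e2, e3]"
    by (auto simp: length_Suc_conv numeral_eq_Suc)
  with xs have e: "e1 \<in> E" "e2 \<in> E" "e3 \<in> E" and b: "between_vertices a e1 u" "between_vertices a e2 u"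
      "between_vertices a e3 u" and ne: "e1 \<noteq> e2" "e1 \<noteq> e3" "e2 \<noteq> e3"
    by auto
  have u: "u \<in> facet_vertices e1" "u \<in> facet_vertices e2" "u \<in> facet_vertices e3"
    using b by (auto simp: between_vertices_def)
  let ?\<gamma> = "(- (u \<bullet> a), a)"
  obtain w1 where v1: "?\<gamma> \<bullet> w1 = 0" "lorentz w1 e1 = 0"
      "\<forall>h\<in>E. h \<noteq> e1 \<and> u \<in> facet_vertices h \<longrightarrow> lorentz w1 h < 0"
    using between_vertices_vector[OF e(1) b(1)] by blast
  have w1: "?\<gamma> \<bullet> w1 = 0" "lorentz w1 e1 = 0" "lorentz w1 e2 < 0" "lorentz w1 e3 < 0"
    using v1 e u ne by auto
  obtain w2 where v2: "?\<gamma> \<bullet> w2 = 0" "lorentz w2 e2 = 0"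
      "\<forall>h\<in>E. h \<noteq> e2 \<and> u \<in> facet_vertices h \<longrightarrow> lorentz w2 h < 0"
    using between_vertices_vector[OF e(2) b(2)] by blast
  have w2: "?\<gamma> \<bullet> w2 = 0" "lorentz w2 e2 = 0" "lorentz w2 e1 < 0" "lorentz w2 e3 < 0"
    using v2 e u ne by auto
  obtain w3 where v3: "?\<gamma> \<bullet> w3 = 0" "lorentz w3 e3 = 0"
      "\<forall>h\<in>E. h \<noteq> e3 \<and> u \<in> facet_vertices h \<longrightarrow> lorentz w3 h < 0"
    using between_vertices_vector[OF e(3) b(3)] by blast
  have w3: "?\<gamma> \<bullet> w3 = 0" "lorentz w3 e3 = 0" "lorentz w3 e1 < 0" "lorentz w3 e2 < 0"
    using v3 e u ne by auto
  have "a \<noteq> 0" using b(1) by (auto simp: between_vertices_def)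
  then have "?\<gamma> \<noteq> 0" by (simp add: zero_prod_def)
  moreover have "?\<gamma> \<bullet> light u = 0" by (simp add: inner_prod_def inner_commute)
  ultimately obtain c0 c1 c2 c3 where c: "c0 *\<^sub>R light u + c1 *\<^sub>R w1 + c2 *\<^sub>R w2 + c3 *\<^sub>R w3 = 0"
    "\<not> (c0 = 0 \<and> c1 = 0 \<and> c2 = 0 \<and> c3 = 0)"
    using dependent_in_hyperplane[of ?\<gamma> "light u" w1 w2 w3] w1(1) w2(1) w3(1) by blast
  have "c2 * lorentz w2 e1 + c3 * lorentz w3 e1 = 0" "c1 * lorentz w1 e2 + c3 * lorentz w3 e2 = 0"
    "c1 * lorentz w1 e3 + c2 * lorentz w2 e3 = 0"
    using arg_cong[OF c(1), of "\<lambda>x. lorentz x e1"] arg_cong[OF c(1), of "\<lambda>x. lorentz x e2"]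
      arg_cong[OF c(1), of "\<lambda>x. lorentz x e3"] u w1(2) w2(2) w3(2)
    by (simp_all add: lorentz_simps)
  from opposite_signs[OF this(1) w2(3) w3(3)] opposite_signs[OF this(2) w1(3) w3(4)]
    opposite_signs[OF this(3) w1(4) w2(4)]
  have "c1 = 0" "c2 = 0" "c3 = 0" by linarith+
  moreover from this c(1) have "c0 *\<^sub>R light u = 0" by simp
  from arg_cong[OF this, of fst] have "c0 = 0" by simp
  ultimately show False using c(2) by simp
qed

lemma card_E_ge_3: "3 \<le> card E"
proof -
  obtain u where "u \<in> U" using U_nonempty by blast
  then have "3 \<le> card (vertex_facets u)" by (rule vertex_facets_ge_3)
  also have "\<dots> \<le> card E" using finite_E by (intro card_mono) auto
  finally show ?thesis .
qed

lemma sum_vertex_facets: "(\<Sum>u\<in>U. card (vertex_facets u)) = (\<Sum>e\<in>E. card (facet_vertices e))"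
  using sum_multicount_gen[of U E "\<lambda>u e. lorentz (light u) e = 0" "\<lambda>e. card (facet_vertices e)"]
    finite_U finite_E by simp

text \<open>Incidences are counted from both sides: a facet has at most two vertices besides those
  it is cut through at, and a vertex has at most two facets cut through at it, but none if it is the
  lowest or the highest. This leaves at most \<open>2 * (card U - 2) + 2 * card E\<close>
  incidences.\<close>

theorem euler_inequality:
  "(\<Sum>u\<in>U. real (card (vertex_facets u)) - 2) \<le> 2 * (real (card E) - 2)"
proof -
  obtain a where inj: "inj_on (\<lambda>u. u \<bullet> a) U"
    using injective_functional[OF finite_U] by blast
  obtain p q where p: "p \<in> U" "\<And>v. v \<in> U \<Longrightarrow> p \<bullet> a \<le> v \<bullet> a"
    and q: "q \<in> U" "\<And>v. v \<in> U \<Longrightarrow> v \<bullet> a \<le> q \<bullet> a"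
    by (rule obtain_min_max[OF finite_U U_nonempty, of "\<lambda>v. v \<bullet> a"]) blast
  have "E \<noteq> {}" using card_E_ge_3 by auto
  then obtain e where "e \<in> E" by blast
  \<comment> \<open>The \<open>- 4\<close> in the bound comes from two distinct exceptional
    vertices.\<close>
  have "p \<noteq> q"
  proof
    assume "p = q"
    then have "v = p" if "v \<in> U" for v
      using p q that inj by (metis inj_onD order_antisym)
    then have "facet_vertices e \<subseteq> {p}" by blast
    then have "card (facet_vertices e) \<le> 1" using card_mono[of "{p}"] by fastforce
    with facet_vertices_ge_2[OF \<open>e \<in> E\<close>] show False by simp
  qed
  have cU: "card U = card (U - {p, q}) + 2"
    using p(1) q(1) \<open>p \<noteq> q\<close> finite_U card_Diff_subset[of "{p, q}" U] card_mono[of U "{p, q}"] by auto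
  have empty: "{e \<in> E. between_vertices a e u} = {}" if "u \<in> {p, q}" for u
    using that p(2) q(2) by (force simp: between_vertices_def)
  have "(\<Sum>e\<in>E. card (facet_vertices e)) \<le> (\<Sum>e\<in>E. card {u \<in> U. between_vertices a e u} + 2)"
  proof (intro sum_mono)
    fix e assume "e \<in> E"
    moreover have "{u. between_vertices a e u} = {u \<in> U. between_vertices a e u}"
      by (auto simp: between_vertices_def)
    ultimately show "card (facet_vertices e) \<le> card {u \<in> U. between_vertices a e u} + 2"
      using between_vertices_ge[OF _ inj, of e] by simp
  qed
  also have "\<dots> = (\<Sum>e\<in>E. card {u \<in> U. between_vertices a e u}) + 2 * card E"
    unfolding sum.distrib by simp
  also have "(\<Sum>e\<in>E. card {u \<in> U. between_vertices a e u}) = (\<Sum>u\<in>U. card {e \<in> E. between_vertices a e u})"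
    using sum_multicount_gen[of U E "\<lambda>u e. between_vertices a e u" "\<lambda>e. card {u \<in> U. between_vertices a e u}"]
      finite_U finite_E by simp
  also have "\<dots> = (\<Sum>u\<in>U - {p, q}. card {e \<in> E. between_vertices a e u})"
  proof (rule sum.mono_neutral_right[OF finite_U Diff_subset], rule ballI)
    fix u assume "u \<in> U - (U - {p, q})"
    then have "u \<in> {p, q}" by blast
    from empty[OF this] show "card {e \<in> E. between_vertices a e u} = 0" by (simp only: card.empty)
  qed
  also have "\<dots> \<le> (\<Sum>u\<in>U - {p, q}. 2)"
    by (intro sum_mono between_vertices_le_2)
  finally have "(\<Sum>u\<in>U. card (vertex_facets u)) \<le> 2 * card (U - {p, q}) + 2 * card E"
    unfolding sum_vertex_facets by simp
  then have "real (\<Sum>u\<in>U. card (vertex_facets u)) \<le> 2 * real (card (U - {p, q})) + 2 * real (card E)"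
    by linarith
  then show ?thesis
    unfolding of_nat_sum by (simp add: sum_subtractf cU)
qed

theorem sum_coxeter_exponents_le:
  "(\<Sum>(e, f) | e \<in> E \<and> f \<in> E \<and> e \<noteq> f. 1 / real (coxeter_exponent e f)) \<le> 2 * (real (card E) - 2)"
proof -
  have "(\<Sum>(e, f) | e \<in> E \<and> f \<in> E \<and> e \<noteq> f. 1 / real (coxeter_exponent e f))
      = (\<Sum>(e, f)\<in>E \<times> E. angle_weight e f)"
  proof (rule sum.mono_neutral_cong_left)
    fix x assume "x \<in> {(e, f). e \<in> E \<and> f \<in> E \<and> e \<noteq> f}"
    then show "(case x of (e, f) \<Rightarrow> 1 / real (coxeter_exponent e f)) = (case x of (e, f) \<Rightarrow> angle_weight e f)"
      by (cases x) (simp add: angle_weight_def)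
  next
    show "\<forall>x\<in>E \<times> E - {(e, f). e \<in> E \<and> f \<in> E \<and> e \<noteq> f}. (case x of (e, f) \<Rightarrow> angle_weight e f) = 0"
      by (auto simp: angle_weight_def)
  qed (use finite_E in auto)
  also have "\<dots> = (\<Sum>e\<in>E. \<Sum>f\<in>E. angle_weight e f)"
    by (rule sum.cartesian_product[symmetric])
  also have "\<dots> \<le> 2 * (real (card E) - 2)"
    using total_weight_le_vertices euler_inequality by linarith
  finally show ?thesis .
qed

end

section \<open>From the polytope to its cone\<close>

lemma flip_nonzero: "a \<noteq> (0 :: real \<times> 'a::euclidean_space) \<Longrightarrow> (- fst a, snd a) \<noteq> 0"
  by (cases a) (auto simp: zero_prod_def)

lemma open_not_orthogonal:
  fixes a :: "real \<times> 'a::euclidean_space"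
  assumes "open N" "N \<noteq> {}" "a \<noteq> 0"
  shows "\<exists>x\<in>N. lorentz x a \<noteq> 0"
proof -
  let ?S = "{x. (- fst a, snd a) \<bullet> x = 0}"
  have "dim ?S < DIM(real \<times> 'a)"
    using flip_nonzero[OF assms(3)] by (simp add: dim_hyperplane DIM_positive del: DIM_prod)
  then obtain x where x: "x \<in> N" "x \<notin> span ?S"
    using open_avoids_subspaces[of N "{()}" "\<lambda>_. ?S"] assms by auto
  have "x \<notin> ?S" using x(2) span_superset[of ?S] by (rule contra_subsetD[rotated])
  then have "lorentz x a \<noteq> 0" unfolding lorentz_eq_inner inner_commute[of x] mem_Collect_eq .
  then show ?thesis by (rule bexI[OF _ x(1)])
qed

text \<open>Radial projection of timelike vectors to the hyperboloid; it preserves the sign of every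
  product and the Klein coordinates.\<close>

definition hyp_point :: "real \<times> 'a::euclidean_space \<Rightarrow> real \<times> 'a" where
  "hyp_point x = (1 / sqrt (- lorentz x x)) *\<^sub>R x"

lemma hyp_point_scale:
  assumes "timelike x"
  obtains r where "0 < r" "hyp_point x = r *\<^sub>R x"
  using that[of "1 / sqrt (- lorentz x x)"] assms by (simp add: hyp_point_def timelike_iff)

lemma hyp_point_in_hyp_space:
  assumes "timelike x"
  shows "hyp_point x \<in> hyp_space"
proof -
  have "0 < - lorentz x x" using assms by (simp add: timelike_iff)
  then have "lorentz (hyp_point x) (hyp_point x) = -1"
    by (simp add: hyp_point_def lorentz_simps field_simps)
  moreover obtain r where "0 < r" "hyp_point x = r *\<^sub>R x" using hyp_point_scale[OF assms] .
  then have "0 < fst (hyp_point x)" using timelike_fst[OF assms] by simp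
  ultimately show ?thesis by (simp add: hyp_space_def)
qed

lemma hyp_point_lorentz_iff:
  assumes "timelike x"
  shows "lorentz (hyp_point x) e = 0 \<longleftrightarrow> lorentz x e = 0"
    and "lorentz (hyp_point x) e \<le> 0 \<longleftrightarrow> lorentz x e \<le> 0"
    and "lorentz (hyp_point x) e < 0 \<longleftrightarrow> lorentz x e < 0"
proof -
  obtain r where "0 < r" "hyp_point x = r *\<^sub>R x" using hyp_point_scale[OF assms] .
  then show "lorentz (hyp_point x) e = 0 \<longleftrightarrow> lorentz x e = 0"
    "lorentz (hyp_point x) e \<le> 0 \<longleftrightarrow> lorentz x e \<le> 0"
    "lorentz (hyp_point x) e < 0 \<longleftrightarrow> lorentz x e < 0"
    by (auto simp: lorentz_scaleR_left mult_less_0_iff mult_le_0_iff)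
qed

lemma hyp_point_klein:
  assumes "timelike x"
  shows "snd (hyp_point x) /\<^sub>R fst (hyp_point x) = snd x /\<^sub>R fst x"
proof -
  obtain r where "0 < r" "hyp_point x = r *\<^sub>R x" using hyp_point_scale[OF assms] .
  then show ?thesis by (simp add: inverse_eq_divide)
qed

text \<open>The timelike vectors that project into the interior form a nonempty open set, which no
  linear hyperplane contains.\<close>

lemma hyp_interior_not_orthogonal:
  fixes a :: "real \<times> 'a::euclidean_space"
  assumes "(top_of_set hyp_space) interior_of X \<noteq> {}" "a \<noteq> 0"
  shows "\<exists>x\<in>X. lorentz x a \<noteq> 0"
proof -
  let ?I = "(top_of_set hyp_space) interior_of X"
  have "openin (top_of_set hyp_space) ?I" by simp
  then obtain T where T: "open T" "?I = hyp_space \<inter> T" unfolding openin_open by blast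
  let ?N = "{x. timelike x} \<inter> hyp_point -` T"
  have "continuous_on {x. timelike x} (hyp_point :: real \<times> 'a \<Rightarrow> _)"
    unfolding hyp_point_def by (intro continuous_intros) (auto simp: timelike_iff)
  then have "open ?N"
    using open_timelike T(1) by (rule continuous_open_preimage)
  moreover obtain x0 where x0: "x0 \<in> ?I" using assms(1) by blast
  then have "x0 \<in> hyp_space" "x0 \<in> T" using T(2) by auto
  then have "timelike x0" "hyp_point x0 = x0"
    by (auto simp: hyp_space_timelike) (simp add: hyp_point_def hyp_space_def)
  then have "x0 \<in> ?N" using \<open>x0 \<in> T\<close> by simp
  then have "?N \<noteq> {}" by blast
  ultimately obtain x where x: "x \<in> ?N" "lorentz x a \<noteq> 0"
    using open_not_orthogonal assms(2) by blast
  then have "hyp_point x \<in> ?I" unfolding T(2) using x(1) hyp_point_in_hyp_space[of x] by simp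
  then have "hyp_point x \<in> X" using interior_of_subset by (metis subsetD)
  moreover have "lorentz (hyp_point x) a \<noteq> 0" using x hyp_point_lorentz_iff(1)[of x a] by simp
  ultimately show ?thesis by blast
qed

lemma hyp_space_lorentz_le:
  assumes "x \<in> hyp_space" "y \<in> hyp_space"
  shows "lorentz x y \<le> -1"
proof -
  let ?a = "norm (snd x)" and ?b = "norm (snd y)"
  have t: "(fst x)\<^sup>2 = 1 + ?a\<^sup>2" "(fst y)\<^sup>2 = 1 + ?b\<^sup>2" "0 < fst x" "0 < fst y"
    using assms by (auto simp: hyp_space_def lorentz_self)
  have "(1 + ?a * ?b)\<^sup>2 \<le> (fst x * fst y)\<^sup>2"
    unfolding power_mult_distrib t(1,2) using zero_le_power2[of "?a - ?b"]
    by (simp add: power2_eq_square algebra_simps)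
  then have "1 + ?a * ?b \<le> fst x * fst y"
    by (rule power2_le_imp_le) (use t in simp)
  moreover have "snd x \<bullet> snd y \<le> ?a * ?b" by (rule norm_cauchy_schwarz)
  ultimately show ?thesis by (simp add: lorentz_def)
qed

lemma hyp_dist_lorentz:
  assumes "x \<in> hyp_space" "y \<in> hyp_space"
  shows "lorentz x y = - cosh (hyp_dist x y)"
  using hyp_space_lorentz_le[OF assms] by (simp add: hyp_dist_def cosh_arcosh_real)

lemma strictly_inside_point:
  fixes K :: "(real \<times> 'a::euclidean_space) set"
  assumes "finite H" "K \<noteq> {}" "\<And>x y. \<lbrakk>x \<in> K; y \<in> K\<rbrakk> \<Longrightarrow> x + y \<in> K"
    and "\<And>x h. \<lbrakk>x \<in> K; h \<in> H\<rbrakk> \<Longrightarrow> lorentz x h \<le> 0"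
    and "\<And>h. h \<in> H \<Longrightarrow> \<exists>x\<in>K. lorentz x h < 0"
  shows "\<exists>x\<in>K. \<forall>h\<in>H. lorentz x h < 0"
  using assms(1,4,5)
proof (induction H)
  case empty
  then show ?case using assms(2) by blast
next
  case (insert h H)
  then obtain x where x: "x \<in> K" "\<forall>h\<in>H. lorentz x h < 0" by (metis insertCI)
  obtain y where y: "y \<in> K" "lorentz y h < 0" using insert.prems by blast
  have "\<forall>g\<in>insert h H. lorentz (x + y) g < 0"
  proof
    fix g assume g: "g \<in> insert h H"
    then have "lorentz x g \<le> 0" "lorentz y g \<le> 0" "lorentz x g < 0 \<or> lorentz y g < 0"
      using insert.prems(1) x y by blast+
    then show "lorentz (x + y) g < 0" by (auto simp: lorentz_add_left)
  qed
  then show ?case using assms(3) x y by blast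
qed

lemma two_vertices_timelike:
  assumes "norm u = 1" "norm u' = 1" "u \<noteq> u'" "0 < s" "0 < t"
  shows "timelike (s *\<^sub>R light u + t *\<^sub>R light u')"
proof -
  have "lorentz (s *\<^sub>R light u + t *\<^sub>R light u') (s *\<^sub>R light u + t *\<^sub>R light u')
      = 2 * s * t * lorentz (light u) (light u') + s * s * lorentz (light u) (light u) + t * t * lorentz (light u') (light u')"
    by (simp add: lorentz_simps lorentz_commute[of "light u'" "light u"] algebra_simps)
  also have "\<dots> = 2 * s * t * lorentz (light u) (light u')"
    using assms(1,2) by (simp add: lorentz_self)
  also have "\<dots> < 0"
    using light_lorentz[OF assms(1-3)] assms(4,5) by (simp add: mult_pos_neg)
  finally show ?thesis using assms(4,5) by (simp add: timelike_iff)
qed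

lemma dim_two_orthogonal:
  fixes e h :: "real \<times> (real ^ 3)"
  assumes "lorentz e e = 1" "lorentz h h = 1" "e \<noteq> h" "e \<noteq> - h"
  shows "dim {x. lorentz x e = 0 \<and> lorentz x h = 0} \<le> 2"
proof -
  let ?f = "\<lambda>x::real \<times> (real ^ 3). (- fst x, snd x)"
  have "?f e \<notin> span {?f h}"
  proof
    assume "?f e \<in> span {?f h}"
    then have "?f e \<in> range (\<lambda>k. k *\<^sub>R ?f h)" by (simp only: span_singleton)
    then obtain k where "?f e = k *\<^sub>R ?f h" by (rule rangeE)
    then have e: "e = k *\<^sub>R h" by (intro prod_eqI) auto
    then have "k * k = 1" using assms(1,2) by (simp add: lorentz_simps)
    then have "k = 1 \<or> k = -1" by (simp add: square_eq_1_iff)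
    with e assms(3,4) show False by auto
  qed
  moreover have "?f h \<noteq> 0" using assms(2) by (intro flip_nonzero) auto
  ultimately have ind: "independent {?f e, ?f h}" and "?f e \<noteq> ?f h"
    by (auto simp: independent_insert span_base)
  let ?A = "span {?f e, ?f h}"
  have "dim ?A = 2" using dim_span_eq_card_independent[OF ind] \<open>?f e \<noteq> ?f h\<close> by simp
  moreover have "dim {y \<in> UNIV. \<forall>x\<in>?A. orthogonal x y} + dim ?A = dim (UNIV :: (real \<times> (real ^ 3)) set)"
    by (rule dim_subspace_orthogonal_to_vectors) auto
  ultimately have dim2: "dim {y. \<forall>x\<in>?A. orthogonal x y} = 2" by (simp add: dim_UNIV)
  have "{x. lorentz x e = 0 \<and> lorentz x h = 0} \<subseteq> {y. \<forall>x\<in>?A. orthogonal x y}"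
  proof (clarify)
    fix y x assume *: "lorentz y e = 0" "lorentz y h = 0" "x \<in> ?A"
    have "orthogonal y x"
      by (rule orthogonal_to_span[OF *(3)]) (use * in \<open>auto simp: orthogonal_def lorentz_eq_inner\<close>)
    then show "orthogonal x y" by (simp add: orthogonal_commute)
  qed
  from dim_subset[OF this] show ?thesis unfolding dim2 .
qed

text \<open>
  An isometric image of a polygon spans a three-dimensional space, because the Gram matrix of
  three points that span Minkowski space is nonsingular.
\<close>

lemma polygon_not_in_line:
  fixes e h :: "real \<times> (real ^ 3)"
  assumes poly: "hyp_polygon_in (hyp_plane e) F"
    and eh: "lorentz e e = 1" "lorentz h h = 1" "e \<noteq> h" "e \<noteq> - h"
  shows "\<exists>x\<in>F. lorentz x h \<noteq> 0"
proof (rule ccontr)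
  assume "\<not> ?thesis"
  then have Fh: "lorentz x h = 0" if "x \<in> F" for x using that by blast
  obtain \<phi> :: "real \<times> (real ^ 2) \<Rightarrow> real \<times> (real ^ 3)" and Q
    where \<phi>: "bij_betw \<phi> hyp_space (hyp_plane e)"
      "\<forall>x\<in>hyp_space. \<forall>y\<in>hyp_space. hyp_dist (\<phi> x) (\<phi> y) = hyp_dist x y"
      and Q: "hyp_polygon Q" and F: "F = \<phi> ` Q"
    using poly unfolding hyp_polygon_in_def by blast
  have QH: "Q \<subseteq> hyp_space" and Qi: "(top_of_set hyp_space) interior_of Q \<noteq> {}"
    using Q by (auto simp: hyp_polygon_def finite_volume_domain_def)
  have in_plane: "\<phi> x \<in> hyp_plane e" if "x \<in> hyp_space" for x
    using that \<phi>(1) by (auto simp: bij_betw_def)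
  have iso: "lorentz (\<phi> x) (\<phi> y) = lorentz x y" if "x \<in> Q" "y \<in> Q" for x y
  proof -
    have xy: "x \<in> hyp_space" "y \<in> hyp_space" using that QH by auto
    then have "\<phi> x \<in> hyp_space" "\<phi> y \<in> hyp_space" using in_plane by (auto simp: hyp_plane_def)
    then show ?thesis using hyp_dist_lorentz xy \<phi>(2) by metis
  qed
  have "span Q = UNIV"
  proof (rule ccontr)
    assume "span Q \<noteq> UNIV"
    then obtain b where b: "b \<noteq> 0" "\<forall>x\<in>span Q. b \<bullet> x = 0"
      using span_not_UNIV_orthogonal[of Q] by auto
    have "\<exists>x\<in>Q. lorentz x (- fst b, snd b) \<noteq> 0"
      using hyp_interior_not_orthogonal[OF Qi] flip_nonzero[OF b(1)] by blast
    then obtain x where "x \<in> Q" "x \<bullet> b \<noteq> 0" by (auto simp: lorentz_eq_inner)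
    then show False using b(2) by (auto simp: span_base inner_commute)
  qed
  obtain B where B: "B \<subseteq> Q" "independent B" "Q \<subseteq> span B"
    using maximal_independent_subset[of Q] by blast
  have spanB: "span B = UNIV" using B(3) \<open>span Q = UNIV\<close> by (metis span_mono span_span top.extremum_unique)
  have finB: "finite B" and cardB: "card B = 3"
    using independent_imp_finite[OF B(2)] dim_span_eq_card_independent[OF B(2)]
    by (auto simp: spanB dim_UNIV)
  have inj: "inj_on \<phi> B"
    using \<phi>(1) B(1) QH by (meson bij_betw_imp_inj_on inj_on_subset order_trans)
  have "\<phi> ` B \<subseteq> {x. lorentz x e = 0 \<and> lorentz x h = 0}"
  proof (rule image_subsetI)
    fix b assume "b \<in> B"
    then have "b \<in> Q" using B(1) by blast
    then have "\<phi> b \<in> F" "\<phi> b \<in> hyp_plane e" using F in_plane[of b] QH by auto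
    then show "\<phi> b \<in> {x. lorentz x e = 0 \<and> lorentz x h = 0}"
      using Fh by (simp add: hyp_plane_def)
  qed
  then have "dim (\<phi> ` B) \<le> 2" using dim_two_orthogonal[OF eh] dim_subset by (meson order_trans)
  moreover have "card (\<phi> ` B) = 3" using inj cardB by (simp add: card_image)
  ultimately have "dependent (\<phi> ` B)"
    using dim_eq_card_independent[of "\<phi> ` B"] by auto
  then obtain c where c: "\<exists>v\<in>\<phi> ` B. c v \<noteq> 0" "(\<Sum>v\<in>\<phi> ` B. c v *\<^sub>R v) = 0"
    using dependent_finite[of "\<phi> ` B"] finB by auto
  have c0: "(\<Sum>b\<in>B. c (\<phi> b) *\<^sub>R \<phi> b) = 0"
    using c(2) by (simp add: sum.reindex[OF inj])
  define z where "z = (\<Sum>b\<in>B. c (\<phi> b) *\<^sub>R b)"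
  have zb: "lorentz z b = 0" if "b \<in> B" for b
  proof -
    have "lorentz z b = (\<Sum>b'\<in>B. c (\<phi> b') * lorentz b' b)"
      by (simp add: z_def lorentz_sum_left lorentz_scaleR_left)
    also have "\<dots> = (\<Sum>b'\<in>B. c (\<phi> b') * lorentz (\<phi> b') (\<phi> b))"
    proof (rule sum.cong[OF refl])
      fix b' assume "b' \<in> B"
      then have "lorentz (\<phi> b') (\<phi> b) = lorentz b' b" using B(1) that by (intro iso) auto
      then show "c (\<phi> b') * lorentz b' b = c (\<phi> b') * lorentz (\<phi> b') (\<phi> b)" by simp
    qed
    also have "\<dots> = lorentz (\<Sum>b'\<in>B. c (\<phi> b') *\<^sub>R \<phi> b') (\<phi> b)"
      by (simp add: lorentz_sum_left lorentz_scaleR_left)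
    also have "\<dots> = 0" by (simp add: c0)
    finally show ?thesis .
  qed
  have "z = 0"
  proof (rule ccontr)
    assume "z \<noteq> 0"
    let ?z = "(- fst z, snd z)"
    have "orthogonal ?z y" if "y \<in> span B" for y
      using that by (rule orthogonal_to_span)
        (use zb in \<open>simp add: orthogonal_def inner_commute lorentz_commute[of z] flip: lorentz_eq_inner\<close>)
    then have "orthogonal ?z ?z" unfolding spanB by blast
    then have "?z = 0" unfolding orthogonal_def by (simp only: inner_eq_zero_iff)
    with flip_nonzero[OF \<open>z \<noteq> 0\<close>] show False by blast
  qed
  then have "\<forall>b\<in>B. c (\<phi> b) = 0"
    using independentD[OF B(2) finB, of "\<lambda>b. c (\<phi> b)"] unfolding z_def by blast
  with c(1) show False by blast
qed

text \<open>A facet is a polygon and so lies in no other bounding hyperplane; hence for every other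
  half-space it has a point strictly inside, and the sum of these points is strictly inside all of
  them.\<close>

lemma half_spaces_facet_point:
  assumes poly: "hyp_polytope P E" and e: "e \<in> E"
  shows "\<exists>x. timelike x \<and> lorentz x e = 0 \<and> (\<forall>h\<in>E - {e}. lorentz x h < 0)"
proof -
  have fam: "finite E" "E \<subseteq> unit_normals" "P = hyp_space \<inter> (\<Inter>e\<in>E. hyp_halfspace e)"
    and dom: "finite_volume_domain P"
    and facet: "hyp_polygon_in (hyp_plane e) (P \<inter> hyp_plane e)"
    using poly e by (auto simp: hyp_polytope_def halfspace_family_def)
  have unit: "lorentz h h = 1" if "h \<in> E" for h using fam(2) that by (auto simp: unit_normals_def)
  have P_le: "lorentz x h \<le> 0" if "x \<in> P" "h \<in> E" for x h
    using that fam(3) by (auto simp: hyp_halfspace_def)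
  have "e \<noteq> 0" using unit[OF e] by auto
  then obtain y where "y \<in> P" "lorentz y e \<noteq> 0"
    using dom hyp_interior_not_orthogonal unfolding finite_volume_domain_def by blast
  then have "lorentz y e < 0" using P_le[OF _ e, of y] by simp
  \<comment> \<open>\<open>- e\<close> has the same hyperplane as \<open>e\<close>, so it must be
    excluded before \<open>polygon_not_in_line\<close> applies.\<close>
  then have opp: "- e \<notin> E" using P_le[OF \<open>y \<in> P\<close>, of "- e"] by (auto simp: lorentz_minus_right)
  define K where "K = {x. timelike x \<and> lorentz x e = 0 \<and> (\<forall>h\<in>E. lorentz x h \<le> 0)}"
  have PK: "x \<in> K" if "x \<in> P \<inter> hyp_plane e" for x
    unfolding K_def using that P_le[of x] hyp_space_timelike[of x] by (auto simp: hyp_plane_def)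
  have strict: "\<exists>x\<in>K. lorentz x h < 0" if "h \<in> E - {e}" for h
  proof -
    have "\<exists>x\<in>P \<inter> hyp_plane e. lorentz x h \<noteq> 0"
      using that opp unit e by (intro polygon_not_in_line[OF facet]) auto
    then obtain x where x: "x \<in> P \<inter> hyp_plane e" "lorentz x h \<noteq> 0" by blast
    then have "lorentz x h < 0" using P_le[of x h] that by auto
    with PK[OF x(1)] show ?thesis by blast
  qed
  have "\<exists>x\<in>K. \<forall>h\<in>E - {e}. lorentz x h < 0"
  proof (rule strictly_inside_point)
    obtain \<phi> Q where \<phi>: "P \<inter> hyp_plane e = \<phi> ` Q" and Q: "hyp_polygon (Q :: (real \<times> (real ^ 2)) set)"
      using facet unfolding hyp_polygon_in_def by blast
    have "Q \<noteq> {}" using Q unfolding hyp_polygon_def finite_volume_domain_def by auto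
    then have "P \<inter> hyp_plane e \<noteq> {}" using \<phi> by blast
    then show "K \<noteq> {}" using PK by blast
    show "x + y \<in> K" if "x \<in> K" "y \<in> K" for x y
      using that timelike_add_causal[of x y] timelike_causal[of y]
      by (auto simp: K_def lorentz_add_left intro: add_nonpos_nonpos)
  qed (use fam strict in \<open>auto simp: K_def\<close>)
  then show ?thesis unfolding K_def by blast
qed

lemma half_spaces_interior_point:
  assumes poly: "hyp_polytope P E"
  shows "\<exists>p. timelike p \<and> (\<forall>e\<in>E. lorentz p e < 0)"
proof -
  have fam: "finite E" "E \<subseteq> unit_normals" "P = hyp_space \<inter> (\<Inter>e\<in>E. hyp_halfspace e)"
    and dom: "finite_volume_domain P"
    using poly by (auto simp: hyp_polytope_def halfspace_family_def)
  have P_le: "lorentz x h \<le> 0" if "x \<in> P" "h \<in> E" for x h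
    using that fam(3) by (auto simp: hyp_halfspace_def)
  define K where "K = {x. timelike x \<and> (\<forall>h\<in>E. lorentz x h \<le> 0)}"
  have PK: "x \<in> K" if "x \<in> P" for x
    unfolding K_def using that P_le[of x] hyp_space_timelike[of x] fam(3) by auto
  have "\<exists>x\<in>K. \<forall>h\<in>E. lorentz x h < 0"
  proof (rule strictly_inside_point)
    have "P \<noteq> {}" using dom unfolding finite_volume_domain_def by auto
    then show "K \<noteq> {}" using PK by blast
    show "x + y \<in> K" if "x \<in> K" "y \<in> K" for x y
      using that timelike_add_causal[of x y] timelike_causal[of y]
      by (auto simp: K_def lorentz_add_left intro: add_nonpos_nonpos)
    show "\<exists>x\<in>K. lorentz x h < 0" if "h \<in> E" for h
    proof -
      have "h \<noteq> 0" using fam(2) that by (auto simp: unit_normals_def)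
      then obtain y where "y \<in> P" "lorentz y h \<noteq> 0"
        using dom hyp_interior_not_orthogonal unfolding finite_volume_domain_def by blast
      then show ?thesis using P_le[of y h] that PK[of y] by force
    qed
  qed (use fam in \<open>auto simp: K_def\<close>)
  then show ?thesis unfolding K_def by blast
qed

text \<open>\<open>light u\<close> lies outside hyperbolic space, so it is approached along a
  segment from a point of the polytope, and the inequality passes to the limit.\<close>

lemma ideal_polytope_vertex:
  assumes P: "P = hyp_space \<inter> (\<Inter>e\<in>E. hyp_halfspace e)" "P = ideal_hull V" "P \<noteq> {}"
    and V: "V \<subseteq> sphere 0 1" and u: "u \<in> V" and e: "e \<in> E"
  shows "lorentz (light u) e \<le> 0"
proof -
  obtain p where p: "p \<in> P" using P(3) by blast
  then have "p \<in> hyp_space" "p \<in> ideal_hull V" using P(1,2) by auto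
  then have pH: "timelike p" "snd p /\<^sub>R fst p \<in> convex hull V"
    by (auto simp only: ideal_hull_def mem_Collect_eq intro: hyp_space_timelike)
  define q where "q = (1 / fst p) *\<^sub>R p"
  have q: "timelike q" "fst q = 1" "snd q = snd p /\<^sub>R fst p"
    using timelike_fst[OF pH(1)] timelike_scaleR[OF pH(1), of "1 / fst p"]
    by (auto simp: q_def inverse_eq_divide)
  have cu: "causal (light u)" using V u by (auto simp: causal_def)
  have "lorentz ((1 - s) *\<^sub>R light u + s *\<^sub>R q) e \<le> 0" if s: "0 < s" "s < 1" for s
  proof -
    let ?y = "(1 - s) *\<^sub>R light u + s *\<^sub>R q"
    have ty: "timelike ?y"
      using timelike_add_causal[OF timelike_scaleR[OF q(1) s(1)] causal_scaleR[OF cu, of "1 - s"]] s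
      by (simp add: add.commute)
    have "snd ?y /\<^sub>R fst ?y = (1 - s) *\<^sub>R u + s *\<^sub>R (snd p /\<^sub>R fst p)" using q by simp
    also have "\<dots> \<in> convex hull V"
      using s u pH(2) by (intro convexD[OF convex_convex_hull]) (auto intro: hull_inc)
    finally have "hyp_point ?y \<in> ideal_hull V"
      using hyp_point_in_hyp_space[OF ty] hyp_point_klein[OF ty] by (simp add: ideal_hull_def)
    then have "hyp_point ?y \<in> hyp_halfspace e" using P e by blast
    then show ?thesis using hyp_point_lorentz_iff(2)[OF ty, of e] by (simp add: hyp_halfspace_def)
  qed
  then have ev: "\<forall>\<^sub>F s in at_right 0. lorentz ((1 - s) *\<^sub>R light u + s *\<^sub>R q) e \<le> 0"
    unfolding eventually_at_right_field by (intro exI[of _ 1]) auto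
  have "((\<lambda>s. (1 - s) * lorentz (light u) e + s * lorentz q e) \<longlongrightarrow>
      (1 - 0) * lorentz (light u) e + 0 * lorentz q e) (at_right 0)"
    by (intro tendsto_intros)
  moreover have "\<forall>\<^sub>F s in at_right 0. (1 - s) * lorentz (light u) e + s * lorentz q e \<le> 0"
    using ev by eventually_elim (simp add: lorentz_simps)
  ultimately have "(1 - 0) * lorentz (light u) e + 0 * lorentz q e \<le> 0"
    by (rule tendsto_upperbound) simp
  then show ?thesis by simp
qed

theorem ideal_coxeter_cone:
  assumes cox: "coxeter_polytope P E" and V: "finite V" "V \<subseteq> sphere 0 1" "P = ideal_hull V"
  shows "ideal_cone E V"
proof -
  have poly: "hyp_polytope P E" using cox by (simp add: coxeter_polytope_def)
  then have fam: "finite E" "E \<subseteq> unit_normals" "P = hyp_space \<inter> (\<Inter>e\<in>E. hyp_halfspace e)"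
    and dom: "finite_volume_domain P"
    by (auto simp: hyp_polytope_def halfspace_family_def)
  have unit: "lorentz h h = 1" if "h \<in> E" for h using fam(2) that by (auto simp: unit_normals_def)
  have norm: "norm u = 1" if "u \<in> V" for u using V(2) that by auto
  have Pne: "P \<noteq> {}" using dom unfolding finite_volume_domain_def by auto
  have in_P: "hyp_point x \<in> P" if "timelike x" "\<forall>e\<in>E. lorentz x e \<le> 0" for x
    using that hyp_point_in_hyp_space[OF that(1)] hyp_point_lorentz_iff(2)[OF that(1)]
    unfolding fam(3) hyp_halfspace_def by auto
  have vertex: "lorentz (light u) e \<le> 0" if "u \<in> V" "e \<in> E" for u e
    using ideal_polytope_vertex[OF fam(3) V(3) Pne V(2) that] .
  have cox_angle: "\<exists>k\<ge>2. lorentz e f = - cos (pi / real k)"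
    if ef: "e \<in> E" "f \<in> E" "e \<noteq> f" and u: "u \<in> V" "u' \<in> V" "u \<noteq> u'"
      and z: "lorentz (light u) e = 0" "lorentz (light u') e = 0"
        "lorentz (light u) f = 0" "lorentz (light u') f = 0" for e f u u'
  proof -
    obtain xf where xf: "timelike xf" "lorentz xf f = 0" "lorentz xf e < 0"
      using half_spaces_facet_point[OF poly ef(2)] ef by blast
    \<comment> \<open>These vectors run along the edge between the two ideal vertices; the
      parameters \<open>1\<close> and \<open>2\<close> give the distinct points that
      \<open>meet_in_edge\<close> asks for.\<close>
    define y where "y s = light u + s *\<^sub>R light u'" for s :: real
    have ty: "timelike (y s)" if "0 < s" for s
      using two_vertices_timelike[of u u' 1 s] norm u that by (simp add: y_def)
    have yP: "hyp_point (y s) \<in> P \<inter> hyp_plane e \<inter> hyp_plane f" if "0 < s" for s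
    proof -
      have "\<forall>h\<in>E. lorentz (y s) h \<le> 0"
        using vertex u that
        by (auto simp: y_def lorentz_simps intro!: add_nonpos_nonpos mult_nonneg_nonpos)
      moreover have "lorentz (y s) e = 0" "lorentz (y s) f = 0" using z by (auto simp: y_def lorentz_simps)
      ultimately show ?thesis
        using in_P[OF ty[OF that]] hyp_point_in_hyp_space[OF ty[OF that]]
          hyp_point_lorentz_iff(1)[OF ty[OF that]] by (simp add: hyp_plane_def)
    qed
    have "hyp_point (y 1) \<noteq> hyp_point (y 2)"
    proof
      assume "hyp_point (y 1) = hyp_point (y 2)"
      then have "snd (y 1) /\<^sub>R fst (y 1) = snd (y 2) /\<^sub>R fst (y 2)"
        using hyp_point_klein[OF ty, of 1] hyp_point_klein[OF ty, of 2] by simp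
      then have "(1 / 2) *\<^sub>R (u + u') = (1 / 3) *\<^sub>R (u + 2 *\<^sub>R u')"
        by (simp add: y_def inverse_eq_divide)
      then have "6 *\<^sub>R ((1 / 2) *\<^sub>R (u + u')) = 6 *\<^sub>R ((1 / 3) *\<^sub>R (u + 2 *\<^sub>R u'))" by simp
      then have "3 *\<^sub>R u + 3 *\<^sub>R u' = 2 *\<^sub>R u + 4 *\<^sub>R u'" by (simp only: scaleR_scaleR scaleR_add_right) simp
      then have "(3 - 2) *\<^sub>R u = (4 - 3) *\<^sub>R u'" by (simp only: scaleR_diff_left) (simp add: algebra_simps)
      with u(3) show False by simp
    qed
    moreover have "hyp_plane e \<noteq> hyp_plane f"
    proof -
      have "hyp_point xf \<in> hyp_plane f" "hyp_point xf \<notin> hyp_plane e"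
        using xf hyp_point_in_hyp_space[OF xf(1)] hyp_point_lorentz_iff(1)[OF xf(1)]
        by (auto simp: hyp_plane_def)
      then show ?thesis by blast
    qed
    ultimately have "meet_in_edge P e f"
      unfolding meet_in_edge_def using yP[of 1] yP[of 2]
      by (intro conjI exI[of _ "hyp_point (y 1)"] exI[of _ "hyp_point (y 2)"]) auto
    then obtain k :: nat where k: "2 \<le> k" "dihedral_angle e f = pi / real k"
      using cox ef unfolding coxeter_polytope_def by blast
    \<comment> \<open>The angle determines the product only once the product is known to lie in the
      domain of \<open>arccos\<close>.\<close>
    have "e \<noteq> - f" using xf by (auto simp: lorentz_minus_right)
    then have "\<bar>lorentz e f\<bar> < 1"
      using unit_normals_lorentz_less[OF ty[of 1], of e f] z unit ef by (auto simp: y_def lorentz_simps)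
    then have "lorentz e f = cos (arccos (lorentz e f))" by (simp add: abs_less_iff cos_arccos)
    also have "arccos (lorentz e f) = pi - pi / real k" using k(2) by (simp add: dihedral_angle_def)
    finally have "lorentz e f = - cos (pi / real k)" by simp
    with k(1) show ?thesis by blast
  qed
  show ?thesis
  proof (unfold_locales)
    show "snd x /\<^sub>R fst x \<in> convex hull V" if "timelike x" "\<forall>e\<in>E. lorentz x e \<le> 0" for x
      using in_P[OF that] hyp_point_klein[OF that(1)] unfolding V(3) ideal_hull_def by simp
  qed (use fam(1) unit V(1) norm half_spaces_facet_point[OF poly] half_spaces_interior_point[OF poly]
        vertex cox_angle in blast)+
qed

lemma card_facets:
  assumes "hyp_polytope P E"
  shows "card (facets P E) = card E"
proof -
  have P: "P = hyp_space \<inter> (\<Inter>e\<in>E. hyp_halfspace e)"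
    using assms by (auto simp: hyp_polytope_def halfspace_family_def)
  have "inj_on (\<lambda>e. P \<inter> hyp_plane e) E"
  proof (rule inj_onI, rule ccontr)
    fix e f assume ef: "e \<in> E" "f \<in> E" "P \<inter> hyp_plane e = P \<inter> hyp_plane f" "e \<noteq> f"
    obtain x where x: "timelike x" "lorentz x e = 0" "\<forall>h\<in>E - {e}. lorentz x h < 0"
      using half_spaces_facet_point[OF assms ef(1)] by blast
    have le: "lorentz x h \<le> 0" if "h \<in> E" for h using x(2,3) that by (cases "h = e") (auto intro: less_imp_le)
    have "hyp_point x \<in> P \<inter> hyp_plane e"
      unfolding P using x(2) le hyp_point_in_hyp_space[OF x(1)] hyp_point_lorentz_iff[OF x(1)]
      by (simp add: hyp_plane_def hyp_halfspace_def)
    moreover have "lorentz x f < 0" using x(3) ef by auto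
    then have "hyp_point x \<notin> hyp_plane f" using hyp_point_lorentz_iff(1)[OF x(1), of f] by (simp add: hyp_plane_def)
    ultimately show False using ef(3) by blast
  qed
  then show ?thesis unfolding facets_def by (rule card_image)
qed

text \<open>Andreev's theorem supplies the alternative with exponent \<open>0\<close>, and interior
  points of the cone, which form an open set, separate vectors.\<close>

sublocale ideal_cone \<subseteq> reflection_system lorentz E C coxeter_exponent
proof
  show "lorentz (x + y) z = lorentz x z + lorentz y z" for x y z :: "real \<times> (real ^ 3)"
    by (rule lorentz_add_left)
  show "lorentz (c *\<^sub>R x) z = c * lorentz x z" for c and x z :: "real \<times> (real ^ 3)"
    by (rule lorentz_scaleR_left)
  show "lorentz x y = lorentz y x" for x y :: "real \<times> (real ^ 3)"
    by (rule lorentz_commute)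
  show "finite E" by (rule finite_E)
  show "lorentz e e = 1" if "e \<in> E" for e using that by (rule unit)
  show "coxeter_exponent e f = coxeter_exponent f e" for e f by (rule coxeter_exponent_commute)
  show "lorentz p e \<le> 0" if "p \<in> C" "e \<in> E" for p e using that unfolding C_def by blast
  show "2 \<le> coxeter_exponent e f \<and> lorentz e f = - cos (pi / real (coxeter_exponent e f)) \<or>
      coxeter_exponent e f = 0 \<and> lorentz e f \<le> -1" if "e \<in> E" "f \<in> E" "e \<noteq> f" for e f
  proof (cases "adjacent e f")
    case True
    then show ?thesis using coxeter_exponent_adjacent that by blast
  next
    case False
    then have "coxeter_exponent e f = 0" by (simp add: coxeter_exponent_def)
    with nonadjacent_lorentz[OF that False] show ?thesis by blast
  qed
  show "\<exists>p\<in>C. lorentz p x \<noteq> 0" if x: "x \<noteq> 0" for x :: "real \<times> (real ^ 3)"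
  proof -
    let ?N = "{p. timelike p} \<inter> (\<Inter>e\<in>E. {p. lorentz p e < 0})"
    have "open ?N"
      by (intro open_Int open_timelike open_INT finite_E ballI open_Collect_less continuous_intros)
    moreover have "?N \<noteq> {}" using interior_point by auto
    ultimately obtain p where p: "p \<in> ?N" "lorentz p x \<noteq> 0"
      using open_not_orthogonal[of ?N x] x by blast
    then have "p \<in> C" by (auto simp: C_def intro: less_imp_le)
    with p show ?thesis by blast
  qed
qed

section \<open>The reflection group acting on hyperbolic space\<close>

text \<open>Every vector is a difference of two timelike ones. Hence restricting the linear
  reflection group to hyperbolic space identifies no elements, and word lengths agree.\<close>

lemma linear_eq_on_hyp_space:
  fixes S T :: "real \<times> 'a::euclidean_space \<Rightarrow> real \<times> 'a"
  assumes "linear S" "linear T" "\<And>x. x \<in> hyp_space \<Longrightarrow> S x = T x"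
  shows "S = T"
proof
  fix x :: "real \<times> 'a"
  have *: "S y = T y" if ty: "timelike y" for y
  proof -
    obtain r where r: "0 < r" "hyp_point y = r *\<^sub>R y" using hyp_point_scale[OF ty] .
    have "S (r *\<^sub>R y) = T (r *\<^sub>R y)" using assms(3)[OF hyp_point_in_hyp_space[OF ty]] r(2) by simp
    then have "r *\<^sub>R S y = r *\<^sub>R T y" by (simp add: linear_scale[OF assms(1)] linear_scale[OF assms(2)])
    then show ?thesis using r(1) by simp
  qed
  define y :: "real \<times> 'a" where "y = (norm (snd x) + \<bar>fst x\<bar> + 1, 0)"
  have "norm (snd x) < fst x + (norm (snd x) + \<bar>fst x\<bar> + 1)" by linarith
  moreover have "0 < norm (snd x) + \<bar>fst x\<bar> + 1" using norm_ge_zero[of "snd x"] by linarith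
  ultimately have "timelike (x + y)" "timelike y"
    by (auto simp: timelike_def y_def)
  then have "S (x + y) = T (x + y)" "S y = T y" using * by blast+
  then show "S x = T x" by (simp add: linear_add[OF assms(1)] linear_add[OF assms(2)])
qed

text \<open>The reflection preserves the form, and the product of \<open>x\<close> with its image is
  negative, which keeps the image on the upper sheet.\<close>

lemma reflection_preserves_hyp_space:
  assumes e: "lorentz e e = 1" and x: "x \<in> hyp_space"
  shows "x - (2 * lorentz x e) *\<^sub>R e \<in> hyp_space"
proof -
  let ?y = "x - (2 * lorentz x e) *\<^sub>R e"
  have xx: "lorentz x x = -1" "timelike x" using x by (auto simp: hyp_space_def intro: hyp_space_timelike)
  have yy: "lorentz ?y ?y = -1"
    using e xx(1) by (simp add: lorentz_simps lorentz_commute[of e x] algebra_simps)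
  have "lorentz x ?y = -1 - 2 * (lorentz x e)\<^sup>2"
    using xx(1) by (simp add: lorentz_simps power2_eq_square)
  then have xy: "lorentz x ?y < 0" using zero_le_power2[of "lorentz x e"] by linarith
  have "causal ?y \<or> causal (- ?y)" using yy by (intro not_spacelike_causal) simp
  moreover have "\<not> causal (- ?y)"
    using causal_lorentz_le[OF timelike_causal[OF xx(2)], of "- ?y"] xy unfolding lorentz_minus_right by linarith
  moreover have "?y \<noteq> 0" using yy by auto
  ultimately have "0 < fst ?y" using causal_fst_pos by blast
  with yy show ?thesis by (simp only: hyp_space_def mem_Collect_eq)
qed

context ideal_cone
begin

abbreviation hyp_group :: "(real \<times> (real ^ 3) \<Rightarrow> real \<times> (real ^ 3)) monoid" where
  "hyp_group \<equiv> BijGroup hyp_space"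

abbreviation on_hyp :: "(real \<times> (real ^ 3) \<Rightarrow> real \<times> (real ^ 3)) \<Rightarrow> real \<times> (real ^ 3) \<Rightarrow> real \<times> (real ^ 3)" where
  "on_hyp T \<equiv> restrict T hyp_space"

lemma hyp_reflection_refl: "hyp_reflection e = on_hyp (refl e)"
  unfolding hyp_reflection_def by (rule restrict_ext) (simp add: refl_def)

lemma refl_hyp_space: "\<lbrakk>e \<in> E; x \<in> hyp_space\<rbrakk> \<Longrightarrow> refl e x \<in> hyp_space"
  unfolding refl_def using unit by (rule reflection_preserves_hyp_space)

lemma word_map_bij_hyp_space: "set w \<subseteq> E \<Longrightarrow> bij_betw (word_map w) hyp_space hyp_space"
proof (induction w)
  case (Cons e w)
  have e: "bij_betw (refl e) hyp_space hyp_space"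
  proof (rule bij_betw_byWitness)
    show "\<forall>x\<in>hyp_space. refl e (refl e x) = x" "\<forall>x\<in>hyp_space. refl e (refl e x) = x"
      using Cons.prems refl_refl[of e] by simp_all
    show "refl e ` hyp_space \<subseteq> hyp_space" "refl e ` hyp_space \<subseteq> hyp_space"
      using Cons.prems refl_hyp_space[of e] by (auto simp only: list.set insert_subset)
  qed
  show ?case
    unfolding word_map.simps by (rule bij_betw_trans[OF _ e]) (use Cons in simp)
qed (simp add: bij_betw_def)

lemma on_hyp_Bij: "set w \<subseteq> E \<Longrightarrow> on_hyp (word_map w) \<in> Bij hyp_space"
  using word_map_bij_hyp_space[of w] by (simp add: Bij_def bij_betw_cong[of hyp_space "on_hyp (word_map w)" "word_map w"])

lemma on_hyp_mult:
  assumes "set v \<subseteq> E" "set w \<subseteq> E"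
  shows "on_hyp (word_map v) \<otimes>\<^bsub>hyp_group\<^esub> on_hyp (word_map w) = on_hyp (word_map (v @ w))"
proof -
  have "word_map w x \<in> hyp_space" if "x \<in> hyp_space" for x
    using word_map_bij_hyp_space[OF assms(2)] that by (auto simp: bij_betw_def)
  then show ?thesis
    using on_hyp_Bij[OF assms(1)] on_hyp_Bij[OF assms(2)]
    by (auto simp: BijGroup_def compose_def word_map_append restrict_def fun_eq_iff)
qed

lemma one_on_hyp: "one hyp_group = on_hyp id"
  unfolding BijGroup_def id_def by simp

lemma foldr_on_hyp:
  "set w \<subseteq> E \<Longrightarrow> foldr (mult hyp_group) (map hyp_reflection w) (one hyp_group) = on_hyp (word_map w)"
proof (induction w)
  case Nil
  show ?case
    unfolding list.map foldr.simps one_on_hyp word_map.simps by (rule id_apply)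
next
  case (Cons e w)
  then have w: "set w \<subseteq> E" by simp
  have "foldr (mult hyp_group) (map hyp_reflection (e # w)) (one hyp_group)
      = on_hyp (word_map [e]) \<otimes>\<^bsub>hyp_group\<^esub> foldr (mult hyp_group) (map hyp_reflection w) (one hyp_group)"
    by (simp only: list.map foldr.simps o_apply hyp_reflection_refl word_map.simps comp_id)
  also have "\<dots> = on_hyp (word_map [e]) \<otimes>\<^bsub>hyp_group\<^esub> on_hyp (word_map w)"
    using Cons.IH[OF w] by (simp only:)
  also have "\<dots> = on_hyp (word_map ([e] @ w))"
    using Cons.prems by (intro on_hyp_mult) auto
  finally show ?case by (simp only: append.simps)
qed

lemma on_hyp_inj: "inj_on on_hyp W"
proof (rule inj_onI)
  fix S T assume *: "S \<in> W" "T \<in> W" "on_hyp S = on_hyp T"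
  show "S = T"
  proof (rule linear_eq_on_hyp_space)
    show "S x = T x" if "x \<in> hyp_space" for x
      using fun_cong[OF *(3), of x] that by simp
  qed (use * W_linear in auto)
qed

lemma word_length_on_hyp:
  assumes "T \<in> W"
  shows "word_length hyp_group (hyp_reflection ` E) (on_hyp T) = len T"
proof -
  have "(\<exists>w. length w = k \<and> set w \<subseteq> hyp_reflection ` E \<and> on_hyp T = foldr (mult hyp_group) w (one hyp_group))
      \<longleftrightarrow> (\<exists>w. length w = k \<and> set w \<subseteq> E \<and> T = word_map w)" for k
  proof
    assume "\<exists>w. length w = k \<and> set w \<subseteq> hyp_reflection ` E \<and> on_hyp T = foldr (mult hyp_group) w (one hyp_group)"
    then obtain w where w: "length w = k" "set w \<subseteq> hyp_reflection ` E"
      "on_hyp T = foldr (mult hyp_group) w (one hyp_group)" by blast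
    from w(2) have "w \<in> lists (hyp_reflection ` E)" by (simp add: lists_eq_set)
    then have "w \<in> map hyp_reflection ` lists E" by (simp only: lists_image)
    then obtain v where v: "set v \<subseteq> E" "w = map hyp_reflection v" by (auto simp: lists_eq_set)
    then have "on_hyp T = on_hyp (word_map v)" using w(3) foldr_on_hyp by simp
    then have "T = word_map v" using on_hyp_inj assms word_map_in_W[OF v(1)] by (auto dest: inj_onD)
    with v w(1) show "\<exists>w. length w = k \<and> set w \<subseteq> E \<and> T = word_map w" by auto
  next
    assume "\<exists>w. length w = k \<and> set w \<subseteq> E \<and> T = word_map w"
    then obtain w where "length w = k" "set w \<subseteq> E" "T = word_map w" by blast
    then show "\<exists>w. length w = k \<and> set w \<subseteq> hyp_reflection ` E \<and> on_hyp T = foldr (mult hyp_group) w (one hyp_group)"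
      using foldr_on_hyp by (intro exI[of _ "map hyp_reflection w"]) auto
  qed
  then show ?thesis by (simp add: word_length_def len_def)
qed

lemma generate_on_hyp: "generate hyp_group (hyp_reflection ` E) = on_hyp ` W"
proof
  show "generate hyp_group (hyp_reflection ` E) \<subseteq> on_hyp ` W"
  proof
    fix x assume "x \<in> generate hyp_group (hyp_reflection ` E)"
    then have "\<exists>w. set w \<subseteq> E \<and> x = on_hyp (word_map w)"
    proof induction
      case one
      show ?case
        by (intro exI[of _ "[]"] conjI) (simp_all only: one_on_hyp word_map.simps list.set empty_subsetI)
    next
      case (incl h)
      then obtain e where "e \<in> E" "h = hyp_reflection e" by blast
      then show ?case by (intro exI[of _ "[e]"]) (simp add: hyp_reflection_refl)
    next
      \<comment> \<open>Reflections are involutions, so the inverse of a generator is again a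
        one-letter word.\<close>
      case (inv h)
      then obtain e where e: "e \<in> E" "h = on_hyp (word_map [e])" by (auto simp: hyp_reflection_refl)
      have "h \<otimes>\<^bsub>hyp_group\<^esub> h = on_hyp (word_map ([e] @ [e]))"
        unfolding e(2) using e(1) by (intro on_hyp_mult) auto
      also have "\<dots> = one hyp_group"
        by (simp only: append.simps word_map.simps comp_id refl_comp_refl[OF e(1)] one_on_hyp)
      finally have "inv\<^bsub>hyp_group\<^esub> h = h"
        using on_hyp_Bij[of "[e]"] e by (intro group.inv_equality[OF group_BijGroup]) (auto simp: BijGroup_def)
      with e show ?case by (intro exI[of _ "[e]"]) simp
    next
      case (eng h1 h2)
      then obtain v w where "set v \<subseteq> E" "h1 = on_hyp (word_map v)" "set w \<subseteq> E" "h2 = on_hyp (word_map w)"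
        by blast
      then show ?case using on_hyp_mult by (intro exI[of _ "v @ w"]) auto
    qed
    then show "x \<in> on_hyp ` W" using word_map_in_W by blast
  qed
  have "on_hyp (word_map w) \<in> generate hyp_group (hyp_reflection ` E)" if "set w \<subseteq> E" for w
    using that
  proof (induction w)
    case Nil
    have "on_hyp (word_map []) = one hyp_group" by (simp only: one_on_hyp word_map.simps)
    then show ?case using generate.one by metis
  next
    case (Cons e w)
    then have eq: "on_hyp (word_map (e # w)) = hyp_reflection e \<otimes>\<^bsub>hyp_group\<^esub> on_hyp (word_map w)"
      using on_hyp_mult[of "[e]" w] by (simp add: hyp_reflection_refl)
    show ?case
      unfolding eq by (rule generate.eng[OF generate.incl Cons.IH]) (use Cons.prems in auto)
  qed
  then show "on_hyp ` W \<subseteq> generate hyp_group (hyp_reflection ` E)"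
    by (auto simp: W_def lists_eq_set)
qed

lemma growth_coeff_sphere_count: "growth_coeff hyp_group (hyp_reflection ` E) k = sphere_count k"
proof -
  have "{x \<in> on_hyp ` W. word_length hyp_group (hyp_reflection ` E) x = k} = on_hyp ` {T \<in> W. len T = k}"
    using word_length_on_hyp by auto
  moreover have "inj_on on_hyp {T \<in> W. len T = k}"
    using on_hyp_inj by (rule inj_on_subset) auto
  ultimately show ?thesis
    by (simp add: growth_coeff_def generate_on_hyp sphere_count_def card_image)
qed

lemma polytope_growth_rate_bounds:
  "ereal (real (card E) - 3) \<le> polytope_growth_rate E \<and>
   polytope_growth_rate E \<le> ereal (real (card E) - 1)"
  using growth_ge[OF sum_coxeter_exponents_le] growth_le card_E_ge_3
  by (simp add: polytope_growth_rate_def growth_rate_def growth_coeff_sphere_count)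

end

theorem theorem4:
  fixes P E :: "(real \<times> (real ^ 3)) set" and n :: nat
  assumes "coxeter_polytope P E"
    and "ideal_polytope P"
    and "card (facets P E) = n"
  shows "ereal (real n - 3) \<le> polytope_growth_rate E \<and>
         polytope_growth_rate E \<le> ereal (real n - 1)"
proof -
  obtain V where "finite V" "V \<subseteq> sphere 0 1" "P = ideal_hull V"
    using assms(2) unfolding ideal_polytope_def by blast
  then have "ideal_cone E V" by (rule ideal_coxeter_cone[OF assms(1)])
  moreover have "card E = n"
    using card_facets assms(1,3) by (simp add: coxeter_polytope_def)
  ultimately show ?thesis using ideal_cone.polytope_growth_rate_bounds by blast
qed

end
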